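(* Let $\Omega\subset\mathbb{C}^n$ be a bounded domain, $1\le m\le n$, $0<\gamma\le1$, $g\in\mathcal{C}(\partial\Omega)$, and let $F:\Omega\times\mathbb{R}\to\mathbb{R}^+$ be a continuous function, non-decreasing in the second variable, such that $$\sup_{|t|\le M}\ \sup_{x\ne y\in\Omega}\frac{|F^{1/m}(x,t)-F^{1/m}(y,t)|}{|x-y|^{\gamma}}<+\infty\qquad\text{for all }M>0.$$ Consider the equation $$-(dd^c\varphi)^m\wedge\beta^{n-m}+F(x,\varphi)\beta^n=0\quad\text{in }\Omega.\qquad(\ast)$$ Assume that there exist functions $u,v:\bar\Omega\to\mathbb{R}$, both $\gamma$-Hölder continuous on $\bar\Omega$, such that $u$ is a viscosity subsolution of $(\ast)$ in $\Omega$, $v$ is a viscosity supersolution of $(\ast)$ in $\Omega$, and $u=v=g$ on $\partial\Omega$. Then the unique viscosity solution of $(\ast)$ with boundary value $g$ is $\gamma$-Hölder continuous on $\bar\Omega$.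
   Context: $\mathbb{R}^+=[0,\infty)$. $dd^c=\frac{i}{\pi}\partial\bar\partial$ and $\beta=\frac{i}{\pi}\sum_j dz_j\wedge d\bar z_j$ is the standard Kähler form. A real $(1,1)$-form $\alpha$ is $m$-positive at a point if $\alpha^j\wedge\beta^{n-j}\ge 0$ there for $j=1,\dots,m$. For $q$ of class $\mathcal{C}^2$, $H_m(q)=(dd^cq)^m\wedge\beta^{n-m}$, and $[H_m(q)]_+$ at a point equals $H_m(q)$ if $dd^cq$ is $m$-positive there and $0$ otherwise. A $\mathcal{C}^2$ function $q$ defined near $x_0$ touches $w$ from above (resp. below) at $x_0$ if $q(x_0)=w(x_0)$ and $q\ge w$ (resp. $q\le w$) in a neighborhood of $x_0$. Viscosity subsolution of $(\ast)$: an upper semicontinuous $w:\Omega\to\mathbb{R}\cup\{-\infty\}$, $w\not\equiv-\infty$, such that for every $x_0\in\Omega$ and every $\mathcal{C}^2$ function $q$ touching $w$ from above at $x_0$, $H_m(q)\ge F(x,q)\beta^n$ at $x_0$. Viscosity supersolution: a lower semicontinuous $w:\Omega\to\mathbb{R}\cup\{+\infty\}$, $w\not\equiv+\infty$, such that for every $x_0\in\Omega$ and every $\mathcal{C}^2$ function $q$ touching $w$ from below at $x_0$, $[H_m(q)]_+\le F(x,q)\beta^n$ at $x_0$. Viscosity solution: a function $w:\Omega\to\mathbb{R}$ which is both (hence continuous). A function $w$ on $\Omega$ has boundary value $g$ if $\lim_{x\to\zeta}w(x)=g(\zeta)$ for every $\zeta\in\partial\Omega$; such a $w$ is regarded as a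 function on $\bar\Omega$ by setting $w=g$ on $\partial\Omega$. Under the stated hypotheses a viscosity solution of $(\ast)$ with boundary value $g$ exists and is unique. *)

theory Defs
  imports "HOL-Analysis.Analysis"
begin

text \<open>
  Complex-valued forms at a point of \<open>\<complex>\<^sup>n\<close> are alternating \<open>\<real>\<close>-multilinear maps.
  A 2-form is a function of two tangent vectors; a form of degree \<open>2 k\<close> takes a sequence of
  vectors of which only the entries \<open>0, \<dots>, 2 k - 1\<close> matter.  The wedge product is normalised by
  \<open>(a \<and> b)(v, w) = a(v) b(w) - a(w) b(v)\<close> for 1-forms.
\<close>

type_synonym 'n form2 = "complex ^ 'n \<Rightarrow> complex ^ 'n \<Rightarrow> complex"
type_synonym 'n even_form = "(nat \<Rightarrow> complex ^ 'n) \<Rightarrow> complex"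

definition dz :: "'n::finite \<Rightarrow> complex ^ 'n \<Rightarrow> complex"
  where "dz j v = v $ j"

definition dzbar :: "'n::finite \<Rightarrow> complex ^ 'n \<Rightarrow> complex"
  where "dzbar j v = cnj (v $ j)"

definition wedge1 :: "(complex ^ 'n \<Rightarrow> complex) \<Rightarrow> (complex ^ 'n \<Rightarrow> complex) \<Rightarrow> 'n::finite form2"
  where "wedge1 a b v w = a v * b w - a w * b v"

text \<open>
  The product \<open>\<alpha>\<^sub>0 \<and> \<dots> \<and> \<alpha>\<^sub>k\<^sub>-\<^sub>1\<close> of a list of 2-forms, as the antisymmetrisation of their tensor
  product.  The factor \<open>2\<^sup>-\<^sup>k\<close> belongs to the normalisation above: each factor has degree 2.
\<close>

definition wedge2 :: "'n::finite form2 list \<Rightarrow> 'n even_form"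
  where "wedge2 as v =
    (\<Sum>\<sigma> | \<sigma> permutes {..<2 * length as}.
       of_int (sign \<sigma>) * (\<Prod>i<length as. (as ! i) (v (\<sigma> (2 * i))) (v (\<sigma> (2 * i + 1)))))
    / 2 ^ length as"

definition \<beta>_form :: "'n::finite form2"
  where "\<beta>_form v w = \<i> / of_real pi * (\<Sum>j\<in>UNIV. wedge1 (dz j) (dzbar j) v w)"

text \<open>\<open>wedge_\<beta> j \<alpha>\<close> is \<open>\<alpha>\<^sup>j \<and> \<beta>\<^sup>n\<^sup>-\<^sup>j\<close>; the truncated subtraction requires \<open>j \<le> CARD('n)\<close>.\<close>

definition wedge_\<beta> :: "nat \<Rightarrow> 'n::finite form2 \<Rightarrow> 'n even_form"
  where "wedge_\<beta> j \<alpha> = wedge2 (replicate j \<alpha> @ replicate (CARD('n) - j) \<beta>_form)"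

definition \<beta>_top :: "'n::finite even_form"
  where "\<beta>_top = wedge2 (replicate CARD('n) \<beta>_form)"

text \<open>
  The order on forms of top degree: a top-degree form is nonnegative if it is a nonnegative
  multiple of the volume form \<open>\<beta>\<^sup>n\<close>.
\<close>

definition top_form_le :: "'n::finite even_form \<Rightarrow> 'n even_form \<Rightarrow> bool"
  where "top_form_le \<eta> \<theta> \<longleftrightarrow> (\<exists>c::real. c \<ge> 0 \<and> (\<forall>v. \<theta> v - \<eta> v = of_real c * \<beta>_top v))"

definition m_positive :: "nat \<Rightarrow> 'n::finite form2 \<Rightarrow> bool"
  where "m_positive m \<alpha> \<longleftrightarrow> (\<forall>j\<in>{1..m}. top_form_le (\<lambda>v. 0) (wedge_\<beta> j \<alpha>))"

definition C2_on :: "'a::real_normed_vector set \<Rightarrow> ('a \<Rightarrow> real) \<Rightarrow> bool"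
  where "C2_on U q \<longleftrightarrow>
    (\<exists>(D :: 'a \<Rightarrow> 'a \<Rightarrow>\<^sub>L real) (D2 :: 'a \<Rightarrow> 'a \<Rightarrow>\<^sub>L 'a \<Rightarrow>\<^sub>L real).
       (\<forall>x\<in>U. (q has_derivative blinfun_apply (D x)) (at x)) \<and>
       (\<forall>x\<in>U. (D has_derivative blinfun_apply (D2 x)) (at x)) \<and>
       continuous_on U D2)"

definition C2_near :: "'a::real_normed_vector \<Rightarrow> ('a \<Rightarrow> real) \<Rightarrow> bool"
  where "C2_near x q \<longleftrightarrow> (\<exists>U. open U \<and> x \<in> U \<and> C2_on U q)"

text \<open>
  Wirtinger derivatives \<open>\<partial>/\<partial>z\<^sub>j = (\<partial>/\<partial>x\<^sub>j - \<i> \<partial>/\<partial>y\<^sub>j) / 2\<close> and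
  \<open>\<partial>/\<partial>z\<^sub>j\<close>-bar \<open>= (\<partial>/\<partial>x\<^sub>j + \<i> \<partial>/\<partial>y\<^sub>j) / 2\<close>.
\<close>

definition deriv_z :: "'n::finite \<Rightarrow> (complex ^ 'n \<Rightarrow> complex) \<Rightarrow> complex ^ 'n \<Rightarrow> complex"
  where "deriv_z j f x =
    (frechet_derivative f (at x) (axis j 1) - \<i> * frechet_derivative f (at x) (axis j \<i>)) / 2"

definition deriv_zbar :: "'n::finite \<Rightarrow> (complex ^ 'n \<Rightarrow> complex) \<Rightarrow> complex ^ 'n \<Rightarrow> complex"
  where "deriv_zbar j f x =
    (frechet_derivative f (at x) (axis j 1) + \<i> * frechet_derivative f (at x) (axis j \<i>)) / 2"

definition ddc :: "(complex ^ 'n \<Rightarrow> real) \<Rightarrow> complex ^ 'n \<Rightarrow> 'n::finite form2"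
  where "ddc q x v w = \<i> / of_real pi *
    (\<Sum>j\<in>UNIV. \<Sum>k\<in>UNIV.
       deriv_z j (deriv_zbar k (\<lambda>y. of_real (q y))) x * wedge1 (dz j) (dzbar k) v w)"

definition Hess :: "nat \<Rightarrow> (complex ^ 'n \<Rightarrow> real) \<Rightarrow> complex ^ 'n \<Rightarrow> 'n::finite even_form"
  where "Hess m q x = wedge_\<beta> m (ddc q x)"

definition Hess_pos :: "nat \<Rightarrow> (complex ^ 'n \<Rightarrow> real) \<Rightarrow> complex ^ 'n \<Rightarrow> 'n::finite even_form"
  where "Hess_pos m q x = (if m_positive m (ddc q x) then Hess m q x else (\<lambda>v. 0))"

definition usc_on :: "'a::topological_space set \<Rightarrow> ('a \<Rightarrow> ereal) \<Rightarrow> bool"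
  where "usc_on S w \<longleftrightarrow> (\<forall>x\<in>S. \<forall>a. w x < a \<longrightarrow> (\<forall>\<^sub>F y in at x within S. w y < a))"

definition lsc_on :: "'a::topological_space set \<Rightarrow> ('a \<Rightarrow> ereal) \<Rightarrow> bool"
  where "lsc_on S w \<longleftrightarrow> (\<forall>x\<in>S. \<forall>a. a < w x \<longrightarrow> (\<forall>\<^sub>F y in at x within S. a < w y))"

definition touches_above ::
    "('a::real_normed_vector \<Rightarrow> real) \<Rightarrow> ('a \<Rightarrow> ereal) \<Rightarrow> 'a \<Rightarrow> bool"
  where "touches_above q w x0 \<longleftrightarrow>
    C2_near x0 q \<and> ereal (q x0) = w x0 \<and> (\<forall>\<^sub>F x in nhds x0. w x \<le> ereal (q x))"

definition touches_below ::
    "('a::real_normed_vector \<Rightarrow> real) \<Rightarrow> ('a \<Rightarrow> ereal) \<Rightarrow> 'a \<Rightarrow> bool"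
  where "touches_below q w x0 \<longleftrightarrow>
    C2_near x0 q \<and> ereal (q x0) = w x0 \<and> (\<forall>\<^sub>F x in nhds x0. ereal (q x) \<le> w x)"

text \<open>Only the values of \<open>w\<close> on \<open>\<Omega>\<close> matter, provided \<open>\<Omega>\<close> is open.\<close>

definition viscosity_subsolution ::
    "nat \<Rightarrow> (complex ^ 'n \<Rightarrow> real \<Rightarrow> real) \<Rightarrow> (complex ^ 'n::finite) set \<Rightarrow>
     (complex ^ 'n \<Rightarrow> ereal) \<Rightarrow> bool"
  where "viscosity_subsolution m F \<Omega> w \<longleftrightarrow>
    usc_on \<Omega> w \<and> (\<forall>x\<in>\<Omega>. w x \<noteq> \<infinity>) \<and> (\<exists>x\<in>\<Omega>. w x \<noteq> -\<infinity>) \<and>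
    (\<forall>x0\<in>\<Omega>. \<forall>q. touches_above q w x0 \<longrightarrow>
       top_form_le (\<lambda>v. of_real (F x0 (q x0)) * \<beta>_top v) (Hess m q x0))"

definition viscosity_supersolution ::
    "nat \<Rightarrow> (complex ^ 'n \<Rightarrow> real \<Rightarrow> real) \<Rightarrow> (complex ^ 'n::finite) set \<Rightarrow>
     (complex ^ 'n \<Rightarrow> ereal) \<Rightarrow> bool"
  where "viscosity_supersolution m F \<Omega> w \<longleftrightarrow>
    lsc_on \<Omega> w \<and> (\<forall>x\<in>\<Omega>. w x \<noteq> -\<infinity>) \<and> (\<exists>x\<in>\<Omega>. w x \<noteq> \<infinity>) \<and>
    (\<forall>x0\<in>\<Omega>. \<forall>q. touches_below q w x0 \<longrightarrow>
       top_form_le (Hess_pos m q x0) (\<lambda>v. of_real (F x0 (q x0)) * \<beta>_top v))"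

definition viscosity_solution ::
    "nat \<Rightarrow> (complex ^ 'n \<Rightarrow> real \<Rightarrow> real) \<Rightarrow> (complex ^ 'n::finite) set \<Rightarrow>
     (complex ^ 'n \<Rightarrow> real) \<Rightarrow> bool"
  where "viscosity_solution m F \<Omega> w \<longleftrightarrow>
    viscosity_subsolution m F \<Omega> (\<lambda>x. ereal (w x)) \<and>
    viscosity_supersolution m F \<Omega> (\<lambda>x. ereal (w x))"

definition has_boundary_value ::
    "'a::topological_space set \<Rightarrow> ('a \<Rightarrow> real) \<Rightarrow> ('a \<Rightarrow> real) \<Rightarrow> bool"
  where "has_boundary_value \<Omega> w g \<longleftrightarrow> (\<forall>\<zeta>\<in>frontier \<Omega>. (w \<longlongrightarrow> g \<zeta>) (at \<zeta> within \<Omega>))"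

definition extend_by_boundary_value ::
    "'a::topological_space set \<Rightarrow> ('a \<Rightarrow> real) \<Rightarrow> ('a \<Rightarrow> real) \<Rightarrow> 'a \<Rightarrow> real"
  where "extend_by_boundary_value \<Omega> w g x = (if x \<in> frontier \<Omega> then g x else w x)"

definition holder_continuous_on :: "real \<Rightarrow> 'a::metric_space set \<Rightarrow> ('a \<Rightarrow> real) \<Rightarrow> bool"
  where "holder_continuous_on \<gamma> S f \<longleftrightarrow>
    (\<exists>C. \<forall>x\<in>S. \<forall>y\<in>S. \<bar>f x - f y\<bar> \<le> C * dist x y powr \<gamma>)"

end

theory Submission
  imports Defs "HOL-Computational_Algebra.Fundamental_Theorem_Algebra"
begin

text \<open>
  The complex Hessian operator is \<open>hsym m A\<close>, the normalised \<open>m\<close>-th elementary symmetric function of the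
  eigenvalues of the Hermitian matrix \<open>A = (\<partial>\<^sup>2q / \<partial>z\<^sub>j \<partial>z\<^sub>k-bar)\<close>.  By Garding's theory of hyperbolic
  polynomials its \<open>m\<close>-th root is superadditive on the cone of \<open>m\<close>-positive matrices.  Hence the
  condition \<open>hsym m A \<ge> c\<close> on that cone is an intersection of half spaces, that is, a family of linear
  elliptic inequalities with constant coefficients.  A viscosity subsolution of such a linear inequality
  is also a subsolution after mollification, which is seen by comparison with the heat flow.
  Mollified subsolutions are therefore smooth strict subsolutions up to a small error and can serve as
  test functions for supersolutions, which gives the comparison principle without Jensen's lemma.

  Comparison gives \<open>u \<le> w \<le> v\<close>, hence the Holder estimate at the boundary.  The estimate in the
  interior follows by comparing the translate \<open>w(x + h)\<close> with \<open>w\<close> on \<open>\<Omega> \<inter> (\<Omega> - h)\<close>, after adding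
  \<open>L \<bar>h\<bar>\<^sup>\<gamma> (\<bar>x\<bar>\<^sup>2 - R\<^sup>2) - C \<bar>h\<bar>\<^sup>\<gamma>\<close>, which compensates the variation of \<open>F\<^sup>1\<^sup>/\<^sup>m\<close> in \<open>x\<close> and the boundary values.
\<close>

text \<open>The equation constrains a nonlinear function of the Hessian, while mollification
  respects only linear constraints. What makes the reduction work is that \<open>hsym_ge m c\<close>
  is stable under adding rank one matrices: the normal of a half space around it is nonnegative on
  these, so the linear problems are elliptic. A right hand side depending on x is frozen to a
  constant on a small ball. The loss in F^(1/m), at most eps/2 by uniform continuity, is repaid by
  adding eps |x|^2 to the subsolution: the complex Hessian of this term is eps times the identity,
  whose \<open>hsym m\<close> has m-th root eps, and superadditivity adds that root to the one of
  the subsolution. This is why the hypothesis on F concerns its m-th root. The definition of a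
  subsolution bounds only \<open>hsym m\<close> from below. That Hessians of test functions lie in
  the cone, where the theory of Garding applies, has to be recovered by adding nonnegative diagonal
  quadratics to the test function.\<close>

definition form_of :: "complex^'n^'n \<Rightarrow> 'n::finite form2"
  where "form_of A v w = \<i> / of_real pi *
    (\<Sum>j\<in>UNIV. \<Sum>k\<in>UNIV. A $ j $ k * wedge1 (dz j) (dzbar k) v w)"

text \<open>The coefficient of t_1 ... t_n in det (t_1 A_1 + ... + t_n A_n). Permuting rows and
  columns separately makes the symmetry in the slots visible and matches the separate dz and dz-bar
  factors of a (1,1)-form.\<close>

definition mixed_disc :: "('n::finite \<Rightarrow> complex^'n^'n) \<Rightarrow> complex"
  where "mixed_disc As = (\<Sum>\<pi> | \<pi> permutes UNIV. \<Sum>\<rho> | \<rho> permutes UNIV.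
    of_int (sign \<pi> * sign \<rho>) * (\<Prod>i\<in>UNIV. As i $ \<pi> i $ \<rho> i))"

text \<open>Slots are labelled by the index type itself. An enumeration serves only to single out
  the first k of them, and by symmetry of \<open>mixed_disc\<close> every enumeration gives the same
  \<open>hsym\<close>.\<close>

definition idx :: "'n::finite \<Rightarrow> nat"
  where "idx = (SOME h. bij_betw h UNIV {..<CARD('n)})"

definition cscale :: "complex \<Rightarrow> complex^'n^'n \<Rightarrow> complex^'n^'n"
  where "cscale c A = (\<chi> i j. c * A $ i $ j)"

text \<open>\<open>hsym k A\<close> is the mixed discriminant of \<open>k\<close> copies of \<open>A\<close> and \<open>n - k\<close> copies of the identity, normalised to
  be 1 at the identity: the \<open>k\<close>-th elementary symmetric function of the eigenvalues over \<open>n choose k\<close>.\<close>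

definition hsym :: "nat \<Rightarrow> complex^'n^'n \<Rightarrow> complex"
  where "hsym k A = mixed_disc (\<lambda>i::'n::finite. if idx i < k then A else mat 1) / fact CARD('n)"

lemma bij_idx: "bij_betw (idx :: 'n::finite \<Rightarrow> nat) UNIV {..<CARD('n)}"
proof -
  have "\<exists>h::'n \<Rightarrow> nat. bij_betw h UNIV {0..<CARD('n)}"
    by (rule ex_bij_betw_finite_nat) simp
  then show ?thesis unfolding idx_def atLeast0LessThan by (rule someI_ex)
qed

lemma idx_less [simp]: "idx (i::'n::finite) < CARD('n)"
  using bij_idx[where 'n='n] by (auto simp: bij_betw_def)

lemma idx_eq_iff [simp]: "idx (i::'n::finite) = idx j \<longleftrightarrow> i = j"
  using bij_idx[where 'n='n] by (auto simp: bij_betw_def dest: injD)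

lemma prod_idx: "(\<Prod>i<CARD('n). f i) = (\<Prod>i\<in>UNIV. f (idx (i::'n::finite)))"
  using prod.reindex_bij_betw[OF bij_idx[where 'n='n], of f] by simp

lemma card_idx_less: "k \<le> CARD('n) \<Longrightarrow> card {i::'n::finite. idx i < k} = k"
proof -
  assume "k \<le> CARD('n)"
  then have "bij_betw (idx :: 'n \<Rightarrow> nat) {i. idx i < k} {..<k}"
  proof (intro bij_betw_imageI inj_onI set_eqI iffI)
    fix x assume "x \<in> {..<k}"
    moreover have "{..<CARD('n)} = range (idx :: 'n \<Rightarrow> nat)"
      using bij_idx[where 'n='n] by (simp add: bij_betw_def)
    ultimately have "x \<in> range (idx :: 'n \<Rightarrow> nat)" using \<open>k \<le> CARD('n)\<close> by auto
    then obtain i :: 'n where "x = idx i" by blast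
    then show "x \<in> idx ` {i::'n. idx i < k}" using \<open>x \<in> {..<k}\<close> by auto
  qed auto
  then show ?thesis using bij_betw_same_card by fastforce
qed

subsection \<open>Mixed discriminants\<close>

text \<open>Composing both summation permutations with \<open>\<tau>\<close> reindexes the product,
  and the sign of \<open>\<tau>\<close> enters twice and cancels.\<close>

lemma mixed_disc_permute:
  assumes "bij (\<tau> :: 'n::finite \<Rightarrow> 'n)"
  shows "mixed_disc (As \<circ> \<tau>) = mixed_disc As"
proof -
  have \<tau>: "\<tau> permutes UNIV" using assms by (intro bij_imp_permutes) auto
  have inv: "inv \<tau> permutes UNIV" using \<tau> by (rule permutes_inv)
  have sg: "sign (\<pi> \<circ> \<tau>) * sign (\<rho> \<circ> \<tau>) = sign \<pi> * sign \<rho>"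
    if "\<pi> permutes UNIV" "\<rho> permutes UNIV" for \<pi> \<rho> :: "'n \<Rightarrow> 'n"
  proof -
    have "sign (\<pi> \<circ> \<tau>) * sign (\<rho> \<circ> \<tau>) = sign \<pi> * sign \<rho> * (sign \<tau> * sign \<tau>)"
      using that \<tau> by (simp only: sign_compose permutes_imp_permutation[OF finite_class.finite_UNIV] mult_ac)
    then show ?thesis by simp
  qed
  have pr: "(\<Prod>i\<in>UNIV. (As \<circ> \<tau>) i $ (\<pi> \<circ> \<tau>) i $ (\<rho> \<circ> \<tau>) i) = (\<Prod>i\<in>UNIV. As i $ \<pi> i $ \<rho> i)"
    for \<pi> \<rho> :: "'n \<Rightarrow> 'n"
    using prod.reindex_bij_betw[OF assms, of "\<lambda>i. As i $ \<pi> i $ \<rho> i"] by simp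
  have "mixed_disc (As \<circ> \<tau>) = (\<Sum>\<pi> | \<pi> permutes UNIV. \<Sum>\<rho> | \<rho> permutes UNIV.
    of_int (sign (\<pi> \<circ> \<tau>) * sign (\<rho> \<circ> \<tau>)) * (\<Prod>i\<in>UNIV. (As \<circ> \<tau>) i $ (\<pi> \<circ> \<tau>) i $ (\<rho> \<circ> \<tau>) i))"
    unfolding mixed_disc_def
    by (subst sum_permutations_compose_right[OF \<tau>], subst (2) sum_permutations_compose_right[OF \<tau>]) simp
  also have "\<dots> = mixed_disc As"
    unfolding mixed_disc_def pr by (intro sum.cong refl) (simp only: mem_Collect_eq sg)
  finally show ?thesis .
qed

text \<open>Replacing rho by its composition with pi turns the inner sum into the Leibniz formula
  for every pi, and there are n! of these.\<close>

lemma mixed_disc_const: "mixed_disc (\<lambda>i::'n::finite. A) = fact CARD('n) * det A"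
proof -
  have "(\<Sum>\<rho> | \<rho> permutes UNIV. of_int (sign \<pi> * sign \<rho>) * (\<Prod>i\<in>UNIV. A $ \<pi> i $ \<rho> i)) = det A"
    if \<pi>: "\<pi> permutes UNIV" for \<pi> :: "'n \<Rightarrow> 'n"
  proof -
    have "(\<Sum>\<rho> | \<rho> permutes UNIV. of_int (sign \<pi> * sign \<rho>) * (\<Prod>i\<in>UNIV. A $ \<pi> i $ \<rho> i))
      = (\<Sum>\<rho> | \<rho> permutes UNIV. of_int (sign \<pi> * sign (\<rho> \<circ> \<pi>)) * (\<Prod>i\<in>UNIV. A $ \<pi> i $ (\<rho> \<circ> \<pi>) i))"
      by (rule sum_permutations_compose_right[OF \<pi>])
    also have "\<dots> = det A"
      unfolding det_def
    proof (intro sum.cong refl)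
      fix \<rho> :: "'n \<Rightarrow> 'n" assume \<rho>: "\<rho> \<in> {p. p permutes UNIV}"
      have s: "sign \<pi> * sign (\<rho> \<circ> \<pi>) = sign \<rho>"
        using \<rho> \<pi> by (simp add: sign_compose permutes_imp_permutation[OF finite_class.finite_UNIV]
            mult.left_commute[of "sign \<pi>"])
      have p: "(\<Prod>i\<in>UNIV. A $ \<pi> i $ (\<rho> \<circ> \<pi>) i) = (\<Prod>i\<in>UNIV. A $ i $ \<rho> i)"
        using prod.reindex_bij_betw[OF permutes_bij[OF \<pi>], of "\<lambda>i. A $ i $ \<rho> i"] by simp
      show "of_int (sign \<pi> * sign (\<rho> \<circ> \<pi>)) * (\<Prod>i\<in>UNIV. A $ \<pi> i $ (\<rho> \<circ> \<pi>) i)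
        = of_int (sign \<rho>) * (\<Prod>i\<in>UNIV. A $ i $ \<rho> i)" unfolding s p ..
    qed
    finally show ?thesis .
  qed
  then show ?thesis unfolding mixed_disc_def
    by (simp add: card_permutations)
qed

lemma mixed_disc_scale:
  "mixed_disc (\<lambda>i. cscale (c i) (As i)) = (\<Prod>i\<in>UNIV. c i) * mixed_disc As" for c :: "'n::finite \<Rightarrow> complex"
  unfolding mixed_disc_def cscale_def
  by (simp add: prod.distrib sum_distrib_left mult.left_commute)

text \<open>Multilinearity in all slots of J at once; S is the set of slots that receive A.\<close>

lemma mixed_disc_add:
  fixes A B C :: "'n::finite \<Rightarrow> complex^'n^'n"
  shows "mixed_disc (\<lambda>i. if i \<in> J then A i + B i else C i)
    = (\<Sum>S\<in>Pow J. mixed_disc (\<lambda>i. if i \<in> S then A i else if i \<in> J then B i else C i))"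
proof -
  have *: "(\<Prod>i\<in>UNIV. (if i \<in> J then A i + B i else C i) $ \<pi> i $ \<rho> i)
    = (\<Sum>S\<in>Pow J. (\<Prod>i\<in>UNIV. (if i \<in> S then A i else if i \<in> J then B i else C i) $ \<pi> i $ \<rho> i))"
    for \<pi> \<rho> :: "'n \<Rightarrow> 'n"
  proof -
    have "(\<Prod>i\<in>UNIV. (if i \<in> J then A i + B i else C i) $ \<pi> i $ \<rho> i)
      = (\<Prod>i\<in>J. A i $ \<pi> i $ \<rho> i + B i $ \<pi> i $ \<rho> i) * (\<Prod>i\<in>-J. C i $ \<pi> i $ \<rho> i)"
    proof -
      let ?f = "\<lambda>i. (if i \<in> J then A i + B i else C i) $ \<pi> i $ \<rho> i"
      have u: "UNIV = J \<union> - J" by auto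
      have "prod ?f UNIV = prod ?f J * prod ?f (-J)"
        by (subst u, rule prod.union_disjoint) auto
      moreover have "prod ?f J = (\<Prod>i\<in>J. A i $ \<pi> i $ \<rho> i + B i $ \<pi> i $ \<rho> i)" by (rule prod.cong) auto
      moreover have "prod ?f (-J) = (\<Prod>i\<in>-J. C i $ \<pi> i $ \<rho> i)" by (rule prod.cong) auto
      ultimately show ?thesis by simp
    qed
    also have "\<dots> = (\<Sum>S\<in>Pow J. ((\<Prod>i\<in>S. A i $ \<pi> i $ \<rho> i) * (\<Prod>i\<in>J-S. B i $ \<pi> i $ \<rho> i)) * (\<Prod>i\<in>-J. C i $ \<pi> i $ \<rho> i))"
      by (simp add: prod_add sum_distrib_right)
    also have "\<dots> = (\<Sum>S\<in>Pow J. (\<Prod>i\<in>UNIV. (if i \<in> S then A i else if i \<in> J then B i else C i) $ \<pi> i $ \<rho> i))"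
    proof (intro sum.cong refl)
      fix S assume S: "S \<in> Pow J"
      have u: "UNIV = (S \<union> (J - S)) \<union> -J" using S by auto
      let ?f = "\<lambda>i. (if i \<in> S then A i else if i \<in> J then B i else C i) $ \<pi> i $ \<rho> i"
      have "prod ?f UNIV = prod ?f S * prod ?f (J - S) * prod ?f (-J)"
        by (subst u, subst prod.union_disjoint, simp, simp, use S in blast,
            subst prod.union_disjoint) auto
      moreover have "prod ?f S = (\<Prod>i\<in>S. A i $ \<pi> i $ \<rho> i)" by (rule prod.cong) auto
      moreover have "prod ?f (J - S) = (\<Prod>i\<in>J-S. B i $ \<pi> i $ \<rho> i)" by (rule prod.cong) auto
      moreover have "prod ?f (-J) = (\<Prod>i\<in>-J. C i $ \<pi> i $ \<rho> i)" using S by (intro prod.cong) auto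
      ultimately show "(\<Prod>i\<in>S. A i $ \<pi> i $ \<rho> i) * (\<Prod>i\<in>J-S. B i $ \<pi> i $ \<rho> i) * (\<Prod>i\<in>-J. C i $ \<pi> i $ \<rho> i)
        = prod ?f UNIV" by simp
    qed
    finally show ?thesis .
  qed
  have "mixed_disc (\<lambda>i. if i \<in> J then A i + B i else C i) =
    (\<Sum>\<pi> | \<pi> permutes UNIV. \<Sum>\<rho> | \<rho> permutes UNIV. \<Sum>S\<in>Pow J. of_int (sign \<pi> * sign \<rho>) *
       (\<Prod>i\<in>UNIV. (if i \<in> S then A i else if i \<in> J then B i else C i) $ \<pi> i $ \<rho> i))"
    unfolding mixed_disc_def * sum_distrib_left ..
  also have "\<dots> = (\<Sum>\<pi> | \<pi> permutes UNIV. \<Sum>S\<in>Pow J. \<Sum>\<rho> | \<rho> permutes UNIV. of_int (sign \<pi> * sign \<rho>) *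
       (\<Prod>i\<in>UNIV. (if i \<in> S then A i else if i \<in> J then B i else C i) $ \<pi> i $ \<rho> i))"
    by (rule sum.cong[OF refl], rule sum.swap)
  also have "\<dots> = (\<Sum>S\<in>Pow J. mixed_disc (\<lambda>i. if i \<in> S then A i else if i \<in> J then B i else C i))"
    unfolding mixed_disc_def by (rule sum.swap)
  finally show ?thesis .
qed

text \<open>By symmetry only the number of slots holding A matters. This collapses sums over subsets
  of slots to sums over their cardinality.\<close>

lemma hsym_subset:
  fixes A :: "complex^'n::finite^'n" and J :: "'n set"
  assumes "card J = k"
  shows "mixed_disc (\<lambda>i. if i \<in> J then A else mat 1) = fact CARD('n) * hsym k A"
proof -
  let ?K = "{i::'n. idx i < k}"
  have k: "k \<le> CARD('n)" using assms card_mono[of UNIV J] by simp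
  have c: "card J = card ?K" using card_idx_less[OF k] assms by simp
  obtain f where f: "bij_betw f J ?K" using finite_same_card_bij[OF _ _ c] by auto
  have c': "card (-J) = card (-?K)" using c by (simp add: card_Diff_subset Compl_eq_Diff_UNIV)
  obtain g where g: "bij_betw g (-J) (-?K)" using finite_same_card_bij[OF _ _ c'] by auto
  let ?t = "\<lambda>i. if i \<in> J then f i else g i"
  have "bij_betw ?t (J \<union> -J) (?K \<union> -?K)"
    by (rule bij_betw_combine)
      (use f g in \<open>auto simp: bij_betw_def inj_on_def\<close>)
  then have t: "bij ?t" by simp
  have "idx (?t i) < k \<longleftrightarrow> i \<in> J" for i
    using f g by (auto simp: bij_betw_def)
  then have "(\<lambda>i. if i \<in> J then A else mat 1) = (\<lambda>i. if idx i < k then A else mat 1) \<circ> ?t"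
    by (auto simp: fun_eq_iff)
  then show ?thesis by (simp only: mixed_disc_permute[OF t] hsym_def) simp
qed

lemma hsym_0: "hsym 0 (A::complex^'n::finite^'n) = 1"
  unfolding hsym_def by (simp add: mixed_disc_const)

lemma hsym_full: "hsym CARD('n) (A::complex^'n::finite^'n) = det A"
  unfolding hsym_def by (simp add: mixed_disc_const)

lemma hsym_add_scaled:
  fixes M B :: "complex^'n::finite^'n"
  shows "hsym k (M + cscale t B) = (\<Sum>S\<in>Pow {i. idx i < k}. t ^ card S *
     mixed_disc (\<lambda>i. if i \<in> S then B else if idx i < k then M else mat 1)) / fact CARD('n)"
proof -
  have "hsym k (M + cscale t B) = mixed_disc (\<lambda>i. if i \<in> {i. idx i < k} then cscale t B + M else mat 1) / fact CARD('n)"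
    unfolding hsym_def by (simp only: add.commute[of M] mem_Collect_eq)
  also have "\<dots> = (\<Sum>S\<in>Pow {i. idx i < k}. mixed_disc (\<lambda>i. if i \<in> S then cscale t B else if i \<in> {i. idx i < k} then M else mat 1)) / fact CARD('n)"
    by (subst mixed_disc_add) simp
  also have "(\<Sum>S\<in>Pow {i. idx i < k}. mixed_disc (\<lambda>i. if i \<in> S then cscale t B else if i \<in> {i. idx i < k} then M else mat 1))
    = (\<Sum>S\<in>Pow {i. idx i < k}. t ^ card S * mixed_disc (\<lambda>i. if i \<in> S then B else if idx i < k then M else mat 1))"
  proof (intro sum.cong refl)
    fix S :: "'n set"
    have "mixed_disc (\<lambda>i. if i \<in> S then cscale t B else if i \<in> {i. idx i < k} then M else mat 1)
      = mixed_disc (\<lambda>i. cscale (if i \<in> S then t else 1) (if i \<in> S then B else if idx i < k then M else mat 1))"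
      by (rule arg_cong[where f=mixed_disc]) (auto simp: fun_eq_iff cscale_def vec_eq_iff)
    also have "\<dots> = (\<Prod>i\<in>UNIV. if i \<in> S then t else 1) * mixed_disc (\<lambda>i. if i \<in> S then B else if idx i < k then M else mat 1)"
      by (rule mixed_disc_scale)
    also have "(\<Prod>i\<in>UNIV. if i \<in> S then t else 1) = t ^ card S"
      by (simp add: prod.If_cases)
    finally show "mixed_disc (\<lambda>i. if i \<in> S then cscale t B else if i \<in> {i. idx i < k} then M else mat 1)
      = t ^ card S * mixed_disc (\<lambda>i. if i \<in> S then B else if idx i < k then M else mat 1)" .
  qed
  finally show ?thesis .
qed

text \<open>Subsets of slots are grouped by size. As for elementary symmetric functions of shifted
  eigenvalues, the coefficients are again values of \<open>hsym\<close>, so that differentiation in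
  s leads from k to k - 1.\<close>

lemma hsym_add_id:
  fixes A :: "complex^'n::finite^'n"
  assumes "k \<le> CARD('n)"
  shows "hsym k (A + cscale s (mat 1)) = (\<Sum>j\<le>k. of_nat (k choose j) * s ^ (k - j) * hsym j A)"
proof -
  let ?K = "{i::'n. idx i < k}"
  have cK: "card ?K = k" using assms by (rule card_idx_less)
  have "(\<Sum>S\<in>Pow ?K. s ^ card S *
     mixed_disc (\<lambda>i. if i \<in> S then mat 1 else if idx i < k then A else mat 1))
    = (\<Sum>S\<in>Pow ?K. s ^ card S * (fact CARD('n) * hsym (k - card S) A))"
  proof (intro sum.cong refl arg_cong2[where f="(*)"])
    fix S assume S: "S \<in> Pow ?K"
    have "(\<lambda>i. if i \<in> S then mat 1 else if idx i < k then A else mat 1)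
      = (\<lambda>i. if i \<in> ?K - S then A else mat 1)" by (auto simp: fun_eq_iff)
    moreover have "card (?K - S) = k - card S" using S cK by (subst card_Diff_subset) auto
    ultimately show "mixed_disc (\<lambda>i. if i \<in> S then mat 1 else if idx i < k then A else mat 1)
      = fact CARD('n) * hsym (k - card S) A" by (simp only: hsym_subset)
  qed
  also have "\<dots> = (\<Sum>j\<le>k. \<Sum>S\<in>{S. S \<in> Pow ?K \<and> card S = j}. s ^ card S * (fact CARD('n) * hsym (k - card S) A))"
    by (subst sum.group) (auto simp: cK intro: card_mono[of ?K, simplified cK])
  also have "\<dots> = (\<Sum>j\<le>k. of_nat (k choose j) * (s ^ j * (fact CARD('n) * hsym (k - j) A)))"
  proof (intro sum.cong refl)
    fix j
    have "card {S. S \<in> Pow ?K \<and> card S = j} = k choose j"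
      using n_subsets[of ?K j] cK by simp
    then show "(\<Sum>S\<in>{S. S \<in> Pow ?K \<and> card S = j}. s ^ card S * (fact CARD('n) * hsym (k - card S) A))
      = of_nat (k choose j) * (s ^ j * (fact CARD('n) * hsym (k - j) A))" by simp
  qed
  finally have "hsym k (A + cscale s (mat 1)) = (\<Sum>j\<le>k. of_nat (k choose j) * (s ^ j * (fact CARD('n) * hsym (k - j) A))) / fact CARD('n)"
    unfolding hsym_add_scaled by simp
  also have "\<dots> = (\<Sum>j\<le>k. of_nat (k choose j) * s ^ j * hsym (k - j) A)"
    by (simp add: sum_divide_distrib mult.assoc)
  also have "\<dots> = (\<Sum>j\<le>k. of_nat (k choose (k - j)) * s ^ (k - j) * hsym (k - (k - j)) A)"
    by (rule sum.reindex_bij_witness[of _ "\<lambda>j. k - j" "\<lambda>j. k - j"]) auto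
  also have "\<dots> = (\<Sum>j\<le>k. of_nat (k choose j) * s ^ (k - j) * hsym j A)"
    by (intro sum.cong refl) (auto simp: binomial_symmetric[symmetric])
  finally show ?thesis .
qed


subsection \<open>Powers of (1,1)-forms\<close>

text \<open>The value on v of the wedge product of dz_(F i) and dz-bar_(G i) over all slots i. Only
  one of the two orders in each slot is kept, so no power of 2 appears.\<close>

definition alt_prod ::
    "(nat \<Rightarrow> complex ^ 'n) \<Rightarrow> ('n::finite \<Rightarrow> 'n) \<Rightarrow> ('n \<Rightarrow> 'n) \<Rightarrow> complex"
  where "alt_prod v F G = (\<Sum>\<sigma> | \<sigma> permutes {..<2 * CARD('n)}. of_int (sign \<sigma>) *
    (\<Prod>i\<in>UNIV. v (\<sigma> (2 * idx i)) $ F i * cnj (v (\<sigma> (2 * idx i + 1)) $ G i)))"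

lemma sum_permutes_transpose:
  fixes f :: "(nat \<Rightarrow> nat) \<Rightarrow> complex"
  assumes "a < n" "b < n" "a \<noteq> b"
  shows "(\<Sum>\<sigma> | \<sigma> permutes {..<n}. of_int (sign \<sigma>) * f (\<sigma> \<circ> Transposition.transpose a b))
    = - (\<Sum>\<sigma> | \<sigma> permutes {..<n}. of_int (sign \<sigma>) * f \<sigma>)"
proof -
  have t: "Transposition.transpose a b permutes {..<n}" using assms by (intro permutes_swap_id) auto
  have "(\<Sum>\<sigma> | \<sigma> permutes {..<n}. of_int (sign \<sigma>) * f \<sigma>)
    = (\<Sum>\<sigma> | \<sigma> permutes {..<n}. of_int (sign (\<sigma> \<circ> Transposition.transpose a b)) * f (\<sigma> \<circ> Transposition.transpose a b))"
    by (rule sum_permutations_compose_right[OF t])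
  also have "\<dots> = (\<Sum>\<sigma> | \<sigma> permutes {..<n}. - (of_int (sign \<sigma>) * f (\<sigma> \<circ> Transposition.transpose a b)))"
    using assms by (intro sum.cong refl)
      (auto simp: sign_compose sign_swap_id permutation_swap_id permutes_imp_permutation[of "{..<n}"])
  finally show ?thesis by (simp add: sum_negf)
qed

text \<open>Swapping the two arguments of slot i is an odd permutation, so the subtracted term
  contributes as much as the first one and every slot gives a factor 2. This is where the power of 2
  in \<open>wedge2\<close> cancels.\<close>

lemma sum_permutes_antisymmetrise:
  fixes X :: "'n::finite \<Rightarrow> nat \<Rightarrow> nat \<Rightarrow> complex"
  shows "(\<Sum>\<sigma> | \<sigma> permutes {..<2 * CARD('n)}. of_int (sign \<sigma>) *
      (\<Prod>i\<in>UNIV. X i (\<sigma> (2 * idx i)) (\<sigma> (2 * idx i + 1)) - X i (\<sigma> (2 * idx i + 1)) (\<sigma> (2 * idx i))))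
    = 2 ^ CARD('n) * (\<Sum>\<sigma> | \<sigma> permutes {..<2 * CARD('n)}. of_int (sign \<sigma>) *
      (\<Prod>i\<in>UNIV. X i (\<sigma> (2 * idx i)) (\<sigma> (2 * idx i + 1))))"
proof -
  \<comment> \<open>Slots in S are already reduced to their first term; the claim follows by
    enlarging S one slot at a time.\<close>
  define P where "P S \<sigma> = (\<Prod>i\<in>UNIV. if i \<in> S then X i (\<sigma> (2 * idx i)) (\<sigma> (2 * idx i + 1))
     else X i (\<sigma> (2 * idx i)) (\<sigma> (2 * idx i + 1)) - X i (\<sigma> (2 * idx i + 1)) (\<sigma> (2 * idx i)))"
    for S :: "'n set" and \<sigma> :: "nat \<Rightarrow> nat"
  define Q where "Q S = (\<Sum>\<sigma> | \<sigma> permutes {..<2 * CARD('n)}. of_int (sign \<sigma>) * P S \<sigma>)" for S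
  have step: "Q S = 2 * Q (insert k S)" if k: "k \<notin> S" for S k
  proof -
    let ?t = "Transposition.transpose (2 * idx k) (2 * idx k + 1)"
    have P: "P S \<sigma> = P (insert k S) \<sigma> - P (insert k S) (\<sigma> \<circ> ?t)" for \<sigma>
    proof -
      let ?R = "\<lambda>S \<sigma>. (\<Prod>i\<in>UNIV-{k}. if i \<in> S then X i (\<sigma> (2 * idx i)) (\<sigma> (2 * idx i + 1))
     else X i (\<sigma> (2 * idx i)) (\<sigma> (2 * idx i + 1)) - X i (\<sigma> (2 * idx i + 1)) (\<sigma> (2 * idx i)))"
      have t: "?t (2 * idx i) = 2 * idx i" "?t (2 * idx i + 1) = 2 * idx i + 1" if "i \<noteq> k" for i
      proof -
        have "idx i \<noteq> idx k" using that by simp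
        then have "2 * idx i \<noteq> 2 * idx k" "2 * idx i \<noteq> 2 * idx k + 1"
           "2 * idx i + 1 \<noteq> 2 * idx k" "2 * idx i + 1 \<noteq> 2 * idx k + 1" by presburger+
        then show "?t (2 * idx i) = 2 * idx i" "?t (2 * idx i + 1) = 2 * idx i + 1"
          by (auto intro!: transpose_apply_other)
      qed
      have 1: "?R (insert k S) \<sigma> = ?R S \<sigma>" by (rule prod.cong) auto
      have 2: "?R (insert k S) (\<sigma> \<circ> ?t) = ?R S \<sigma>"
        by (rule prod.cong) (auto simp del: One_nat_def simp: t[simplified])
      show ?thesis
        unfolding P_def prod.remove[OF finite_class.finite_UNIV UNIV_I[of k]] 1 2
        using k by (simp add: algebra_simps)
    qed
    have "Q S = Q (insert k S) - (\<Sum>\<sigma> | \<sigma> permutes {..<2 * CARD('n)}. of_int (sign \<sigma>) * P (insert k S) (\<sigma> \<circ> ?t))"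
      unfolding Q_def P by (simp add: algebra_simps sum_subtractf)
    also have "(\<Sum>\<sigma> | \<sigma> permutes {..<2 * CARD('n)}. of_int (sign \<sigma>) * P (insert k S) (\<sigma> \<circ> ?t)) = - Q (insert k S)"
      unfolding Q_def using idx_less[of k] by (intro sum_permutes_transpose) linarith+
    finally show ?thesis by simp
  qed
  have "Q {} = 2 ^ card S * Q S" for S
    by (induction S rule: finite_induct[OF finite_class.finite]) (auto simp: step)
  from this[of UNIV] show ?thesis unfolding Q_def P_def by simp
qed

text \<open>Exchanging two dz factors amounts to exchanging the argument positions
  \<open>2 * idx a\<close> and \<open>2 * idx b\<close>, exchanging two dz-bar factors to exchanging
  the odd positions next to them; both are odd permutations.\<close>

lemma alt_prod_transpose:
  fixes F G :: "'n::finite \<Rightarrow> 'n"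
  assumes "a \<noteq> b"
  shows "alt_prod v (F \<circ> Transposition.transpose a b) G = - alt_prod v F G"
    and "alt_prod v F (G \<circ> Transposition.transpose a b) = - alt_prod v F G"
proof -
  define f where "f \<sigma> = (\<Prod>i\<in>UNIV. v (\<sigma> (2 * idx i)) $ F i * cnj (v (\<sigma> (2 * idx i + 1)) $ G i))" for \<sigma>
  let ?s = "Transposition.transpose a b" and ?t0 = "Transposition.transpose (2 * idx a) (2 * idx b)"
    and ?t1 = "Transposition.transpose (2 * idx a + 1) (2 * idx b + 1)"
  have ab: "idx a \<noteq> idx b" using assms by simp
  have bij: "bij ?s" by simp
  have t00: "?t0 (2 * idx i) = 2 * idx (?s i)" for i
    using ab by (auto simp: Transposition.transpose_def)
  have t01: "?t0 (2 * idx i + 1) = 2 * idx i + 1" for i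
    by (rule transpose_apply_other) presburger+
  have t10: "?t1 (2 * idx i) = 2 * idx i" for i
    by (rule transpose_apply_other) presburger+
  have t11: "?t1 (2 * idx i + 1) = 2 * idx (?s i) + 1" for i
    using ab by (auto simp: Transposition.transpose_def)
  have 0: "f (\<sigma> \<circ> ?t0) = (\<Prod>i\<in>UNIV. v (\<sigma> (2 * idx i)) $ (F \<circ> ?s) i * cnj (v (\<sigma> (2 * idx i + 1)) $ G i))" for \<sigma>
    unfolding f_def o_def t00 t01 prod.distrib
    using prod.reindex_bij_betw[OF bij, of "\<lambda>i. v (\<sigma> (2 * idx (?s i))) $ F i"]
    by simp
  have 1: "f (\<sigma> \<circ> ?t1) = (\<Prod>i\<in>UNIV. v (\<sigma> (2 * idx i)) $ F i * cnj (v (\<sigma> (2 * idx i + 1)) $ (G \<circ> ?s) i))" for \<sigma>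
    unfolding f_def o_def t10 t11 prod.distrib
    using prod.reindex_bij_betw[OF bij, of "\<lambda>i. cnj (v (\<sigma> (2 * idx (?s i) + 1)) $ G i)"]
    by simp
  show "alt_prod v (F \<circ> ?s) G = - alt_prod v F G"
    unfolding alt_prod_def 0[symmetric] f_def[symmetric]
    by (rule sum_permutes_transpose) (use ab in auto)
  have lt: "2 * idx i + 1 < 2 * CARD('n)" for i :: 'n using idx_less[of i] by linarith
  show "alt_prod v F (G \<circ> ?s) = - alt_prod v F G"
    unfolding alt_prod_def 1[symmetric] f_def[symmetric]
    by (rule sum_permutes_transpose) (use ab lt in auto)
qed

lemma alt_prod_permutes:
  fixes F G :: "'n::finite \<Rightarrow> 'n"
  assumes "\<pi> permutes UNIV"
  shows "alt_prod v (F \<circ> \<pi>) G = of_int (sign \<pi>) * alt_prod v F G"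
    and "alt_prod v F (G \<circ> \<pi>) = of_int (sign \<pi>) * alt_prod v F G"
proof -
  have "alt_prod v (F \<circ> \<pi>) G = of_int (sign \<pi>) * alt_prod v F G \<and>
    alt_prod v F (G \<circ> \<pi>) = of_int (sign \<pi>) * alt_prod v F G"
    using finite_class.finite_UNIV assms
  proof (induction rule: permutes_rev_induct)
    case (swap a b p)
    have "sign (p \<circ> Transposition.transpose a b) = - sign p"
      using swap.hyps by (simp only: sign_compose sign_swap_id permutation_swap_id
          permutes_imp_permutation[OF finite_class.finite_UNIV]) simp
    then show ?case
      using swap.IH by (simp only: o_assoc alt_prod_transpose(1)[OF swap.hyps(3), of v "F \<circ> p"]
          alt_prod_transpose(2)[OF swap.hyps(3), of v F "G \<circ> p"]) simp
  qed (simp add: sign_id)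
  then show "alt_prod v (F \<circ> \<pi>) G = of_int (sign \<pi>) * alt_prod v F G"
    "alt_prod v F (G \<circ> \<pi>) = of_int (sign \<pi>) * alt_prod v F G" by auto
qed

text \<open>Some differential is repeated: exchanging the two slots that carry it changes the sign
  but not the expression.\<close>

lemma alt_prod_not_permutes:
  fixes F G :: "'n::finite \<Rightarrow> 'n"
  assumes "\<not> F permutes UNIV \<or> \<not> G permutes UNIV"
  shows "alt_prod v F G = 0"
proof -
  have *: "\<exists>a b. a \<noteq> b \<and> H \<circ> Transposition.transpose a b = H" if "\<not> H permutes UNIV" for H :: "'n \<Rightarrow> 'n"
  proof -
    have "\<not> inj H"
      using that finite_UNIV_inj_surj[of H] bij_imp_permutes[of H UNIV] by (auto simp: bij_def)
    then obtain a b where ab: "a \<noteq> b" "H a = H b" by (auto simp: inj_def)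
    then have "H \<circ> Transposition.transpose a b = H" by (auto simp: fun_eq_iff Transposition.transpose_def)
    then show ?thesis using ab by auto
  qed
  from assms show ?thesis
  proof
    assume "\<not> F permutes UNIV"
    then obtain a b where "a \<noteq> b" "F \<circ> Transposition.transpose a b = F" using * by blast
    then show ?thesis using alt_prod_transpose(1)[of a b v F G] by simp
  next
    assume "\<not> G permutes UNIV"
    then obtain a b where "a \<noteq> b" "G \<circ> Transposition.transpose a b = G" using * by blast
    then show ?thesis using alt_prod_transpose(2)[of a b v F G] by simp
  qed
qed

text \<open>Each factor is expanded in coordinates, F i and G i being the indices chosen in slot i.
  Repeated indices vanish, and sorting the others into a fixed order produces the two signs of the
  mixed discriminant.\<close>

lemma wedge2_form_of:
  fixes L :: "'n::finite form2 list" and As :: "'n \<Rightarrow> complex^'n^'n"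
  assumes len: "length L = CARD('n)" and L: "\<And>i. L ! idx i = form_of (As i)"
  shows "wedge2 L v = (\<i> / of_real pi) ^ CARD('n) * alt_prod v id id * mixed_disc As"
proof -
  let ?c = "\<i> / of_real pi :: complex"
  let ?N = "{\<sigma>. \<sigma> permutes {..<2 * CARD('n)}}"
  define X where "X i a b = (\<Sum>j\<in>UNIV. \<Sum>k\<in>UNIV. As i $ j $ k * (v a $ j * cnj (v b $ k)))" for i a b
  have form: "form_of (As i) (v a) (v b) = ?c * (X i a b - X i b a)" for i a b
    unfolding form_of_def X_def wedge1_def dz_def dzbar_def
    by (simp add: sum_subtractf[symmetric] algebra_simps)
  have "wedge2 L v = (\<Sum>\<sigma>\<in>?N. of_int (sign \<sigma>) *
    (\<Prod>i\<in>UNIV. form_of (As i) (v (\<sigma> (2 * idx i))) (v (\<sigma> (2 * idx i + 1))))) / 2 ^ CARD('n)"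
    unfolding wedge2_def len prod_idx L ..
  also have "\<dots> = ?c ^ CARD('n) * (\<Sum>\<sigma>\<in>?N. of_int (sign \<sigma>) *
    (\<Prod>i\<in>UNIV. X i (\<sigma> (2 * idx i)) (\<sigma> (2 * idx i + 1)) - X i (\<sigma> (2 * idx i + 1)) (\<sigma> (2 * idx i)))) / 2 ^ CARD('n)"
    unfolding form prod.distrib by (simp add: sum_distrib_left mult_ac)
  also have "\<dots> = ?c ^ CARD('n) * (\<Sum>\<sigma>\<in>?N. of_int (sign \<sigma>) *
    (\<Prod>i\<in>UNIV. X i (\<sigma> (2 * idx i)) (\<sigma> (2 * idx i + 1))))"
    unfolding sum_permutes_antisymmetrise by simp
  also have "(\<Sum>\<sigma>\<in>?N. of_int (sign \<sigma>) * (\<Prod>i\<in>UNIV. X i (\<sigma> (2 * idx i)) (\<sigma> (2 * idx i + 1))))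
    = (\<Sum>\<sigma>\<in>?N. \<Sum>F\<in>UNIV. \<Sum>G\<in>UNIV. (\<Prod>i\<in>UNIV. As i $ F i $ G i) * (of_int (sign \<sigma>) *
      (\<Prod>i\<in>UNIV. v (\<sigma> (2 * idx i)) $ F i * cnj (v (\<sigma> (2 * idx i + 1)) $ G i))))"
    unfolding X_def
    by (subst prod_sum_PiE, simp, simp, subst prod_sum_PiE, simp, simp)
      (simp add: PiE_UNIV_domain prod.distrib sum_distrib_left mult_ac)
  also have "\<dots> = (\<Sum>F\<in>UNIV. \<Sum>G\<in>UNIV. (\<Prod>i\<in>UNIV. As i $ F i $ G i) * alt_prod v F G)"
    unfolding alt_prod_def sum_distrib_left
    by (subst sum.swap, rule sum.cong[OF refl], rule sum.swap)
  also have "\<dots> = (\<Sum>F | F permutes UNIV. \<Sum>G\<in>UNIV. (\<Prod>i\<in>UNIV. As i $ F i $ G i) * alt_prod v F G)"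
    by (rule sum.mono_neutral_right) (auto intro!: sum.neutral simp: alt_prod_not_permutes)
  also have "\<dots> = (\<Sum>F | F permutes UNIV. \<Sum>G | G permutes UNIV. (\<Prod>i\<in>UNIV. As i $ F i $ G i) * alt_prod v F G)"
    by (rule sum.cong[OF refl], rule sum.mono_neutral_right) (auto simp: alt_prod_not_permutes)
  also have "\<dots> = alt_prod v id id * mixed_disc As"
    unfolding mixed_disc_def sum_distrib_left
  proof (intro sum.cong refl)
    fix F G :: "'n \<Rightarrow> 'n" assume "F \<in> {p. p permutes UNIV}" "G \<in> {p. p permutes UNIV}"
    then have "alt_prod v F G = of_int (sign F * sign G) * alt_prod v id id"
      using alt_prod_permutes(1)[of F v id G] alt_prod_permutes(2)[of G v id id] by simp
    then show "(\<Prod>i\<in>UNIV. As i $ F i $ G i) * alt_prod v F G =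
      alt_prod v id id * (of_int (sign F * sign G) * (\<Prod>i\<in>UNIV. As i $ F i $ G i))" by simp
  qed
  finally show ?thesis by simp
qed

lemma beta_form_eq: "\<beta>_form = form_of (mat 1)"
  unfolding \<beta>_form_def form_of_def fun_eq_iff mat_def
  by (auto simp: if_distrib[of "\<lambda>x. x * _"] intro!: sum.cong cong: if_cong)

lemma beta_top_eq:
  "(\<beta>_top :: 'n::finite even_form) v = (\<i> / of_real pi) ^ CARD('n) * alt_prod v id id * fact CARD('n)"
proof -
  have "(\<beta>_top :: 'n even_form) v = (\<i> / of_real pi) ^ CARD('n) * alt_prod v id id * mixed_disc (\<lambda>i::'n. mat 1)"
    unfolding \<beta>_top_def using wedge2_form_of[of "replicate CARD('n) \<beta>_form" "\<lambda>i. mat 1" v]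
    by (simp add: beta_form_eq)
  then show ?thesis by (simp add: mixed_disc_const)
qed

lemma wedge_beta_form_of:
  assumes "k \<le> CARD('n)"
  shows "wedge_\<beta> k (form_of A) v = hsym k A * (\<beta>_top :: 'n::finite even_form) v"
proof -
  have "wedge_\<beta> k (form_of A) v = (\<i> / of_real pi) ^ CARD('n) * alt_prod v id id * mixed_disc (\<lambda>i. if idx i < k then A else mat 1)"
    unfolding wedge_\<beta>_def by (rule wedge2_form_of) (use assms in \<open>auto simp: beta_form_eq nth_append diff_less_mono\<close>)
  then show ?thesis unfolding beta_top_eq hsym_def by simp
qed

text \<open>Forms of top degree are compared through their coefficient of
  \<open>\<beta>_top\<close>; this makes the coefficient unique.\<close>

lemma beta_top_nonzero: "\<exists>v. (\<beta>_top :: 'n::finite even_form) v \<noteq> 0"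
proof -
  let ?N = "{\<sigma>. \<sigma> permutes {..<2 * CARD('n)}}"
  let ?h = "inv (idx :: 'n \<Rightarrow> nat)"
  have inj: "inj (idx :: 'n \<Rightarrow> nat)" by (simp add: inj_def)
  \<comment> \<open>The real basis e_1, i e_1, e_2, i e_2, ... in the order given by
    \<open>idx\<close>: position \<open>2 * idx j\<close> holds \<open>axis j 1\<close>, the next
    one \<open>axis j \<i>\<close>.\<close>
  define v where "v a = axis (?h (a div 2)) (if even a then 1 else \<i>)" for a
  \<comment> \<open>Off the diagonal a = b, the i-th coordinates of v a and v b give
    \<open>X i a b - X i b a\<close>. Once this is unfolded by antisymmetry, only the identity
    permutation keeps all factors nonzero.\<close>
  define X where "X i a b = (if a = 2 * idx i \<and> b = 2 * idx i + 1 then - \<i> else 0)"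
    for i :: 'n and a b :: nat
  have hx: "?h k = i \<longleftrightarrow> k = idx i" if "k < CARD('n)" for i k
  proof -
    have "k \<in> range (idx :: 'n \<Rightarrow> nat)" using that bij_idx[where 'n='n] by (simp add: bij_betw_def)
    then have "idx (?h k) = k" by (rule f_inv_into_f)
    then show ?thesis using inv_f_f[OF inj, of i] by auto
  qed
  have eq: "v a $ i * cnj (v b $ i) = X i a b - X i b a"
    if "a < 2 * CARD('n)" "b < 2 * CARD('n)" "a \<noteq> b" for a b and i :: 'n
  proof -
    have a: "a div 2 < CARD('n)" "b div 2 < CARD('n)" using that by auto
    have "v a $ i = (if a = 2 * idx i then 1 else if a = 2 * idx i + 1 then \<i> else 0)"
      using hx[OF a(1), of i] unfolding v_def axis_def by auto
    moreover have "v b $ i = (if b = 2 * idx i then 1 else if b = 2 * idx i + 1 then \<i> else 0)"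
      using hx[OF a(2), of i] unfolding v_def axis_def by auto
    ultimately show ?thesis using that(3) unfolding X_def by auto
  qed
  have "alt_prod v id id = (\<Sum>\<sigma>\<in>?N. of_int (sign \<sigma>) *
      (\<Prod>i\<in>UNIV. X i (\<sigma> (2 * idx i)) (\<sigma> (2 * idx i + 1)) - X i (\<sigma> (2 * idx i + 1)) (\<sigma> (2 * idx i))))"
    unfolding alt_prod_def
  proof (intro sum.cong refl arg_cong2[where f="(*)"] prod.cong)
    fix \<sigma> and i :: 'n assume \<sigma>: "\<sigma> \<in> ?N"
    have l: "2 * idx i < 2 * CARD('n)" "2 * idx i + 1 < 2 * CARD('n)" using idx_less[of i] by linarith+
    have "\<sigma> (2 * idx i) < 2 * CARD('n)" "\<sigma> (2 * idx i + 1) < 2 * CARD('n)"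
      using permutes_in_image[of \<sigma> "{..<2 * CARD('n)}"] \<sigma> l by auto
    moreover have "\<sigma> (2 * idx i) \<noteq> \<sigma> (2 * idx i + 1)"
      using \<sigma> permutes_inj[of \<sigma>] by (metis injD mem_Collect_eq n_not_Suc_n Suc_eq_plus1)
    ultimately show "v (\<sigma> (2 * idx i)) $ id i * cnj (v (\<sigma> (2 * idx i + 1)) $ id i)
      = X i (\<sigma> (2 * idx i)) (\<sigma> (2 * idx i + 1)) - X i (\<sigma> (2 * idx i + 1)) (\<sigma> (2 * idx i))"
      using eq by simp
  qed
  also have "\<dots> = 2 ^ CARD('n) * (\<Sum>\<sigma>\<in>?N. of_int (sign \<sigma>) *
      (\<Prod>i\<in>UNIV. X i (\<sigma> (2 * idx i)) (\<sigma> (2 * idx i + 1))))"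
    by (rule sum_permutes_antisymmetrise)
  also have "(\<Sum>\<sigma>\<in>?N. of_int (sign \<sigma>) * (\<Prod>i\<in>UNIV. X i (\<sigma> (2 * idx i)) (\<sigma> (2 * idx i + 1))))
    = (\<Sum>\<sigma>\<in>{id}. of_int (sign \<sigma>) * (\<Prod>i\<in>UNIV. X i (\<sigma> (2 * idx i)) (\<sigma> (2 * idx i + 1))))"
  proof (rule sum.mono_neutral_right)
    show "finite ?N" by (simp add: finite_permutations)
    show "{id} \<subseteq> ?N" by (simp add: permutes_id)
    show "\<forall>\<sigma>\<in>?N - {id}. of_int (sign \<sigma>) * (\<Prod>i\<in>UNIV. X i (\<sigma> (2 * idx i)) (\<sigma> (2 * idx i + 1))) = 0"
    proof (rule ccontr)
      assume "\<not> ?thesis"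
      then obtain \<sigma> where \<sigma>: "\<sigma> \<in> ?N" "\<sigma> \<noteq> id"
        and X: "\<And>i. X i (\<sigma> (2 * idx i)) (\<sigma> (2 * idx i + 1)) \<noteq> 0" by auto
      have fx: "\<sigma> (2 * idx i) = 2 * idx i \<and> \<sigma> (2 * idx i + 1) = 2 * idx i + 1" for i :: 'n
        using X[of i] unfolding X_def by (auto split: if_splits)
      have "\<sigma> a = a" for a
      proof (cases "a < 2 * CARD('n)")
        case True
        then have "a div 2 \<in> range (idx :: 'n \<Rightarrow> nat)"
          using bij_idx[where 'n='n] by (auto simp: bij_betw_def)
        then obtain i :: 'n where "a div 2 = idx i" by auto
        then have "a = 2 * idx i \<or> a = 2 * idx i + 1" by presburger
        then show ?thesis using fx[of i] by auto
      next
        case False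
        then show ?thesis using \<sigma> by (auto simp: permutes_def)
      qed
      then show False using \<sigma> by auto
    qed
  qed
  also have "\<dots> = (- \<i>) ^ CARD('n)" by (simp add: X_def sign_id)
  finally have eq0: "alt_prod v (id :: 'n \<Rightarrow> 'n) id = 2 ^ CARD('n) * (- \<i>) ^ CARD('n)" .
  have "(2::complex) ^ CARD('n) * (- \<i>) ^ CARD('n) \<noteq> 0" by simp
  with eq0 have "alt_prod v (id :: 'n \<Rightarrow> 'n) id \<noteq> 0" by metis
  then have "(\<beta>_top :: 'n even_form) v \<noteq> 0" unfolding beta_top_eq by simp
  then show ?thesis by blast
qed

section \<open>Hermitian matrices, and \<open>hsym\<close> along rank one directions\<close>

definition adjoint_matrix :: "complex^'n^'n \<Rightarrow> complex^'n^'n"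
  where "adjoint_matrix A = (\<chi> i j. cnj (A $ j $ i))"

definition hermitian :: "complex^'n^'n \<Rightarrow> bool"
  where "hermitian A \<longleftrightarrow> adjoint_matrix A = A"

definition rank1 :: "complex^'n \<Rightarrow> complex^'n^'n"
  where "rank1 v = (\<chi> i j. v $ i * cnj (v $ j))"

lemma cscale_simps:
  "cscale 1 A = A" "cscale a (cscale b A) = cscale (a * b) A" "cscale a (A + B) = cscale a A + cscale a B"
  "cscale (a + b) A = cscale a A + cscale b A" "cscale 0 A = 0" "cscale a 0 = 0"
  by (auto simp: cscale_def vec_eq_iff algebra_simps)

lemma cscale_of_real: "cscale (of_real r) A = r *\<^sub>R A"
  unfolding cscale_def vec_eq_iff by (simp, simp add: scaleR_conv_of_real)

lemma adjoint_matrix_simps: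
  "adjoint_matrix (A + B) = adjoint_matrix A + adjoint_matrix B" "adjoint_matrix (cscale c A) = cscale (cnj c) (adjoint_matrix A)"
  "adjoint_matrix (r *\<^sub>R A) = r *\<^sub>R adjoint_matrix A" "adjoint_matrix (mat 1) = mat 1" "adjoint_matrix (rank1 v) = rank1 v"
  by (auto simp: adjoint_matrix_def cscale_def vec_eq_iff mat_def rank1_def)

lemma hermitian_intros:
  "hermitian A \<Longrightarrow> hermitian B \<Longrightarrow> hermitian (A + B)"
  "hermitian A \<Longrightarrow> hermitian (r *\<^sub>R A)" "hermitian (mat 1)" "hermitian (rank1 v)"
  "hermitian A \<Longrightarrow> hermitian (cscale (of_real r) A)"
  by (auto simp: hermitian_def adjoint_matrix_simps cscale_of_real)

lemma norm_cscale: "norm (cscale c A) = norm c * norm A"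
proof -
  have "norm (cscale c A $ i) = norm c * norm (A $ i)" for i
    unfolding norm_vec_def cscale_def by (simp add: norm_mult L2_set_right_distrib)
  then show ?thesis unfolding norm_vec_def[of "cscale c A"] norm_vec_def[of A]
    by (simp add: L2_set_right_distrib)
qed

text \<open>Conjugate transposition exchanges the roles of the row and the column permutation. Hence
  \<open>hsym\<close> is real on Hermitian matrices.\<close>

lemma mixed_disc_adjoint: "mixed_disc (\<lambda>i. adjoint_matrix (As i)) = cnj (mixed_disc As)"
proof -
  have "cnj (mixed_disc As) = (\<Sum>\<rho> | \<rho> permutes UNIV. \<Sum>\<pi> | \<pi> permutes UNIV.
    of_int (sign \<rho> * sign \<pi>) * (\<Prod>i\<in>UNIV. adjoint_matrix (As i) $ \<rho> i $ \<pi> i))"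
    unfolding mixed_disc_def by (subst sum.swap) (simp add: adjoint_matrix_def mult.commute)
  then show ?thesis unfolding mixed_disc_def by simp
qed

lemma hsym_adjoint: "hsym k (adjoint_matrix A) = cnj (hsym k A)"
  unfolding hsym_def
  by (simp add: mixed_disc_adjoint[symmetric] adjoint_matrix_simps if_distrib[of adjoint_matrix] cong: if_cong)

lemma hsym_hermitian: "hermitian A \<Longrightarrow> hsym k A = of_real (Re (hsym k A))"
  using hsym_adjoint[of k A] unfolding hermitian_def by (simp add: complex_eq_iff)

lemma hsym_scale:
  fixes A :: "complex^'n::finite^'n"
  assumes "k \<le> CARD('n)"
  shows "hsym k (cscale c A) = c ^ k * hsym k A"
proof -
  have "hsym k (cscale c A) = mixed_disc (\<lambda>i. cscale (if idx i < k then c else 1) (if idx i < k then A else mat 1)) / fact CARD('n)"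
    unfolding hsym_def by (simp add: cscale_simps if_distrib cong: if_cong)
  also have "\<dots> = (\<Prod>i\<in>UNIV. if idx (i::'n) < k then c else 1) * hsym k A"
    unfolding mixed_disc_scale hsym_def by simp
  also have "(\<Prod>i\<in>UNIV. if idx (i::'n) < k then c else 1) = c ^ k"
    using card_idx_less[OF assms] by (simp add: prod.If_cases)
  finally show ?thesis .
qed

lemma hsym_id: "k \<le> CARD('n::finite) \<Longrightarrow> hsym k (mat 1 :: complex^'n^'n) = 1"
  unfolding hsym_def using mixed_disc_const[of "mat 1 :: complex^'n^'n"] by simp

lemma continuous_on_hsym [continuous_intros]:
  assumes "continuous_on S f"
  shows "continuous_on S (\<lambda>x. hsym k (f x :: complex^'n::finite^'n))"
proof -
  have "continuous_on S (\<lambda>x. (if idx i < k then f x else mat 1) $ p $ q)" for i p q :: 'n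
    using assms by (cases "idx i < k") (auto intro!: continuous_intros)
  then show ?thesis unfolding hsym_def mixed_disc_def
    by (intro continuous_on_sum continuous_on_prod continuous_on_mult continuous_on_const
        continuous_on_divide ballI) auto
qed

lemma continuous_on_cscale [continuous_intros]:
  assumes "continuous_on S f" "continuous_on S g"
  shows "continuous_on S (\<lambda>x. cscale (f x) (g x :: complex^'n::finite^'n))"
  unfolding cscale_def by (intro continuous_intros assms)

text \<open>The entries of a rank one matrix factor into a row part and a column part, so exchanging
  the row indices of a and b leaves every product unchanged while the sign flips.\<close>

lemma mixed_disc_rank1_twice:
  fixes As :: "'n::finite \<Rightarrow> complex^'n^'n"
  assumes "a \<noteq> b" "As a = rank1 v" "As b = rank1 v"
  shows "mixed_disc As = 0"
proof -
  let ?t = "Transposition.transpose a b"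
  have t: "?t permutes UNIV" by (intro permutes_swap_id) auto
  have p: "(\<Prod>i\<in>UNIV. As i $ (\<pi> \<circ> ?t) i $ \<rho> i) = (\<Prod>i\<in>UNIV. As i $ \<pi> i $ \<rho> i)" for \<pi> \<rho> :: "'n \<Rightarrow> 'n"
  proof -
    have "(\<Prod>i\<in>UNIV. f i) = f a * (f b * prod f (UNIV - {a} - {b}))" for f :: "'n \<Rightarrow> complex"
      using assms(1) by (subst prod.remove[of UNIV a], simp, simp, subst prod.remove[of "UNIV - {a}" b]) auto
    note * = this
    show ?thesis
      unfolding * using assms
      by (auto simp: rank1_def intro!: arg_cong2[where f="(*)"] prod.cong)
  qed
  have "mixed_disc As = (\<Sum>\<pi> | \<pi> permutes UNIV. \<Sum>\<rho> | \<rho> permutes UNIV.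
    of_int (sign (\<pi> \<circ> ?t) * sign \<rho>) * (\<Prod>i\<in>UNIV. As i $ (\<pi> \<circ> ?t) i $ \<rho> i))"
    unfolding mixed_disc_def by (rule sum_permutations_compose_right[OF t])
  also have "\<dots> = - mixed_disc As"
    unfolding p mixed_disc_def sum_negf[symmetric]
    using assms(1) by (intro sum.cong refl)
      (auto simp: sign_compose sign_swap_id permutation_swap_id permutes_imp_permutation[OF finite_class.finite_UNIV])
  finally show ?thesis by simp
qed

text \<open>The derivative of \<open>hsym k\<close> at A in the direction B.\<close>

definition hsym_lin :: "nat \<Rightarrow> complex^'n^'n \<Rightarrow> complex^'n^'n \<Rightarrow> complex"
  where "hsym_lin k A B = (\<Sum>a | idx a < k.
    mixed_disc (\<lambda>i::'n::finite. if i = a then B else if idx i < k then A else mat 1)) / fact CARD('n)"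

text \<open>Terms with the rank one matrix in two or more slots vanish, so the expansion stops at
  first order.\<close>

lemma hsym_add_rank1:
  fixes A :: "complex^'n::finite^'n"
  shows "hsym k (A + cscale s (rank1 v)) = hsym k A + s * hsym_lin k A (rank1 v)"
proof -
  let ?K = "{i::'n. idx i < k}"
  let ?f = "\<lambda>S. s ^ card S * mixed_disc (\<lambda>i. if i \<in> S then rank1 v else if idx i < k then A else mat 1)"
  have "sum ?f (Pow ?K) = sum ?f (insert {} ((\<lambda>a. {a}) ` ?K))"
  proof (rule sum.mono_neutral_right)
    show "\<forall>S\<in>Pow ?K - insert {} ((\<lambda>a. {a}) ` ?K). ?f S = 0"
    proof
      fix S assume S: "S \<in> Pow ?K - insert {} ((\<lambda>a. {a}) ` ?K)"
      then obtain a where a: "a \<in> S" by auto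
      then have "S \<noteq> {a}" using S by auto
      then obtain b where "b \<in> S" "a \<noteq> b" using a by auto
      then show "?f S = 0" using a mixed_disc_rank1_twice[of a b _ v] by simp
    qed
  qed auto
  also have "\<dots> = ?f {} + sum ?f ((\<lambda>a. {a}) ` ?K)" by (rule sum.insert) auto
  also have "sum ?f ((\<lambda>a. {a}) ` ?K) = (\<Sum>a\<in>?K. ?f {a})" by (subst sum.reindex) auto
  finally show ?thesis
    unfolding hsym_add_scaled hsym_lin_def by (simp add: hsym_def add_divide_distrib sum_distrib_left)
qed

lemma mixed_disc_slot_sum:
  fixes B :: "'b \<Rightarrow> complex^'n::finite^'n"
  shows "mixed_disc (\<lambda>i. if i = a then (\<Sum>j\<in>J. B j) else C i) = (\<Sum>j\<in>J. mixed_disc (\<lambda>i. if i = a then B j else C i))"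
proof -
  have "(\<Prod>i\<in>UNIV. (if i = a then X else C i) $ \<pi> i $ \<rho> i) = X $ \<pi> a $ \<rho> a * (\<Prod>i\<in>UNIV-{a}. C i $ \<pi> i $ \<rho> i)"
    for X :: "complex^'n^'n" and \<pi> \<rho> :: "'n \<Rightarrow> 'n"
    by (subst prod.remove[of UNIV a]) (auto intro!: arg_cong2[where f="(*)"] prod.cong)
  note * = this
  have swap: "(\<Sum>j\<in>J. \<Sum>\<pi>\<in>P. \<Sum>\<rho>\<in>P. g j \<pi> \<rho>) = (\<Sum>\<pi>\<in>P. \<Sum>\<rho>\<in>P. \<Sum>j\<in>J. g j \<pi> \<rho>)"
    for g :: "'b \<Rightarrow> ('n \<Rightarrow> 'n) \<Rightarrow> ('n \<Rightarrow> 'n) \<Rightarrow> complex" and P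
    by (subst sum.swap, rule sum.cong[OF refl], rule sum.swap)
  show ?thesis unfolding mixed_disc_def * swap
    by (simp add: sum_distrib_left sum_distrib_right)
qed

lemma sum_rank1_axis: "(\<Sum>j\<in>UNIV. rank1 (axis j 1)) = (mat 1 :: complex^'n::finite^'n)"
proof -
  have "(\<Sum>j\<in>UNIV. axis j 1 $ i * cnj (axis j 1 $ l)) = (\<Sum>j\<in>UNIV. if j = i then (if i = l then 1 else 0) else 0)"
    for i l :: 'n by (intro sum.cong refl) (auto simp: axis_def)
  then show ?thesis by (auto simp: vec_eq_iff rank1_def mat_def)
qed

text \<open>The identity is the sum of the rank one matrices of the coordinate directions, and
  putting it into one of the k + 1 slots of A leaves k copies of A.\<close>

lemma sum_hsym_lin_axis:
  fixes A :: "complex^'n::finite^'n"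
  assumes "Suc k \<le> CARD('n)"
  shows "(\<Sum>j\<in>UNIV. hsym_lin (Suc k) A (rank1 (axis j 1))) = of_nat (Suc k) * hsym k A"
proof -
  let ?K = "{i::'n. idx i < Suc k}"
  have "(\<Sum>j\<in>UNIV. hsym_lin (Suc k) A (rank1 (axis j 1)))
    = (\<Sum>a\<in>?K. mixed_disc (\<lambda>i. if i = a then mat 1 else if idx i < Suc k then A else mat 1)) / fact CARD('n)"
    unfolding hsym_lin_def sum_divide_distrib[symmetric]
    by (subst sum.swap) (simp only: mixed_disc_slot_sum[symmetric] sum_rank1_axis)
  also have "(\<Sum>a\<in>?K. mixed_disc (\<lambda>i. if i = a then mat 1 else if idx i < Suc k then A else mat 1))
    = (\<Sum>a\<in>?K. fact CARD('n) * hsym k A)"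
  proof (intro sum.cong refl)
    fix a assume a: "a \<in> ?K"
    have "(\<lambda>i. if i = a then mat 1 else if idx i < Suc k then A else mat 1)
      = (\<lambda>i. if i \<in> ?K - {a} then A else mat 1)" by auto
    moreover have "card (?K - {a}) = k" using a card_idx_less[OF assms] by simp
    ultimately show "mixed_disc (\<lambda>i. if i = a then mat 1 else if idx i < Suc k then A else mat 1)
      = fact CARD('n) * hsym k A" by (simp only: hsym_subset)
  qed
  finally show ?thesis using card_idx_less[OF assms] by simp
qed

text \<open>Along a rank one direction \<open>hsym m\<close> is affine, so its slope is nonnegative if it stays nonnegative;
  the slopes in the coordinate directions add up to a multiple of \<open>hsym (m - 1)\<close>.\<close>

lemma hsym_nonneg_of_diag:
  fixes A :: "complex^'n::finite^'n"
  assumes "m \<le> CARD('n)"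
    and "\<And>d. (\<And>i. 0 \<le> d i) \<Longrightarrow> 0 \<le> Re (hsym m (A + (\<Sum>i\<in>UNIV. cscale (of_real (d i)) (rank1 (axis i 1)))))"
    and "j \<le> m"
  shows "0 \<le> Re (hsym j A)"
proof -
  let ?D = "\<lambda>d::'n \<Rightarrow> real. \<Sum>i\<in>UNIV. cscale (of_real (d i)) (rank1 (axis i 1)) :: complex^'n^'n"
  \<comment> \<open>The induction runs downwards from m. All nonnegative diagonal additions are kept
    in the claim, as they supply the room to move in a coordinate direction.\<close>
  have "\<forall>d. (\<forall>i. 0 \<le> d i) \<longrightarrow> 0 \<le> Re (hsym j (A + ?D d))"
    using assms(3)
  proof (induction rule: inc_induct)
    case base
    then show ?case using assms(2) by blast
  next
    case (step k)
    show ?case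
    proof (intro allI impI)
      fix d :: "'n \<Rightarrow> real" assume d: "\<forall>i. 0 \<le> d i"
      let ?B = "A + ?D d"
      have "0 \<le> Re (hsym_lin (Suc k) ?B (rank1 (axis i 1)))" for i
      proof (rule ccontr)
        let ?L = "Re (hsym_lin (Suc k) ?B (rank1 (axis i 1)))"
        assume neg: "\<not> 0 \<le> ?L"
        have key: "0 \<le> Re (hsym (Suc k) ?B) + s * ?L" if "0 \<le> s" for s
        proof -
          have "?D (d(i := d i + s)) = (\<Sum>l\<in>UNIV. cscale (of_real (d l)) (rank1 (axis l 1)) + (if l = i then cscale (of_real s) (rank1 (axis i 1)) else 0))"
            by (intro sum.cong refl) (auto simp: cscale_simps of_real_add)
          also have "\<dots> = ?D d + cscale (of_real s) (rank1 (axis i 1))"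
            by (simp add: sum.distrib)
          finally have "A + ?D (d(i := d i + s)) = ?B + cscale (of_real s) (rank1 (axis i 1))" by simp
          then have "hsym (Suc k) (A + ?D (d(i := d i + s)))
            = hsym (Suc k) ?B + of_real s * hsym_lin (Suc k) ?B (rank1 (axis i 1))"
            by (simp only: hsym_add_rank1)
          moreover have "0 \<le> Re (hsym (Suc k) (A + ?D (d(i := d i + s))))"
            using step.IH d that by auto
          ultimately show ?thesis by simp
        qed
        \<comment> \<open>With a negative slope the affine function would be at most -1 at this step
          length.\<close>
        have "0 \<le> (\<bar>Re (hsym (Suc k) ?B)\<bar> + 1) / - ?L" using neg by (intro divide_nonneg_pos) auto
        note key[OF this]
        moreover have "(\<bar>Re (hsym (Suc k) ?B)\<bar> + 1) / - ?L * ?L = - (\<bar>Re (hsym (Suc k) ?B)\<bar> + 1)"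
          using neg by simp
        ultimately have "0 \<le> Re (hsym (Suc k) ?B) - (\<bar>Re (hsym (Suc k) ?B)\<bar> + 1)" by simp
        then show False by linarith
      qed
      then have "0 \<le> Re (\<Sum>i\<in>UNIV. hsym_lin (Suc k) ?B (rank1 (axis i 1)))"
        by (simp add: sum_nonneg)
      also have "\<dots> = real (Suc k) * Re (hsym k ?B)"
        using step.hyps assms(1) by (subst sum_hsym_lin_axis) auto
      finally show "0 \<le> Re (hsym k ?B)" by (simp add: zero_le_mult_iff)
    qed
  qed
  from this[rule_format, of "\<lambda>_. 0"] show ?thesis by (simp add: cscale_simps)
qed

text \<open>With identities in all slots but a, a nonzero product forces rho to agree with pi off a,
  hence everywhere; what remains is the trace.\<close>

lemma hsym_1:
  fixes A :: "complex^'n::finite^'n"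
  shows "of_nat CARD('n) * hsym 1 A = (\<Sum>i\<in>UNIV. A $ i $ i)"
proof -
  have *: "mixed_disc (\<lambda>i. if i = a then A else mat 1) = (\<Sum>\<pi> | \<pi> permutes UNIV. A $ \<pi> a $ \<pi> a)" for a
    unfolding mixed_disc_def
  proof (intro sum.cong refl)
    fix \<pi> :: "'n \<Rightarrow> 'n" assume \<pi>: "\<pi> \<in> {p. p permutes UNIV}"
    let ?f = "\<lambda>\<rho>. of_int (sign \<pi> * sign \<rho>) * (\<Prod>i\<in>UNIV. (if i = a then A else mat 1) $ \<pi> i $ \<rho> i)"
    have "sum ?f {\<rho>. \<rho> permutes UNIV} = sum ?f {\<pi>}"
    proof (rule sum.mono_neutral_right)
      show "\<forall>\<rho>\<in>{\<rho>. \<rho> permutes UNIV} - {\<pi>}. ?f \<rho> = 0"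
      proof (rule ccontr)
        assume "\<not> ?thesis"
        then obtain \<rho> where \<rho>: "\<rho> permutes UNIV" "\<rho> \<noteq> \<pi>" and nz: "?f \<rho> \<noteq> 0" by blast
        have eq: "\<rho> i = \<pi> i" if "i \<noteq> a" for i
        proof (rule ccontr)
          assume "\<rho> i \<noteq> \<pi> i"
          then have "(if i = a then A else mat 1) $ \<pi> i $ \<rho> i = 0" using that by (auto simp: mat_def)
          then have "(\<Prod>i\<in>UNIV. (if i = a then A else mat 1) $ \<pi> i $ \<rho> i) = 0"
            unfolding prod_zero_iff[OF finite_class.finite_UNIV] by blast
          then show False using nz by (simp only: mult_zero_right)
        qed
        have "surj \<pi>" using \<pi> permutes_surj by blast
        then obtain b where b: "\<pi> b = \<rho> a" by (metis surjD)
        have "b = a"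
        proof (rule ccontr)
          assume "b \<noteq> a"
          then have "\<rho> b = \<rho> a" using eq b by metis
          then show False using permutes_inj[OF \<rho>(1)] \<open>b \<noteq> a\<close> by (meson injD)
        qed
        with b have "\<rho> a = \<pi> a" by metis
        then have "\<rho> i = \<pi> i" for i using eq by (cases "i = a") blast+
        then show False using \<rho>(2) by blast
      qed
    qed (use \<pi> in auto)
    also have "\<dots> = (\<Prod>i\<in>UNIV. (if i = a then A else mat 1) $ \<pi> i $ \<pi> i)"
      by (simp flip: of_int_mult)
    also have "\<dots> = A $ \<pi> a $ \<pi> a"
      by (subst prod.remove[of UNIV a]) (auto simp: mat_def intro!: prod.neutral)
    finally show "sum ?f {\<rho>. \<rho> permutes UNIV} = A $ \<pi> a $ \<pi> a" .
  qed
  have "fact CARD('n) * (of_nat CARD('n) * hsym 1 A) = (\<Sum>a\<in>(UNIV::'n set). fact CARD('n) * hsym 1 A)" by simp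
  also have "\<dots> = (\<Sum>a\<in>UNIV. \<Sum>\<pi> | \<pi> permutes UNIV. A $ \<pi> a $ \<pi> a)"
  proof (intro sum.cong refl)
    fix a :: 'n
    have "mixed_disc (\<lambda>i. if i \<in> {a} then A else mat 1) = fact CARD('n) * hsym 1 A"
      by (rule hsym_subset) simp
    then show "fact CARD('n) * hsym 1 A = (\<Sum>\<pi> | \<pi> permutes UNIV. A $ \<pi> a $ \<pi> a)"
      using *[of a] by (simp only: singleton_iff)
  qed
  also have "\<dots> = (\<Sum>\<pi> | \<pi> permutes (UNIV :: 'n set). \<Sum>a\<in>UNIV. A $ \<pi> a $ \<pi> a)" by (rule sum.swap)
  also have "\<dots> = (\<Sum>\<pi> | \<pi> permutes (UNIV :: 'n set). \<Sum>a\<in>UNIV. A $ a $ a)"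
  proof (rule sum.cong[OF refl])
    fix \<pi> :: "'n \<Rightarrow> 'n" assume "\<pi> \<in> {p. p permutes UNIV}"
    then have "bij \<pi>" by (simp add: permutes_bij)
    from sum.reindex_bij_betw[OF this, of "\<lambda>i. A $ i $ i"]
    show "(\<Sum>a\<in>UNIV. A $ \<pi> a $ \<pi> a) = (\<Sum>a\<in>UNIV. A $ a $ a)" .
  qed
  also have "\<dots> = fact CARD('n) * (\<Sum>a\<in>UNIV. A $ a $ a)" by (simp add: card_permutations)
  finally show ?thesis by simp
qed

lemma hsym_rank1_ge_2:
  assumes "2 \<le> k" "k \<le> CARD('n::finite)"
  shows "hsym k (rank1 (v :: complex^'n)) = 0"
proof -
  have "card {i::'n. idx i < 2} = 2" using assms by (intro card_idx_less) auto
  then obtain a b :: 'n where "a \<noteq> b" "{i. idx i < 2} = {a, b}" by (meson card_2_iff)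
  moreover from this have "idx a < 2" "idx b < 2" by auto
  ultimately show ?thesis
    unfolding hsym_def using assms mixed_disc_rank1_twice[of a b _ v] by simp
qed

lemma hsym_rank1_nonneg:
  assumes "k \<le> CARD('n::finite)"
  shows "0 \<le> Re (hsym k (rank1 (v :: complex^'n)))"
proof -
  consider "k = 0" | "k = 1" | "k \<ge> 2" by linarith
  then show ?thesis
  proof cases
    case 2
    have "real CARD('n) * Re (hsym 1 (rank1 v)) = Re (of_nat CARD('n) * hsym 1 (rank1 v))"
      by simp
    also have "\<dots> \<ge> 0" unfolding hsym_1 by (auto simp: rank1_def intro!: sum_nonneg)
    finally show ?thesis using 2 by (simp add: zero_le_mult_iff)
  qed (use assms in \<open>auto simp: hsym_0 hsym_rank1_ge_2\<close>)
qed


subsection \<open>Hyperbolicity of the elementary symmetric functions\<close>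

text \<open>A kernel vector v would make the real number q, the Hermitian form of A at v, equal to -
  s |v|^2.\<close>

lemma det_hermitian_shift_nonzero:
  fixes A :: "complex^'n::finite^'n"
  assumes A: "hermitian A" and s: "Im s \<noteq> 0"
  shows "det (A + cscale s (mat 1)) \<noteq> 0"
proof
  assume "det (A + cscale s (mat 1)) = 0"
  then have "\<not> invertible (A + cscale s (mat 1))" by (simp add: invertible_det_nz)
  then obtain v where v: "(A + cscale s (mat 1)) *v v = 0" "v \<noteq> 0"
    unfolding invertible_left_inverse matrix_left_invertible_ker by auto
  define q where "q = (\<Sum>i\<in>UNIV. cnj (v $ i) * (A *v v) $ i)"
  have q': "q = (\<Sum>i\<in>UNIV. \<Sum>j\<in>UNIV. cnj (v $ i) * A $ i $ j * v $ j)"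
    unfolding q_def matrix_vector_mult_def by (simp add: sum_distrib_left mult.assoc)
  have Aij: "cnj (A $ i $ j) = A $ j $ i" for i j
    using A by (metis (no_types, lifting) hermitian_def adjoint_matrix_def vec_lambda_beta)
  have "cnj q = (\<Sum>i\<in>UNIV. \<Sum>j\<in>UNIV. cnj (v $ j) * A $ j $ i * v $ i)"
    unfolding q' cnj_sum complex_cnj_mult complex_cnj_cnj Aij by (intro sum.cong refl) (simp only: mult_ac)
  also have "\<dots> = q" unfolding q' by (rule sum.swap)
  finally have "Im q = 0" by (simp add: complex_eq_iff)
  have "(A *v v) $ i = - s * v $ i" for i
  proof -
    have "(\<Sum>j\<in>UNIV. cscale s (mat 1) $ i $ j * v $ j) = (\<Sum>j\<in>UNIV. if j = i then s * v $ i else 0)"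
      by (intro sum.cong refl) (auto simp: cscale_def mat_def)
    then have "((A + cscale s (mat 1)) *v v) $ i = (A *v v) $ i + s * v $ i"
      unfolding matrix_vector_mult_def by (simp add: distrib_right sum.distrib)
    then show ?thesis using v(1) by (simp add: eq_neg_iff_add_eq_0)
  qed
  then have "q = (\<Sum>i\<in>UNIV. - s * of_real ((cmod (v $ i))\<^sup>2))"
    unfolding q_def complex_norm_square by (intro sum.cong refl) (simp only: mult_ac)
  then have "q = - s * of_real (\<Sum>i\<in>UNIV. (cmod (v $ i))\<^sup>2)"
    by (simp add: sum_distrib_left sum_negf)
  then have "Im s * (\<Sum>i\<in>UNIV. (cmod (v $ i))\<^sup>2) = 0" using \<open>Im q = 0\<close> by simp
  then have "(\<Sum>i\<in>UNIV. (cmod (v $ i))\<^sup>2) = 0" using s by simp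
  then have "\<forall>i. v $ i = 0" by (simp add: sum_nonneg_eq_0_iff)
  then show False using v(2) by (simp add: vec_eq_iff)
qed

lemma continuous_on_UNIV_preimage_ball:
  fixes f :: "'a::metric_space \<Rightarrow> 'b::topological_space"
  assumes "continuous_on UNIV f" "open U" "f x \<in> U"
  obtains e where "e > 0" "\<And>y. dist y x < e \<Longrightarrow> f y \<in> U"
proof -
  have "open (f -` U)" using assms(1,2) by (rule open_vimage[rotated])
  then show ?thesis using that assms(3) unfolding open_dist by blast
qed

definition shift_poly :: "nat \<Rightarrow> complex^'n::finite^'n \<Rightarrow> complex poly"
  where "shift_poly k A = (\<Sum>j\<le>k. monom (of_nat (k choose j) * hsym j A) (k - j))"

lemma poly_shift_poly:
  "k \<le> CARD('n) \<Longrightarrow> poly (shift_poly k A) s = hsym k (A + cscale s (mat 1))" for A :: "complex^'n::finite^'n"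
  unfolding shift_poly_def hsym_add_id by (simp add: poly_sum poly_monom mult_ac)

lemma coeff_shift_poly:
  "coeff (shift_poly k A) i = (if i \<le> k then of_nat (k choose i) * hsym (k - i) A else 0)"
proof -
  have "coeff (shift_poly k A) i = (\<Sum>j\<le>k. if k - j = i then of_nat (k choose j) * hsym j A else 0)"
    unfolding shift_poly_def by (simp add: coeff_sum)
  also have "\<dots> = (\<Sum>j\<le>k. if j = k - i then (if i \<le> k then of_nat (k choose j) * hsym j A else 0) else 0)"
    by (intro sum.cong refl) auto
  also have "\<dots> = (if i \<le> k then of_nat (k choose i) * hsym (k - i) A else 0)"
    by (auto simp: binomial_symmetric[symmetric])
  finally show ?thesis .
qed

text \<open>Absorption identity for binomial coefficients. Differentiation lowers k, so
  hyperbolicity can descend from the determinant to every \<open>hsym k\<close>.\<close>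

lemma pderiv_shift_poly: "pderiv (shift_poly (Suc k) A) = smult (of_nat (Suc k)) (shift_poly k A)"
proof (rule poly_eqI)
  fix i
  have "(of_nat (Suc i) :: complex) * of_nat (Suc k choose Suc i) = of_nat (Suc k) * of_nat (k choose i)"
    unfolding of_nat_mult[symmetric] Suc_times_binomial_eq by simp
  then show "coeff (pderiv (shift_poly (Suc k) A)) i = coeff (smult (of_nat (Suc k)) (shift_poly k A)) i"
    by (simp add: coeff_pderiv coeff_shift_poly mult.assoc[symmetric] del: binomial_Suc_Suc of_nat_Suc)
qed

text \<open>The argument of Gauss and Lucas: p'/p is the sum of 1 / (z - r) over the roots, and each
  summand has negative imaginary part if r is in the closed lower half plane and z above it. So p'
  has no zero in the upper half plane.\<close>

lemma Im_logderiv_neg: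
  fixes p :: "complex poly"
  assumes "\<And>r. poly p r = 0 \<Longrightarrow> Im r \<le> 0" and "Im z > 0" and "p \<noteq> 0"
  shows "Im (poly (pderiv p) z / poly p z) \<le> 0 \<and> (degree p > 0 \<longrightarrow> Im (poly (pderiv p) z / poly p z) < 0)"
  using assms
proof (induction "degree p" arbitrary: p)
  case 0
  then have "pderiv p = 0" by (simp add: pderiv_eq_0_iff)
  then show ?case using 0 by simp
next
  case (Suc d)
  then obtain r where r: "poly p r = 0" using alg_closed_imp_poly_has_root[of p] by auto
  then obtain q where q: "p = [:- r, 1:] * q" unfolding poly_eq_0_iff_dvd by (elim dvdE)
  have q0: "q \<noteq> 0" using q Suc.prems by auto
  have deg: "degree q = d" using Suc.hyps(2) q0 unfolding q by (subst (asm) degree_mult_eq) auto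
  have IH: "Im (poly (pderiv q) z / poly q z) \<le> 0"
    using Suc.hyps(1)[of q] deg Suc.prems q0 unfolding q by auto
  have qz: "poly q z \<noteq> 0" using Suc.prems(1)[of z] Suc.prems(2) unfolding q by auto
  have "Im r \<le> 0" using Suc.prems(1) r by blast
  then have zr: "z - r \<noteq> 0" "Im (z - r) > 0" using Suc.prems(2) by auto
  have pz: "poly p z = (z - r) * poly q z" unfolding q poly_mult by simp
  have "pderiv p = [:- r, 1:] * pderiv q + q * pderiv [:- r, 1:]" unfolding q by (rule pderiv_mult)
  then have "poly (pderiv p) z = poly ([:- r, 1:] * pderiv q + q * pderiv [:- r, 1:]) z" by (rule arg_cong)
  also have "\<dots> = poly (pderiv q) z * (z - r) + poly q z"
    unfolding poly_add poly_mult by (simp add: pderiv_pCons)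
  finally have "poly (pderiv p) z / poly p z = (poly (pderiv q) z * (z - r) + poly q z) / ((z - r) * poly q z)"
    unfolding pz by simp
  also have "\<dots> = poly (pderiv q) z / poly q z + 1 / (z - r)"
    using qz zr by (simp add: field_simps)
  finally have "Im (poly (pderiv p) z / poly p z) = Im (poly (pderiv q) z / poly q z) + Im (1 / (z - r))" by simp
  moreover have "Im (1 / (z - r)) < 0" using zr(2)
    by (auto simp: Im_divide power2_eq_square intro!: divide_neg_pos add_nonneg_pos)
  ultimately show ?case using IH by linarith
qed

text \<open>Downward induction from the determinant: the derivative inherits the absence of zeros in
  the upper half plane. The lower half plane follows by conjugation.\<close>

lemma hsym_hermitian_shift_nonzero:
  fixes A :: "complex^'n::finite^'n"
  assumes A: "hermitian A" and s: "Im s \<noteq> 0" and k: "k \<le> CARD('n)"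
  shows "hsym k (A + cscale s (mat 1)) \<noteq> 0"
proof -
  have up: "\<forall>s. Im s > 0 \<longrightarrow> poly (shift_poly k A) s \<noteq> 0"
    using k
  proof (induction rule: inc_induct)
    case base
    then show ?case using det_hermitian_shift_nonzero[OF A] by (simp add: poly_shift_poly hsym_full)
  next
    case (step k)
    let ?p = "shift_poly (Suc k) A"
    have "coeff ?p (Suc k) = 1" by (simp add: coeff_shift_poly hsym_0)
    then have "degree ?p > 0" "?p \<noteq> 0" using le_degree[of ?p "Suc k"] by auto
    then have "Im (poly (pderiv ?p) s / poly ?p s) < 0" if "Im s > 0" for s
      using Im_logderiv_neg[of ?p s] step.IH that by (meson linorder_not_le)
    then show ?case unfolding pderiv_shift_poly by fastforce
  qed
  show ?thesis
  proof (cases "Im s > 0")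
    case True
    then show ?thesis using up k by (simp add: poly_shift_poly)
  next
    case False
    have "hsym k (A + cscale (cnj s) (mat 1)) \<noteq> 0"
      using up k s False by (auto simp: poly_shift_poly)
    moreover have "A + cscale (cnj s) (mat 1) = adjoint_matrix (A + cscale s (mat 1))"
      using A by (simp add: adjoint_matrix_simps hermitian_def)
    ultimately show ?thesis by (simp add: hsym_adjoint)
  qed
qed

text \<open>The modulus of p at t is that of the leading coefficient times the product of the
  distances to the roots, so the nearest root satisfies the bound. It serves as continuity of roots:
  a small value forces a nearby root.\<close>

lemma poly_root_near:
  fixes p :: "complex poly"
  assumes "degree p > 0"
  shows "\<exists>r. poly p r = 0 \<and> norm (t - r) ^ degree p * norm (lead_coeff p) \<le> norm (poly p t)"
  using assms
proof (induction "degree p" arbitrary: p)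
  case (Suc d)
  then obtain r where r: "poly p r = 0" using alg_closed_imp_poly_has_root[of p] by auto
  then obtain q where q: "p = [:- r, 1:] * q" unfolding poly_eq_0_iff_dvd by (elim dvdE)
  have q0: "q \<noteq> 0" using q Suc.prems by auto
  have deg: "degree q = d" using Suc.hyps(2) q0 unfolding q by (subst (asm) degree_mult_eq) auto
  have lc: "lead_coeff p = lead_coeff q" unfolding q by (simp only: lead_coeff_mult) simp
  have pt: "norm (poly p t) = norm (t - r) * norm (poly q t)" unfolding q poly_mult norm_mult by simp
  show ?case
  proof (cases "d = 0")
    case True
    then obtain c where "q = [:c:]" using deg by (metis degree_eq_zeroE)
    then show ?thesis using r pt True unfolding lc unfolding Suc.hyps(2)[symmetric] by (intro exI[of _ r]) simp
  next
    case False
    then obtain r' where r': "poly q r' = 0" "norm (t - r') ^ d * norm (lead_coeff q) \<le> norm (poly q t)"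
      using Suc.hyps(1)[of q] deg by auto
    show ?thesis
    proof (cases "norm (t - r) \<le> norm (t - r')")
      case True
      have "norm (t - r) ^ d * norm (lead_coeff q) \<le> norm (t - r') ^ d * norm (lead_coeff q)"
        using True by (intro mult_right_mono power_mono) auto
      then have "norm (t - r) ^ d * norm (lead_coeff q) \<le> norm (poly q t)" using r' by linarith
      then show ?thesis using r pt unfolding lc unfolding Suc.hyps(2)[symmetric]
        by (intro exI[of _ r]) (auto simp: mult.assoc intro!: mult_left_mono)
    next
      case False
      have "norm (t - r') * (norm (t - r') ^ d * norm (lead_coeff q)) \<le> norm (t - r) * norm (poly q t)"
        using False r'(2) by (intro mult_mono) auto
      then show ?thesis using r' pt unfolding lc unfolding Suc.hyps(2)[symmetric]
        by (intro exI[of _ r']) (auto simp: q mult.assoc)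
    qed
  qed
qed simp

definition line_poly :: "nat \<Rightarrow> complex^'n::finite^'n \<Rightarrow> complex^'n^'n \<Rightarrow> complex poly"
  where "line_poly k M B = (\<Sum>S\<in>Pow {i. idx i < k}.
    monom (mixed_disc (\<lambda>i. if i \<in> S then B else if idx i < k then M else mat 1) / fact CARD('n)) (card S))"

lemma poly_line_poly: "poly (line_poly k M B) t = hsym k (M + cscale t B)"
  unfolding line_poly_def hsym_add_scaled by (simp add: poly_sum poly_monom sum_divide_distrib mult_ac)

text \<open>The power t^k arises only from B in all k slots, so the leading coefficient does not
  depend on M.\<close>

lemma degree_line_poly:
  fixes B :: "complex^'n::finite^'n"
  assumes k: "k \<le> CARD('n)" and B: "hsym k B \<noteq> 0"
  shows "degree (line_poly k M B) = k" "lead_coeff (line_poly k M B) = hsym k B"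
proof -
  let ?K = "{i::'n. idx i < k}"
  have cK: "card ?K = k" using k by (rule card_idx_less)
  have "coeff (line_poly k M B) k = (\<Sum>S\<in>Pow ?K. if S = ?K then hsym k B else 0)"
    unfolding line_poly_def coeff_sum
  proof (intro sum.cong refl)
    fix S assume S: "S \<in> Pow ?K"
    then have "card S = k \<longleftrightarrow> S = ?K" using cK card_subset_eq[of ?K S] by auto
    then show "coeff (monom (mixed_disc (\<lambda>i. if i \<in> S then B else if idx i < k then M else mat 1) / fact CARD('n)) (card S)) k
      = (if S = ?K then hsym k B else 0)"
      by (auto simp: hsym_def cK intro!: arg_cong[where f=mixed_disc])
  qed
  then have c: "coeff (line_poly k M B) k = hsym k B" by simp
  have "degree (line_poly k M B) \<le> k" unfolding line_poly_def
  proof (rule degree_sum_le)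
    fix S assume "S \<in> Pow ?K"
    then have "card S \<le> k" using cK card_mono[of ?K S] by auto
    then show "degree (monom (mixed_disc (\<lambda>i. if i \<in> S then B else if idx i < k then M else mat 1) / fact CARD('n)) (card S)) \<le> k"
      by (rule order_trans[OF degree_monom_le])
  qed simp
  moreover have "k \<le> degree (line_poly k M B)" using c B by (intro le_degree) simp
  ultimately show "degree (line_poly k M B) = k" by simp
  then show "lead_coeff (line_poly k M B) = hsym k B" using c by simp
qed

text \<open>The roots of \<open>t \<mapsto> hsym k (M + t B)\<close> move continuously with \<open>M\<close> and, the leading coefficient
  being constant, stay bounded, so they cannot leave a half plane without crossing its boundary.\<close>

lemma hsym_roots_homotopy:
  fixes B M0 M1 :: "complex^'n::finite^'n" and \<phi> :: "complex \<Rightarrow> real"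
  assumes k: "1 \<le> k" "k \<le> CARD('n)" and B: "hsym k B \<noteq> 0" and \<phi>: "continuous_on UNIV \<phi>"
    and cross: "\<And>s t. 0 \<le> s \<Longrightarrow> s \<le> 1 \<Longrightarrow> hsym k (((1 - s) *\<^sub>R M0 + s *\<^sub>R M1) + cscale t B) = 0 \<Longrightarrow> \<phi> t \<noteq> 0"
    and start: "\<And>t. hsym k (M0 + cscale t B) = 0 \<Longrightarrow> \<phi> t < 0"
    and root: "hsym k (M1 + cscale t B) = 0"
  shows "\<phi> t < 0"
proof -
  define M where "M s = (1 - s) *\<^sub>R M0 + s *\<^sub>R M1" for s :: real
  have contM: "continuous_on S M" for S unfolding M_def by (intro continuous_intros)
  \<comment> \<open>The parameters with a root on the wrong side. This set misses 0 and will be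
    shown to be closed and open in [0,1].\<close>
  define S where "S = {s \<in> {0..1}. \<exists>t. 0 \<le> \<phi> t \<and> hsym k (M s + cscale t B) = 0}"
  have "continuous_on UNIV (hsym k :: complex^'n^'n \<Rightarrow> complex)" by (intro continuous_intros)
  from continuous_on_UNIV_preimage_ball[OF this, of "- {0}" B]
  obtain e where e: "e > 0" "\<And>X. dist X B < e \<Longrightarrow> hsym k X \<noteq> 0"
    using B by auto
  define C where "C = norm M0 + norm M1"
  have C0: "C \<ge> 0" unfolding C_def by simp
  have normM: "norm (M s) \<le> C" if "s \<in> {0..1}" for s
  proof -
    have "norm (M s) \<le> (1 - s) * norm M0 + s * norm M1"
      unfolding M_def using that by (intro order_trans[OF norm_triangle_ineq]) auto
    also have "\<dots> \<le> 1 * norm M0 + 1 * norm M1" using that by (intro add_mono mult_right_mono) auto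
    finally show ?thesis unfolding C_def by simp
  qed
  have bound: "norm t \<le> C / e" if s: "s \<in> {0..1}" and r: "hsym k (M s + cscale t B) = 0" for s t
  proof (rule ccontr)
    assume "\<not> norm t \<le> C / e"
    then have *: "C < norm t * e" using e(1) by (simp add: field_simps)
    then have t0: "t \<noteq> 0" using C0 by auto
    \<comment> \<open>For large t the second factor is within e of B, where \<open>hsym k\<close>
      has no zero.\<close>
    have "M s + cscale t B = cscale t (cscale (1 / t) (M s) + B)" using t0 by (simp add: cscale_simps)
    then have "hsym k (cscale (1 / t) (M s) + B) = 0" using r t0 k by (simp add: hsym_scale)
    moreover have "dist (cscale (1 / t) (M s) + B) B < e"
    proof -
      have "norm (M s) < norm t * e" using * normM[OF s] by linarith
      then show ?thesis using t0 by (simp add: dist_norm norm_cscale norm_divide field_simps)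
    qed
    ultimately show False using e(2) by blast
  qed
  \<comment> \<open>Closedness: the roots are bounded, so S is the projection of a compact
    set.\<close>
  have "S = fst ` ({x \<in> {0..1} \<times> cball 0 (C / e). 0 \<le> \<phi> (snd x) \<and> hsym k (M (fst x) + cscale (snd x) B) = 0})"
  proof (rule set_eqI, rule iffI)
    fix s assume "s \<in> S"
    then obtain t where "s \<in> {0..1}" "0 \<le> \<phi> t" "hsym k (M s + cscale t B) = 0" unfolding S_def by blast
    moreover from this have "t \<in> cball 0 (C / e)" using bound by (simp only: mem_cball_0)
    ultimately show "s \<in> fst ` {x \<in> {0..1} \<times> cball 0 (C / e). 0 \<le> \<phi> (snd x) \<and> hsym k (M (fst x) + cscale (snd x) B) = 0}"
      by (intro image_eqI[of _ _ "(s, t)"]) simp_all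
  next
    fix s assume "s \<in> fst ` {x \<in> {0..1} \<times> cball 0 (C / e). 0 \<le> \<phi> (snd x) \<and> hsym k (M (fst x) + cscale (snd x) B) = 0}"
    then show "s \<in> S" unfolding S_def by auto
  qed
  moreover have "compact {x \<in> {0..1} \<times> cball 0 (C / e). 0 \<le> \<phi> (snd x) \<and> hsym k (M (fst x) + cscale (snd x) B) = 0}"
  proof -
    have "closed {x :: real \<times> complex. 0 \<le> \<phi> (snd x)}"
      using continuous_on_compose2[OF \<phi> continuous_on_snd[OF continuous_on_id[of UNIV]] subset_UNIV]
      by (intro closed_Collect_le continuous_on_const)
    moreover have "closed {x :: real \<times> complex. hsym k (M (fst x) + cscale (snd x) B) = 0}"
      unfolding M_def by (intro closed_Collect_eq continuous_intros)
    ultimately have "closed ({x :: real \<times> complex. 0 \<le> \<phi> (snd x)} \<inter> {x. hsym k (M (fst x) + cscale (snd x) B) = 0})"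
      by (rule closed_Int)
    then have "compact (({0..1} \<times> cball 0 (C / e)) \<inter> ({x :: real \<times> complex. 0 \<le> \<phi> (snd x)} \<inter> {x. hsym k (M (fst x) + cscale (snd x) B) = 0}))"
      by (intro compact_Int_closed compact_Times compact_Icc compact_cball)
    then show ?thesis by (rule back_subst[of compact]) auto
  qed
  ultimately have "compact S" by (simp only: compact_continuous_image[OF continuous_on_fst[OF continuous_on_id]])
  then have closedS: "closedin (top_of_set {0..1}) S"
    by (intro closed_subset compact_imp_closed) (auto simp: S_def)
  have openS: "openin (top_of_set {0..1}) S"
    unfolding openin_euclidean_subtopology_iff
  proof (intro conjI ballI)
    show "S \<subseteq> {0..1}" unfolding S_def by auto
    fix s0 assume "s0 \<in> S"
    then obtain t0 where s0: "s0 \<in> {0..1}" and t0: "0 \<le> \<phi> t0" "hsym k (M s0 + cscale t0 B) = 0"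
      unfolding S_def by auto
    have "\<phi> t0 > 0" using cross[of s0 t0] s0 t0 unfolding M_def by fastforce
    then obtain d where d: "d > 0" "\<And>t. dist t t0 < d \<Longrightarrow> \<phi> t > 0"
      using continuous_on_UNIV_preimage_ball[OF \<phi>, of "{0<..}" t0] by auto
    have "continuous_on UNIV (\<lambda>s. norm (hsym k (M s + cscale t0 B)))"
      by (intro continuous_intros contM)
    moreover have "norm (hsym k (M s0 + cscale t0 B)) < d ^ k * norm (hsym k B)" using t0 d B by simp
    ultimately obtain \<eta> where \<eta>: "\<eta> > 0" "\<And>s. dist s s0 < \<eta> \<Longrightarrow> norm (hsym k (M s + cscale t0 B)) < d ^ k * norm (hsym k B)"
      using continuous_on_UNIV_preimage_ball[of "\<lambda>s. norm (hsym k (M s + cscale t0 B))" "{..<d ^ k * norm (hsym k B)}" s0]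
      by auto
    \<comment> \<open>Openness: the value at t0 stays below d^k times the leading coefficient, so
      some root lies within d of t0, still on the wrong side.\<close>
    have "s \<in> S" if "s \<in> {0..1}" "dist s s0 < \<eta>" for s
    proof -
      let ?p = "line_poly k (M s) B"
      have "degree ?p > 0" using degree_line_poly(1)[OF k(2) B] k(1) by simp
      from poly_root_near[OF this, of t0] obtain r where
        r: "poly ?p r = 0" "norm (t0 - r) ^ k * norm (hsym k B) \<le> norm (poly ?p t0)"
        using degree_line_poly[OF k(2) B] by auto
      then have "norm (t0 - r) ^ k * norm (hsym k B) < d ^ k * norm (hsym k B)"
        using \<eta>(2)[OF that(2)] by (simp add: poly_line_poly)
      then have "norm (t0 - r) ^ k < d ^ k" using B by simp
      then have "norm (t0 - r) < d" using d(1) by (simp add: power_less_imp_less_base[of _ k])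
      then have "\<phi> r > 0" using d(2)[of r] by (simp add: dist_norm norm_minus_commute)
      then show ?thesis unfolding S_def using that r(1) by (auto simp: poly_line_poly intro!: exI[of _ r])
    qed
    then show "\<exists>e>0. \<forall>x'\<in>{0..1}. dist x' s0 < e \<longrightarrow> x' \<in> S" using \<eta>(1) by blast
  qed
  have "S = {} \<or> S = {0..1}"
    using connected_Icc[of 0 "1::real"] openS closedS connected_clopen[of "{0..1::real}"] by blast
  moreover have "0 \<notin> S" unfolding S_def M_def using start by fastforce
  ultimately have "1 \<notin> S" by auto
  moreover have "1 \<in> S" if "0 \<le> \<phi> t"
    unfolding S_def M_def using that root by (intro CollectI conjI exI[of _ t]) auto
  ultimately show ?thesis by (meson not_le)
qed

section \<open>Garding cones and superadditivity\<close>

definition pos_cone :: "nat \<Rightarrow> (complex^'n::finite^'n) set"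
  where "pos_cone k = {A. hermitian A \<and> (\<forall>j\<le>k. 0 < Re (hsym j A))}"

text \<open>On Hermitian matrices this is k-positivity of the associated form;
  \<open>pos_cone\<close> is the open cone of Garding. Asking for all j up to k makes the cones
  decrease in k.\<close>

definition nonneg_cone :: "nat \<Rightarrow> (complex^'n::finite^'n) set"
  where "nonneg_cone k = {A. hermitian A \<and> (\<forall>j\<le>k. 0 \<le> Re (hsym j A))}"

lemma pos_cone_subset: "pos_cone k \<subseteq> nonneg_cone k"
  unfolding pos_cone_def nonneg_cone_def by (auto simp: less_imp_le)

lemma pos_cone_mono: "j \<le> k \<Longrightarrow> pos_cone k \<subseteq> pos_cone j"
  unfolding pos_cone_def by auto

text \<open>In the binomial expansion all terms are nonnegative, and the one with
  \<open>hsym 0 A\<close> is a power of e, hence positive. By this shift statements on the closed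
  cone reduce to the open one.\<close>

lemma nonneg_cone_add_id:
  fixes A :: "complex^'n::finite^'n"
  assumes A: "A \<in> nonneg_cone k" and k: "k \<le> CARD('n)" and e: "0 < e"
  shows "A + cscale (of_real e) (mat 1) \<in> pos_cone k"
proof -
  have "0 < Re (hsym j (A + cscale (of_real e) (mat 1)))" if j: "j \<le> k" for j
  proof -
    have "Re (hsym j (A + cscale (of_real e) (mat 1))) = (\<Sum>i\<le>j. real (j choose i) * e ^ (j - i) * Re (hsym i A))"
      using j k by (subst hsym_add_id) (auto simp: simp flip: of_real_power)
    also have "\<dots> \<ge> real (j choose 0) * e ^ (j - 0) * Re (hsym 0 A)"
      using A j e by (intro member_le_sum) (auto simp: nonneg_cone_def)
    finally show ?thesis using e by (simp add: hsym_0) (meson less_le_trans zero_less_power)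
  qed
  then show ?thesis using A unfolding pos_cone_def nonneg_cone_def by (auto intro!: hermitian_intros)
qed

lemma pos_cone_add_id:
  assumes A: "A \<in> pos_cone k" and k: "k \<le> CARD('n)" and e: "0 \<le> e"
  shows "A + cscale (of_real e) (mat 1) \<in> (pos_cone k :: (complex^'n::finite^'n) set)"
  using nonneg_cone_add_id[OF subsetD[OF pos_cone_subset A] k, of e] A e
  by (cases "e = 0") (auto simp: cscale_simps)

lemma pos_cone_scale:
  assumes A: "A \<in> pos_cone k" and k: "k \<le> CARD('n)" and e: "0 < e"
  shows "cscale (of_real e) A \<in> (pos_cone k :: (complex^'n::finite^'n) set)"
  using assms unfolding pos_cone_def
  by (auto simp: hsym_scale simp flip: of_real_power intro!: hermitian_intros)

lemma id_pos_cone: "k \<le> CARD('n) \<Longrightarrow> mat 1 \<in> (pos_cone k :: (complex^'n::finite^'n) set)"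
  unfolding pos_cone_def by (auto simp: hsym_id hermitian_intros)

lemma hsym_pos_cone_ne: "A \<in> pos_cone k \<Longrightarrow> j \<le> k \<Longrightarrow> hsym j A \<noteq> 0"
  unfolding pos_cone_def by fastforce

text \<open>Openness along the identity: finitely many continuous functions of e are positive at
  0.\<close>

lemma pos_cone_sub_id:
  fixes B :: "complex^'n::finite^'n"
  assumes B: "B \<in> pos_cone k"
  shows "\<exists>e>0. B + cscale (of_real (-e)) (mat 1) \<in> pos_cone k"
proof -
  define f where "f j e = Re (hsym j (B + cscale (of_real (-e)) (mat 1)))" for j and e :: real
  have "\<forall>\<^sub>F e in at_right 0. 0 < f j e" if "j \<le> k" for j
  proof -
    have "continuous_on UNIV (f j)" unfolding f_def by (intro continuous_intros)
    then have "(f j \<longlongrightarrow> f j 0) (at_right 0)"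
      by (metis UNIV_I continuous_on_def filterlim_at_within_If tendsto_within_subset subset_UNIV)
    moreover have "0 < f j 0" using B that unfolding f_def pos_cone_def by (simp add: cscale_simps)
    ultimately show ?thesis by (rule order_tendstoD(1))
  qed
  then have "\<forall>\<^sub>F e in at_right 0. \<forall>j\<in>{..k}. 0 < f j e"
    by (intro eventually_ball_finite) auto
  moreover have "\<forall>\<^sub>F e in at_right (0::real). 0 < e" by (simp add: eventually_at_right_less)
  ultimately have "\<forall>\<^sub>F e in at_right 0. 0 < e \<and> (\<forall>j\<in>{..k}. 0 < f j e)" by (rule eventually_conj[rotated])
  then obtain e where "0 < e" "\<forall>j\<in>{..k}. 0 < f j e" by (metis (no_types, lifting) eventually_happens' trivial_limit_at_right_real)
  then show ?thesis using B unfolding pos_cone_def f_def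
    by (intro exI[of _ e]) (auto intro!: hermitian_intros simp del: of_real_minus)
qed

lemma hsym_id_line_roots:
  fixes B :: "complex^'n::finite^'n"
  assumes B: "B \<in> pos_cone k" and k: "k \<le> CARD('n)" and z: "hsym k (B + cscale z (mat 1)) = 0"
  shows "Im z = 0" "Re z < 0"
proof -
  have herm: "hermitian B" using B by (simp add: pos_cone_def)
  show im: "Im z = 0" using hsym_hermitian_shift_nonzero[OF herm _ k] z by blast
  show "Re z < 0"
  proof (rule ccontr)
    assume "\<not> Re z < 0"
    then have "B + cscale (of_real (Re z)) (mat 1) \<in> pos_cone k" using B k by (intro pos_cone_add_id) auto
    moreover have "complex_of_real (Re z) = z" using im by (simp add: complex_eq_iff)
    ultimately show False using hsym_pos_cone_ne[of _ k k] z by force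
  qed
qed

text \<open>As \<open>A\<close> is scaled from \<open>0\<close> to full size, no root \<open>t\<close> crosses the real axis, since for real \<open>t\<close> the matrix
  \<open>A + t B\<close> is Hermitian; for \<open>A = 0\<close> the roots are \<open>t = \<i> \<alpha> / z\<close> with \<open>z < 0\<close>.\<close>

lemma hsym_line_imaginary_shift_nonzero:
  fixes A B :: "complex^'n::finite^'n"
  assumes A: "hermitian A" and B: "B \<in> pos_cone k" and k: "1 \<le> k" "k \<le> CARD('n)"
    and \<alpha>: "0 < \<alpha>" and t: "0 \<le> Im t"
  shows "hsym k (cscale (\<i> * of_real \<alpha>) (mat 1) + A + cscale t B) \<noteq> 0"
proof
  assume root: "hsym k (cscale (\<i> * of_real \<alpha>) (mat 1) + A + cscale t B) = 0"
  let ?I = "cscale (\<i> * of_real \<alpha>) (mat 1) :: complex^'n^'n"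
  have "Im t < 0"
  proof (rule hsym_roots_homotopy[OF k hsym_pos_cone_ne[OF B order_refl] _ _ _ root])
    show "continuous_on UNIV Im" by (intro continuous_intros)
    fix s :: real and t assume s: "0 \<le> s" "s \<le> 1" and h: "hsym k ((1 - s) *\<^sub>R ?I + s *\<^sub>R (?I + A) + cscale t B) = 0"
    show "Im t \<noteq> 0"
    proof
      assume "Im t = 0"
      then have "t = of_real (Re t)" by (simp add: complex_eq_iff)
      then have "cscale t B = cscale (of_real (Re t)) B" by (rule arg_cong)
      moreover have "(1 - s) *\<^sub>R ?I + s *\<^sub>R (?I + A) = s *\<^sub>R A + ?I" by (simp add: algebra_simps)
      moreover have "hermitian (s *\<^sub>R A + cscale (of_real (Re t)) B)"
        using A B by (auto intro!: hermitian_intros simp: pos_cone_def)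
      ultimately show False
        using h \<alpha> hsym_hermitian_shift_nonzero[of "s *\<^sub>R A + cscale (of_real (Re t)) B" "\<i> * of_real \<alpha>" k] k
        by (simp add: ac_simps)
    qed
  next
    fix t assume h: "hsym k (?I + cscale t B) = 0"
    have t0: "t \<noteq> 0"
    proof
      assume "t = 0"
      then have "(\<i> * of_real \<alpha>) ^ k = 0" using h k by (simp add: cscale_simps hsym_scale hsym_id)
      then show False using \<alpha> by simp
    qed
    define z where "z = \<i> * of_real \<alpha> / t"
    have "?I + cscale t B = cscale t (B + cscale z (mat 1))" using t0 unfolding z_def by (simp add: cscale_simps add.commute)
    then have "hsym k (B + cscale z (mat 1)) = 0" using h t0 k by (simp add: hsym_scale)
    from hsym_id_line_roots[OF B k(2) this] have "z = of_real (Re z)" "Re z < 0" by (simp_all add: complex_eq_iff)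
    then have "t = \<i> * of_real (\<alpha> / Re z)" using t0 unfolding z_def by (metis (no_types, lifting) \<alpha> divide_divide_eq_right mult_eq_0_iff
          nonzero_mult_div_cancel_left of_real_divide of_real_eq_0_iff complex_i_not_zero less_irrefl times_divide_eq_right z_def)
    then have "Im t = \<alpha> / Re z" by simp
    then show "Im t < 0" using \<alpha> \<open>Re z < 0\<close> by (simp add: divide_pos_neg)
  qed
  then show False using t by simp
qed

text \<open>For Im t > 0, split t B = t (B - e I) + t e I with B - e I still in the cone. The real
  part of t e I joins the Hermitian A, and the imaginary part is the shift i alpha I, alpha = e Im
  t, of the preceding lemma.\<close>

lemma hsym_line_roots_real:
  fixes A B :: "complex^'n::finite^'n"
  assumes A: "hermitian A" and B: "B \<in> pos_cone k" and k: "1 \<le> k" "k \<le> CARD('n)"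
    and root: "hsym k (A + cscale t B) = 0"
  shows "Im t = 0"
proof -
  have no: "\<not> 0 < Im t" if root: "hsym k (A + cscale t B) = 0" for t
  proof
    assume t: "0 < Im t"
    obtain e where e: "e > 0" "B + cscale (of_real (-e)) (mat 1) \<in> pos_cone k" using pos_cone_sub_id[OF B] by blast
    let ?B = "B + cscale (of_real (-e)) (mat 1)"
    have "t * of_real e = of_real (Re t * e) + \<i> * of_real (Im t * e)" by (simp add: complex_eq_iff)
    then have "A + cscale t B = cscale (\<i> * of_real (Im t * e)) (mat 1) + (A + cscale (of_real (Re t * e)) (mat 1)) + cscale t ?B"
      by (simp add: cscale_def vec_eq_iff algebra_simps mat_def)
    then have "hsym k (A + cscale t B) = hsym k (cscale (\<i> * of_real (Im t * e)) (mat 1) + (A + cscale (of_real (Re t * e)) (mat 1)) + cscale t ?B)"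
      by (rule arg_cong)
    moreover have "hsym k (cscale (\<i> * of_real (Im t * e)) (mat 1) + (A + cscale (of_real (Re t * e)) (mat 1)) + cscale t ?B) \<noteq> 0"
      using t e k A by (intro hsym_line_imaginary_shift_nonzero hermitian_intros) auto
    ultimately show False using root by metis
  qed
  have "adjoint_matrix (A + cscale t B) = A + cscale (cnj t) B"
    using A B by (simp add: pos_cone_def hermitian_def adjoint_matrix_simps)
  then have "hsym k (A + cscale (cnj t) B) = 0" using hsym_adjoint[of k "A + cscale t B"] root by simp
  then show ?thesis using no[OF root] no[of "cnj t"] by simp
qed

lemma pos_cone_segment_id:
  fixes A :: "complex^'n::finite^'n"
  assumes A: "A \<in> pos_cone k" and k: "k \<le> CARD('n)" and s: "0 \<le> s" "s \<le> 1"
  shows "(1 - s) *\<^sub>R mat 1 + s *\<^sub>R A \<in> pos_cone k"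
proof (cases "s = 0")
  case True
  then show ?thesis using id_pos_cone[OF k] by simp
next
  case False
  then have "cscale (of_real s) A + cscale (of_real (1 - s)) (mat 1) \<in> pos_cone k"
    using A k s by (intro pos_cone_add_id pos_cone_scale) auto
  then show ?thesis by (simp add: cscale_of_real add.commute del: of_real_diff)
qed

text \<open>The segment from the identity to A stays in the cone. Along it all roots are real, and 0
  is never a root because \<open>hsym k\<close> does not vanish on the cone.\<close>

lemma hsym_line_roots_neg:
  fixes A B :: "complex^'n::finite^'n"
  assumes A: "A \<in> pos_cone k" and B: "B \<in> pos_cone k" and k: "1 \<le> k" "k \<le> CARD('n)"
    and root: "hsym k (A + cscale t B) = 0"
  shows "Im t = 0" "Re t < 0"
proof -
  show "Im t = 0" using hsym_line_roots_real[OF _ B k root] A by (simp add: pos_cone_def)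
  show "Re t < 0"
  proof (rule hsym_roots_homotopy[OF k hsym_pos_cone_ne[OF B order_refl] _ _ _ root, where ?M0.0="mat 1"])
    show "continuous_on UNIV Re" by (intro continuous_intros)
    fix s :: real and t assume s: "0 \<le> s" "s \<le> 1" and h: "hsym k ((1 - s) *\<^sub>R mat 1 + s *\<^sub>R A + cscale t B) = 0"
    have M: "(1 - s) *\<^sub>R mat 1 + s *\<^sub>R A \<in> pos_cone k" by (rule pos_cone_segment_id[OF A k(2) s])
    then have "Im t = 0" using hsym_line_roots_real[OF _ B k h] by (simp add: pos_cone_def)
    show "Re t \<noteq> 0"
    proof
      assume "Re t = 0"
      then have "t = 0" using \<open>Im t = 0\<close> by (simp add: complex_eq_iff)
      then show False using h hsym_pos_cone_ne[OF M order_refl] by (simp add: cscale_simps)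
    qed
  next
    fix t assume h: "hsym k (mat 1 + cscale t B) = 0"
    have t0: "t \<noteq> 0" using h k by (auto simp: cscale_simps hsym_id)
    have "mat 1 + cscale t B = cscale t (B + cscale (1 / t) (mat 1))" using t0 by (simp add: cscale_simps add.commute)
    then have "hsym k (B + cscale (1 / t) (mat 1)) = 0" using h t0 k by (simp add: hsym_scale)
    from hsym_id_line_roots[OF B k(2) this] have *: "Im (1 / t) = 0" "Re (1 / t) < 0" .
    then show "Re t < 0" by (auto simp: Re_divide divide_less_0_iff not_sum_power2_lt_zero)
  qed
qed

text \<open>The arithmetic-geometric mean inequality for 1 / (1 + mu_i) and for mu_i / (1 + mu_i):
  the two arithmetic means add up to 1.\<close>

lemma prod_one_plus_ge:
  fixes \<mu> :: "nat \<Rightarrow> real"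
  assumes k: "1 \<le> k" and \<mu>: "\<And>i. i < k \<Longrightarrow> 0 < \<mu> i"
  shows "1 + root k (\<Prod>i<k. \<mu> i) \<le> root k (\<Prod>i<k. 1 + \<mu> i)"
proof -
  let ?P = "\<Prod>i<k. 1 + \<mu> i"
  have P: "0 < ?P" by (rule prod_pos) (use \<mu> in \<open>auto intro: add_pos_pos\<close>)
  have rp: "x powr (1 / real k) = root k x" if "0 \<le> x" for x
    using that k by (cases "x = 0") (auto simp: root_powr_inverse inverse_eq_divide)
  have a: "root k (\<Prod>i<k. f i) \<le> (\<Sum>i<k. f i) / k" if "\<And>i. i < k \<Longrightarrow> 0 \<le> f i" for f :: "nat \<Rightarrow> real"
  proof -
    have "(\<Prod>i<k. f i) powr (1 / card {..<k}) \<le> (\<Sum>i<k. f i / card {..<k})"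
      using k that by (intro arith_geom_mean) (auto simp: lessThan_empty_iff)
    then show ?thesis using rp[of "\<Prod>i<k. f i"] prod_nonneg[of "{..<k}" f] that by (simp add: sum_divide_distrib)
  qed
  have "root k (\<Prod>i<k. 1 / (1 + \<mu> i)) + root k (\<Prod>i<k. \<mu> i / (1 + \<mu> i))
    \<le> (\<Sum>i<k. 1 / (1 + \<mu> i)) / k + (\<Sum>i<k. \<mu> i / (1 + \<mu> i)) / k"
    using \<mu> by (intro add_mono a) (auto intro!: divide_nonneg_nonneg simp: less_imp_le add_nonneg_nonneg)
  also have "\<dots> = (\<Sum>i<k. (1 + \<mu> i) / (1 + \<mu> i)) / k"
    by (simp only: add_divide_distrib sum.distrib)
  also have "(\<Sum>i<k. (1 + \<mu> i) / (1 + \<mu> i)) = (\<Sum>i<k. 1)"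
    using \<mu> by (intro sum.cong refl) (simp, smt (verit) \<mu>)
  finally have "root k (1 / ?P) + root k ((\<Prod>i<k. \<mu> i) / ?P) \<le> 1"
    using k by (simp add: prod_dividef)
  then show ?thesis using P k by (simp add: real_root_divide add_divide_distrib[symmetric] divide_le_eq real_root_gt_zero)
qed

text \<open>With roots - mu_i the polynomial is c times the product of the t + mu_i, so its values
  at 0 and 1 are those compared in \<open>prod_one_plus_ge\<close>.\<close>

lemma complex_poly_negative_roots:
  fixes p :: "complex poly"
  assumes deg: "degree p = k" and k: "1 \<le> k" and lead: "lead_coeff p = of_real c" and c: "0 < c"
    and roots: "\<And>r. poly p r = 0 \<Longrightarrow> Im r = 0 \<and> Re r < 0"
  obtains a b where "poly p 0 = of_real a" "poly p 1 = of_real b" "0 < a" "0 < b"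
    "root k a + root k c \<le> root k b"
proof -
  have p0: "p \<noteq> 0" using deg k by auto
  obtain rs where rs: "mset rs = proots p" by (metis ex_mset)
  have dec: "p = smult (of_real c) (\<Prod>x\<leftarrow>rs. [:-x, 1:])"
    using complex_poly_decompose_multiset[of p] lead by (simp flip: rs prod_mset_prod_list)
  have "degree (\<Prod>x\<leftarrow>xs. [:-x, 1::complex:]) = length xs" for xs :: "complex list"
  proof (induction xs)
    case (Cons x xs)
    have "(\<Prod>x\<leftarrow>xs. [:-x, 1::complex:]) \<noteq> 0" by (auto simp: prod_list_zero_iff)
    then show ?case using Cons by (subst list.map, subst prod_list.Cons, subst degree_mult_eq) auto
  qed simp
  then have len: "length rs = k" using deg dec c by (metis degree_smult_eq of_real_eq_0_iff less_irrefl)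
  have root: "poly p r = 0" if "r \<in> set rs" for r
    using that p0 rs by (metis set_mset_mset set_count_proots mem_Collect_eq)
  have pe: "poly p z = of_real c * (\<Prod>i<k. z - rs ! i)" for z
  proof -
    have "poly (\<Prod>x\<leftarrow>rs. [:-x, 1:]) z = (\<Prod>x\<leftarrow>rs. z - x)" by (induction rs) (auto simp: algebra_simps)
    also have "\<dots> = (\<Prod>i<k. z - rs ! i)" using len by (simp add: prod.list_conv_set_nth atLeast0LessThan)
    finally show ?thesis by (subst dec) simp
  qed
  define \<mu> where "\<mu> i = - Re (rs ! i)" for i
  have rsi: "rs ! i = - of_real (\<mu> i)" "0 < \<mu> i" if "i < k" for i
    using roots[OF root, of "rs ! i"] that len unfolding \<mu>_def by (auto simp: complex_eq_iff)
  have "(\<Prod>i<k. 0 - rs ! i) = (\<Prod>i<k. of_real (\<mu> i))" by (intro prod.cong refl) (simp add: rsi)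
  then have 0: "poly p 0 = of_real (c * (\<Prod>i<k. \<mu> i))" unfolding pe by simp
  have "(\<Prod>i<k. 1 - rs ! i) = (\<Prod>i<k. of_real (1 + \<mu> i))" by (intro prod.cong refl) (simp add: rsi)
  then have 1: "poly p 1 = of_real (c * (\<Prod>i<k. 1 + \<mu> i))" unfolding pe by simp
  have pos: "0 < (\<Prod>i<k. \<mu> i)" "0 < (\<Prod>i<k. 1 + \<mu> i)"
    using rsi by (auto intro!: prod_pos add_pos_pos)
  have "root k c * (1 + root k (\<Prod>i<k. \<mu> i)) \<le> root k c * root k (\<Prod>i<k. 1 + \<mu> i)"
    using prod_one_plus_ge[OF k, of \<mu>] rsi c k by (intro mult_left_mono) auto
  then have "root k (c * (\<Prod>i<k. \<mu> i)) + root k c \<le> root k (c * (\<Prod>i<k. 1 + \<mu> i))"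
    by (simp add: real_root_mult algebra_simps)
  then show ?thesis using that[OF 0 1] pos c by simp
qed

text \<open>In \<open>hsym k (A + t B)\<close> the values at t = 0 and t = 1 belong to A and A + B,
  and the leading coefficient in t belongs to B.\<close>

lemma pos_cone_superadditive:
  fixes A B :: "complex^'n::finite^'n"
  assumes A: "A \<in> pos_cone k" and B: "B \<in> pos_cone k" and k: "1 \<le> k" "k \<le> CARD('n)"
  shows "0 < Re (hsym k (A + B))"
    and "root k (Re (hsym k A)) + root k (Re (hsym k B)) \<le> root k (Re (hsym k (A + B)))"
proof -
  let ?p = "line_poly k A B"
  have nz: "hsym k B \<noteq> 0" using B by (rule hsym_pos_cone_ne) simp
  have c: "0 < Re (hsym k B)" "hsym k B = of_real (Re (hsym k B))"
    using B hsym_hermitian unfolding pos_cone_def by auto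
  obtain a b where "poly ?p 0 = of_real a" "poly ?p 1 = of_real b" "0 < a" "0 < b"
    "root k a + root k (Re (hsym k B)) \<le> root k b"
  proof (rule complex_poly_negative_roots)
    show "degree ?p = k" by (rule degree_line_poly(1)[OF k(2) nz])
    show "lead_coeff ?p = of_real (Re (hsym k B))" using degree_line_poly(2)[OF k(2) nz] c(2) by simp
    show "Im r = 0 \<and> Re r < 0" if "poly ?p r = 0" for r
      using hsym_line_roots_neg[OF A B k] that by (simp add: poly_line_poly)
  qed (use k c in auto)
  then show "0 < Re (hsym k (A + B))"
    "root k (Re (hsym k A)) + root k (Re (hsym k B)) \<le> root k (Re (hsym k (A + B)))"
    by (simp_all add: poly_line_poly cscale_simps)
qed

lemma pos_cone_add:
  fixes A B :: "complex^'n::finite^'n"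
  assumes A: "A \<in> pos_cone k" and B: "B \<in> pos_cone k" and k: "k \<le> CARD('n)"
  shows "A + B \<in> pos_cone k"
proof -
  have "0 < Re (hsym j (A + B))" if "j \<le> k" for j
  proof (cases "j = 0")
    case False
    then show ?thesis using pos_cone_superadditive(1)[of A j B] A B that k pos_cone_mono[OF that] by auto
  qed (simp add: hsym_0)
  then show ?thesis using A B by (auto simp: pos_cone_def intro!: hermitian_intros)
qed

text \<open>The open case for A + e I and B + e I, in the limit e -> 0.\<close>

lemma nonneg_cone_superadditive:
  fixes A B :: "complex^'n::finite^'n"
  assumes A: "A \<in> nonneg_cone k" and B: "B \<in> nonneg_cone k" and k: "1 \<le> k" "k \<le> CARD('n)"
  shows "A + B \<in> nonneg_cone k"
    and "root k (Re (hsym k A)) + root k (Re (hsym k B)) \<le> root k (Re (hsym k (A + B)))"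
proof -
  let ?s = "\<lambda>X e. X + cscale (of_real e) (mat 1) :: complex^'n^'n"
  have lim: "((\<lambda>e. Re (hsym j (?s X e))) \<longlongrightarrow> Re (hsym j X)) (at_right 0)" for j X
  proof -
    have "continuous_on UNIV (\<lambda>e. Re (hsym j (?s X e)))" by (intro continuous_intros)
    then have "((\<lambda>e. Re (hsym j (?s X e))) \<longlongrightarrow> Re (hsym j (?s X 0))) (at 0)" unfolding continuous_on_def by blast
    then show ?thesis by (simp add: cscale_simps filterlim_at_split)
  qed
  have lim2: "((\<lambda>e. Re (hsym j (?s A e + ?s B e))) \<longlongrightarrow> Re (hsym j (A + B))) (at_right 0)" for j
  proof -
    have "continuous_on UNIV (\<lambda>e. Re (hsym j (?s A e + ?s B e)))" by (intro continuous_intros)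
    then have "((\<lambda>e. Re (hsym j (?s A e + ?s B e))) \<longlongrightarrow> Re (hsym j (?s A 0 + ?s B 0))) (at 0)" unfolding continuous_on_def by blast
    then show ?thesis by (simp add: cscale_simps filterlim_at_split)
  qed
  have pos: "\<forall>\<^sub>F e in at_right (0::real). 0 < e" by (simp add: eventually_at_right_less)
  have cone: "?s A e \<in> pos_cone k" "?s B e \<in> pos_cone k" if "0 < e" for e
    using A B k that by (auto intro!: nonneg_cone_add_id)
  have "0 \<le> Re (hsym j (A + B))" if "j \<le> k" for j
  proof (rule tendsto_lowerbound[OF lim2])
    show "\<forall>\<^sub>F e in at_right 0. 0 \<le> Re (hsym j (?s A e + ?s B e))"
      using pos
    proof eventually_elim
      case (elim e)
      have "?s A e + ?s B e \<in> pos_cone k" by (rule pos_cone_add[OF cone[OF elim] k(2)])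
      then show ?case using that unfolding pos_cone_def by (blast intro: less_imp_le)
    qed
  qed simp
  then show "A + B \<in> nonneg_cone k" using A B by (auto simp: nonneg_cone_def intro!: hermitian_intros)
  show "root k (Re (hsym k A)) + root k (Re (hsym k B)) \<le> root k (Re (hsym k (A + B)))"
  proof (rule tendsto_le[of "at_right (0::real)"])
    show "((\<lambda>e. root k (Re (hsym k (?s A e + ?s B e)))) \<longlongrightarrow> root k (Re (hsym k (A + B)))) (at_right 0)"
      by (intro tendsto_real_root lim2)
    show "((\<lambda>e. root k (Re (hsym k (?s A e))) + root k (Re (hsym k (?s B e)))) \<longlongrightarrow>
      root k (Re (hsym k A)) + root k (Re (hsym k B))) (at_right 0)"
      by (intro tendsto_intros tendsto_real_root lim)
    show "\<forall>\<^sub>F e in at_right 0. root k (Re (hsym k (?s A e))) + root k (Re (hsym k (?s B e)))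
      \<le> root k (Re (hsym k (?s A e + ?s B e)))"
      using pos by eventually_elim (use pos_cone_superadditive(2)[OF cone k] in blast)
  qed simp
qed

definition hsym_ge :: "nat \<Rightarrow> real \<Rightarrow> (complex^'n::finite^'n) set"
  where "hsym_ge k c = {A \<in> nonneg_cone k. c \<le> Re (hsym k A)}"

lemma nonneg_cone_scale:
  assumes A: "A \<in> nonneg_cone k" and k: "k \<le> CARD('n)" and e: "0 \<le> e"
  shows "e *\<^sub>R A \<in> (nonneg_cone k :: (complex^'n::finite^'n) set)"
  using assms unfolding nonneg_cone_def cscale_of_real[symmetric]
  by (auto simp: hsym_scale simp flip: of_real_power intro!: hermitian_intros)

lemma hsym_scaleR:
  fixes A :: "complex^'n::finite^'n"
  shows "k \<le> CARD('n) \<Longrightarrow> Re (hsym k (e *\<^sub>R A)) = e ^ k * Re (hsym k A)"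
  unfolding cscale_of_real[symmetric] by (simp add: hsym_scale flip: of_real_power)

text \<open>The k-th root of \<open>hsym k\<close> is superadditive and positively homogeneous of
  degree 1, hence concave on the cone.\<close>

lemma convex_hsym_ge:
  assumes k: "1 \<le> k" "k \<le> CARD('n)" and c: "0 \<le> c"
  shows "convex (hsym_ge k c :: (complex^'n::finite^'n) set)"
proof (rule convexI)
  fix A B :: "complex^'n^'n" and u v :: real
  assume A: "A \<in> hsym_ge k c" and B: "B \<in> hsym_ge k c" and uv: "0 \<le> u" "0 \<le> v" "u + v = 1"
  have cone: "u *\<^sub>R A \<in> nonneg_cone k" "v *\<^sub>R B \<in> nonneg_cone k"
    using A B k uv by (auto simp: hsym_ge_def intro!: nonneg_cone_scale)
  have r: "e * root k c \<le> root k (Re (hsym k (e *\<^sub>R X)))" if "0 \<le> e" "X \<in> hsym_ge k c" for e and X :: "complex^'n^'n"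
    using that k by (simp add: hsym_scaleR real_root_mult real_root_power[symmetric] hsym_ge_def mult_left_mono real_root_pos2)
  have "root k c = u * root k c + v * root k c" using uv by (simp flip: distrib_right)
  also have "\<dots> \<le> root k (Re (hsym k (u *\<^sub>R A + v *\<^sub>R B)))"
    using nonneg_cone_superadditive(2)[OF cone k] r[of u A] r[of v B] uv A B by linarith
  finally show "u *\<^sub>R A + v *\<^sub>R B \<in> hsym_ge k c"
    using nonneg_cone_superadditive(1)[OF cone k] k by (simp add: hsym_ge_def)
qed

lemma closed_hermitian: "closed {A :: complex^'n::finite^'n. hermitian A}"
  unfolding hermitian_def adjoint_matrix_def by (intro closed_Collect_eq continuous_intros)

lemma closed_hsym_ge: "closed (hsym_ge k c :: (complex^'n::finite^'n) set)"
proof -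
  have "hsym_ge k c = {A :: complex^'n^'n. hermitian A} \<inter> (\<Inter>j\<le>k. {A. 0 \<le> Re (hsym j A)}) \<inter> {A. c \<le> Re (hsym k A)}"
    unfolding hsym_ge_def nonneg_cone_def by auto
  also have "closed \<dots>"
    by (intro closed_Int closed_hermitian closed_INT closed_Collect_le continuous_intros ballI)
  finally show ?thesis .
qed

lemma rank1_nonneg_cone: "k \<le> CARD('n) \<Longrightarrow> rank1 v \<in> (nonneg_cone k :: (complex^'n::finite^'n) set)"
  unfolding nonneg_cone_def by (auto intro: hermitian_intros hsym_rank1_nonneg)

text \<open>Superadditivity with a nonnegative second root; this is the degenerate ellipticity of
  the operator.\<close>

lemma hsym_ge_add:
  fixes A B :: "complex^'n::finite^'n"
  assumes A: "A \<in> hsym_ge k c" and B: "B \<in> nonneg_cone k" and k: "1 \<le> k" "k \<le> CARD('n)"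
  shows "A + B \<in> hsym_ge k c"
proof -
  have A': "A \<in> nonneg_cone k" "c \<le> Re (hsym k A)" using A by (auto simp: hsym_ge_def)
  have "0 \<le> root k (Re (hsym k B))" using B k by (simp add: nonneg_cone_def)
  then have "root k (Re (hsym k A)) \<le> root k (Re (hsym k (A + B)))"
    using nonneg_cone_superadditive(2)[OF A'(1) B k] by linarith
  then show ?thesis using A' k nonneg_cone_superadditive(1)[OF A'(1) B k] by (simp add: hsym_ge_def)
qed

lemma hsym_ge_nonempty:
  assumes k: "1 \<le> k" "k \<le> CARD('n)" and c: "0 \<le> c"
  shows "hsym_ge k c \<noteq> ({} :: (complex^'n::finite^'n) set)"
proof -
  have "root k c *\<^sub>R mat 1 \<in> (hsym_ge k c :: (complex^'n^'n) set)"
    using k c subsetD[OF pos_cone_subset id_pos_cone[OF k(2)]]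
    by (auto simp: hsym_ge_def hsym_scaleR hsym_id intro!: nonneg_cone_scale)
  then show ?thesis by blast
qed

section \<open>C^2 functions with their derivatives as explicit data\<close>

definition C2jet :: "'a::real_normed_vector set \<Rightarrow> ('a \<Rightarrow> real) \<Rightarrow> ('a \<Rightarrow> 'a \<Rightarrow>\<^sub>L real) \<Rightarrow>
    ('a \<Rightarrow> 'a \<Rightarrow>\<^sub>L 'a \<Rightarrow>\<^sub>L real) \<Rightarrow> bool"
  where "C2jet U q D D2 \<longleftrightarrow>
    (\<forall>x\<in>U. (q has_derivative blinfun_apply (D x)) (at x)) \<and>
    (\<forall>x\<in>U. (D has_derivative blinfun_apply (D2 x)) (at x)) \<and> continuous_on U D2"

lemma C2_on_C2jet: "C2_on U q \<longleftrightarrow> (\<exists>D D2. C2jet U q D D2)"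
  unfolding C2_on_def C2jet_def ..

lemma C2jet_subset: "C2jet U q D D2 \<Longrightarrow> V \<subseteq> U \<Longrightarrow> C2jet V q D D2"
  unfolding C2jet_def by (auto intro: continuous_on_subset)

lemma C2jetD:
  assumes "C2jet U q D D2" "x \<in> U"
  shows "(q has_derivative blinfun_apply (D x)) (at x)" "(D has_derivative blinfun_apply (D2 x)) (at x)"
  using assms unfolding C2jet_def by auto

lemma C2jet_add:
  assumes "C2jet U p Dp D2p" "C2jet U q Dq D2q"
  shows "C2jet U (\<lambda>x. p x + q x) (\<lambda>x. Dp x + Dq x) (\<lambda>x. D2p x + D2q x)"
  using assms unfolding C2jet_def
  by (auto simp: plus_blinfun.rep_eq[abs_def] intro!: continuous_intros has_derivative_add)

lemma C2jet_const: "C2jet U (\<lambda>x. c) (\<lambda>x. 0) (\<lambda>x. 0)"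
  unfolding C2jet_def by (auto simp: zero_blinfun.rep_eq[abs_def] intro!: continuous_intros)

lemma C2jet_cmult:
  assumes "C2jet U p Dp D2p"
  shows "C2jet U (\<lambda>x. c * p x) (\<lambda>x. c *\<^sub>R Dp x) (\<lambda>x. c *\<^sub>R D2p x)"
  using assms unfolding C2jet_def
  by (auto simp: scaleR_blinfun.rep_eq[abs_def] intro!: continuous_intros derivative_eq_intros)

definition outer :: "('a::real_normed_vector \<Rightarrow>\<^sub>L real) \<Rightarrow> 'a \<Rightarrow>\<^sub>L 'a \<Rightarrow>\<^sub>L real"
  where "outer l = blinfun_scaleR_left l o\<^sub>L l"

lemma outer_apply [simp]: "blinfun_apply (blinfun_apply (outer l) h) k = l h * l k"
  unfolding outer_def by (simp add: scaleR_blinfun.rep_eq)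

lemma C2jet_compose:
  fixes \<phi> :: "real \<Rightarrow> real"
  assumes g: "C2jet U g Dg D2g"
    and \<phi>: "\<And>s. (\<phi> has_real_derivative \<phi>' s) (at s)" "\<And>s. (\<phi>' has_real_derivative \<phi>'' s) (at s)"
      "continuous_on UNIV \<phi>''"
  shows "C2jet U (\<lambda>x. \<phi> (g x)) (\<lambda>x. \<phi>' (g x) *\<^sub>R Dg x)
    (\<lambda>x. \<phi>'' (g x) *\<^sub>R outer (Dg x) + \<phi>' (g x) *\<^sub>R D2g x)"
  unfolding C2jet_def
proof (intro conjI ballI)
  have g1: "\<And>x. x \<in> U \<Longrightarrow> (g has_derivative blinfun_apply (Dg x)) (at x)"
    and g2: "\<And>x. x \<in> U \<Longrightarrow> (Dg has_derivative blinfun_apply (D2g x)) (at x)"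
    and g3: "continuous_on U D2g" using g unfolding C2jet_def by auto
  fix x assume x: "x \<in> U"
  show "((\<lambda>x. \<phi> (g x)) has_derivative blinfun_apply (\<phi>' (g x) *\<^sub>R Dg x)) (at x)"
    using has_derivative_compose[OF g1[OF x] \<phi>(1)[of "g x", unfolded has_field_derivative_def]]
    by (simp add: scaleR_blinfun.rep_eq[abs_def] )
  have "((\<lambda>x. \<phi>' (g x)) has_derivative (\<lambda>h. \<phi>'' (g x) * Dg x h)) (at x)"
    using has_derivative_compose[OF g1[OF x] \<phi>(2)[of "g x", unfolded has_field_derivative_def]] .
  from has_derivative_scaleR[OF this g2[OF x]]
  show "((\<lambda>x. \<phi>' (g x) *\<^sub>R Dg x) has_derivative blinfun_apply (\<phi>'' (g x) *\<^sub>R outer (Dg x) + \<phi>' (g x) *\<^sub>R D2g x)) (at x)"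
    by (rule has_derivative_eq_rhs)
      (auto simp: fun_eq_iff outer_def scaleR_blinfun.rep_eq plus_blinfun.rep_eq intro!: blinfun_eqI)
next
  have g1: "\<And>x. x \<in> U \<Longrightarrow> (g has_derivative blinfun_apply (Dg x)) (at x)"
    and g2: "\<And>x. x \<in> U \<Longrightarrow> (Dg has_derivative blinfun_apply (D2g x)) (at x)"
    and g3: "continuous_on U D2g" using g unfolding C2jet_def by auto
  have cg: "continuous_on U g" by (rule has_derivative_continuous_on) (use g1 has_derivative_at_withinI in blast)
  have cDg: "continuous_on U Dg" by (rule has_derivative_continuous_on) (use g2 has_derivative_at_withinI in blast)
  have c\<phi>': "continuous_on UNIV \<phi>'"
    by (intro continuous_at_imp_continuous_on ballI DERIV_isCont[OF \<phi>(2)])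
  show "continuous_on U (\<lambda>x. \<phi>'' (g x) *\<^sub>R outer (Dg x) + \<phi>' (g x) *\<^sub>R D2g x)"
    unfolding outer_def
    by (intro continuous_intros continuous_on_compose2[OF \<phi>(3) cg] continuous_on_compose2[OF c\<phi>' cg] g3 cDg
        bounded_linear.continuous_on[OF bounded_linear_blinfun_scaleR_left]) auto
qed

lemma C2jet_quadratic:
  fixes S :: "'a::euclidean_space \<Rightarrow> 'a"
  assumes lin: "linear S" and sym: "\<And>x y. S x \<bullet> y = x \<bullet> S y"
  shows "C2jet U (\<lambda>x. S (x - c) \<bullet> (x - c)) (\<lambda>x. blinfun_inner_right (2 *\<^sub>R S (x - c)))
    (\<lambda>x. Blinfun (\<lambda>h. blinfun_inner_right (2 *\<^sub>R S h)))"
proof -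
  have bl: "bounded_linear S" using lin by (rule linear_conv_bounded_linear[THEN iffD1])
  have bl2: "bounded_linear (\<lambda>h. blinfun_inner_right (2 *\<^sub>R S h))"
    by (intro bounded_linear_compose[OF bounded_linear_blinfun_inner_right]
        bounded_linear_compose[OF bounded_linear_scaleR_right] bl)
  have dS: "((\<lambda>x. S (x - c)) has_derivative S) (at x)" for x
    using has_derivative_compose[OF _ bounded_linear_imp_has_derivative[OF bl], of "\<lambda>x. x - c" "\<lambda>x. x" x UNIV]
    by (simp add: has_derivative_diff[OF has_derivative_ident has_derivative_const, simplified])
  show ?thesis
    unfolding C2jet_def
  proof (intro conjI ballI)
    fix x
    have "((\<lambda>x. S (x - c) \<bullet> (x - c)) has_derivative (\<lambda>h. S (x - c) \<bullet> h + S h \<bullet> (x - c))) (at x)"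
      using has_derivative_inner[OF dS has_derivative_diff[OF has_derivative_ident has_derivative_const]] by simp
    then show "((\<lambda>x. S (x - c) \<bullet> (x - c)) has_derivative blinfun_apply (blinfun_inner_right (2 *\<^sub>R S (x - c)))) (at x)"
      by (rule has_derivative_eq_rhs) (auto simp: blinfun_inner_right.rep_eq fun_eq_iff sym inner_commute)
    have "((\<lambda>x. blinfun_inner_right (2 *\<^sub>R S (x - c))) has_derivative (\<lambda>h. blinfun_inner_right (2 *\<^sub>R S h))) (at x)"
      by (intro bounded_linear.has_derivative[OF bounded_linear_blinfun_inner_right]
          bounded_linear.has_derivative[OF bounded_linear_scaleR_right] dS)
    then show "((\<lambda>x. blinfun_inner_right (2 *\<^sub>R S (x - c))) has_derivative
        blinfun_apply (Blinfun (\<lambda>h. blinfun_inner_right (2 *\<^sub>R S h)))) (at x)"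
      using bounded_linear_Blinfun_apply[OF bl2] by simp
  qed (rule continuous_on_const)
qed

lemma Blinfun_quadratic_apply:
  fixes S :: "'a::euclidean_space \<Rightarrow> 'a"
  assumes lin: "linear S"
  shows "blinfun_apply (blinfun_apply (Blinfun (\<lambda>h. blinfun_inner_right (2 *\<^sub>R S h))) h) k = 2 * (S h \<bullet> k)"
proof -
  have bl: "bounded_linear S" using lin by (rule linear_conv_bounded_linear[THEN iffD1])
  have bl2: "bounded_linear (\<lambda>h. blinfun_inner_right (2 *\<^sub>R S h))"
    by (intro bounded_linear_compose[OF bounded_linear_blinfun_inner_right]
        bounded_linear_compose[OF bounded_linear_scaleR_right] bl)
  show ?thesis unfolding bounded_linear_Blinfun_apply[OF bl2] by (simp add: blinfun_inner_right.rep_eq)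
qed

text \<open>The mean value theorem along h for a difference along k, followed by linearisation of D
  at x. The second difference is symmetric in h and k, which gives the symmetry of the
  Hessian.\<close>

lemma second_difference:
  assumes j: "C2jet U q D D2" and U: "open U" "x \<in> U" and e: "0 < e"
  shows "\<forall>\<^sub>F s in at_right 0. \<bar>(q (x + s *\<^sub>R h + s *\<^sub>R k) - q (x + s *\<^sub>R h) - q (x + s *\<^sub>R k) + q x) - s\<^sup>2 * D2 x k h\<bar>
     \<le> s\<^sup>2 * (e * (2 * (norm h + norm k)\<^sup>2))"
proof -
  let ?N = "norm h + norm k"
  obtain r where r: "r > 0" "ball x r \<subseteq> U" using U openE by blast
  from C2jetD(2)[OF j U(2)] obtain d where d: "d > 0"
    "\<And>y. norm (y - x) < d \<Longrightarrow> norm (D y - D x - D2 x (y - x)) \<le> e * norm (y - x)"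
    unfolding has_derivative_at_alt using e by blast
  define \<delta> where "\<delta> = min r d / (?N + 1)"
  have \<delta>: "\<delta> > 0" unfolding \<delta>_def using r d by (auto intro!: divide_pos_pos add_nonneg_pos)
  have "\<forall>\<^sub>F s in at_right 0. 0 < s \<and> s < \<delta>"
    using \<delta> eventually_at_right_real[of 0 \<delta>] by (auto elim: eventually_mono)
  then show ?thesis
  proof eventually_elim
    case (elim s)
    have "s * (?N + 1) < min r d" using elim unfolding \<delta>_def by (simp add: pos_less_divide_eq add_nonneg_pos)
    then have sN: "s * ?N < r" "s * ?N < d" using elim by (auto simp: distrib_left)
    have small: "norm (t *\<^sub>R (s *\<^sub>R h) + c *\<^sub>R (s *\<^sub>R k)) \<le> s * ?N" if "0 \<le> t" "t \<le> 1" "c \<in> {0, 1}" for t c :: real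
    proof -
      have "norm (t *\<^sub>R (s *\<^sub>R h) + c *\<^sub>R (s *\<^sub>R k)) \<le> t * (s * norm h) + c * (s * norm k)"
        using elim that by (intro order_trans[OF norm_triangle_ineq]) auto
      also have "\<dots> \<le> 1 * (s * norm h) + 1 * (s * norm k)"
        using elim that by (intro add_mono mult_right_mono) auto
      finally show ?thesis by (simp add: distrib_left)
    qed
    define y where "y c t = x + t *\<^sub>R (s *\<^sub>R h) + c *\<^sub>R (s *\<^sub>R k)" for c t :: real
    have yU: "y c t \<in> U" if "0 \<le> t" "t \<le> 1" "c \<in> {0, 1}" for c t
    proof -
      have "norm (y c t - x) < r" using small[OF that] sN unfolding y_def by (simp add: add.assoc)
      then show ?thesis using r(2) by (auto simp: dist_norm norm_minus_commute)
    qed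
    have dy: "((\<lambda>t. q (y c t)) has_real_derivative D (y c t) (s *\<^sub>R h)) (at t)" if "0 \<le> t" "t \<le> 1" "c \<in> {0, 1}" for c t
    proof -
      have "((\<lambda>t. y c t) has_derivative (\<lambda>t. t *\<^sub>R (s *\<^sub>R h))) (at t)"
        unfolding y_def by (auto intro!: derivative_eq_intros)
      from has_derivative_compose[OF this C2jetD(1)[OF j yU[OF that]]]
      show ?thesis unfolding has_field_derivative_def
        by (rule has_derivative_eq_rhs) (auto simp: fun_eq_iff blinfun.scaleR_right)
    qed
    define g where "g t = q (y 1 t) - q (y 0 t)" for t
    have "\<exists>t>0. t < 1 \<and> g 1 - g 0 = (1 - 0) * (D (y 1 t) (s *\<^sub>R h) - D (y 0 t) (s *\<^sub>R h))"
    proof (rule MVT2)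
      fix t :: real assume "0 \<le> t" "t \<le> 1"
      then show "(g has_real_derivative D (y 1 t) (s *\<^sub>R h) - D (y 0 t) (s *\<^sub>R h)) (at t)"
        unfolding g_def by (intro DERIV_diff dy) auto
    qed simp
    then obtain t where t: "0 < t" "t < 1" "g 1 - g 0 = D (y 1 t) (s *\<^sub>R h) - D (y 0 t) (s *\<^sub>R h)" by auto
    define E where "E c = D (y c t) - D x - D2 x (y c t - x)" for c
    have E: "norm (E c) \<le> e * (s * ?N)" if "c \<in> {0, 1}" for c
    proof -
      have n: "norm (y c t - x) \<le> s * ?N" using small[of t c] t that unfolding y_def by (simp add: add.assoc)
      then have "norm (E c) \<le> e * norm (y c t - x)" unfolding E_def using d(2) sN by auto
      also have "\<dots> \<le> e * (s * ?N)" using n e by (intro mult_left_mono) auto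
      finally show ?thesis .
    qed
    have "D (y 1 t) - D (y 0 t) = E 1 - E 0 + D2 x (y 1 t - y 0 t)"
      unfolding E_def by (simp add: blinfun.diff_right)
    also have "y 1 t - y 0 t = s *\<^sub>R k" unfolding y_def by simp
    finally have "(D (y 1 t) - D (y 0 t)) (s *\<^sub>R h) = (E 1 - E 0 + D2 x (s *\<^sub>R k)) (s *\<^sub>R h)"
      by (rule arg_cong)
    then have "D (y 1 t) (s *\<^sub>R h) - D (y 0 t) (s *\<^sub>R h) = (E 1 - E 0) (s *\<^sub>R h) + s\<^sup>2 * D2 x k h"
      by (simp only: blinfun.add_left blinfun.diff_left[of "D _"])
        (simp add: blinfun.scaleR_left blinfun.scaleR_right power2_eq_square)
    then have "\<bar>(g 1 - g 0) - s\<^sup>2 * D2 x k h\<bar> = norm ((E 1 - E 0) (s *\<^sub>R h))" using t by simp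
    also have "\<dots> \<le> norm (E 1 - E 0) * norm (s *\<^sub>R h)" by (rule norm_blinfun)
    also have "\<dots> \<le> (e * (s * ?N) + e * (s * ?N)) * (s * ?N)"
      using E[of 1] E[of 0] elim e
      by (intro mult_mono order_trans[OF norm_triangle_ineq4] add_mono) (auto intro!: mult_nonneg_nonneg add_nonneg_nonneg)
    also have "\<dots> = s\<^sup>2 * (e * (2 * ?N\<^sup>2))" by (simp add: power2_eq_square algebra_simps)
    also have "g 1 - g 0 = q (x + s *\<^sub>R h + s *\<^sub>R k) - q (x + s *\<^sub>R h) - q (x + s *\<^sub>R k) + q x"
      unfolding g_def y_def by simp
    finally show ?case .
  qed
qed

lemma C2jet_symmetric:
  assumes j: "C2jet U q D D2" and U: "open U" "x \<in> U"
  shows "D2 x h k = D2 x k h"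
proof -
  let ?M = "2 * (norm h + norm k)\<^sup>2"
  have bound: "\<bar>D2 x h k - D2 x k h\<bar> \<le> e * (2 * ?M)" if e: "0 < e" for e
  proof -
    have "\<forall>\<^sub>F s in at_right 0. 0 < (s::real)" by (simp add: eventually_at_right_less)
    with second_difference[OF j U e, of h k] second_difference[OF j U e, of k h]
    have "\<forall>\<^sub>F s in at_right (0::real). \<bar>D2 x h k - D2 x k h\<bar> \<le> e * (2 * ?M)"
    proof eventually_elim
      case (elim s)
      have "\<bar>s\<^sup>2 * D2 x h k - s\<^sup>2 * D2 x k h\<bar> \<le> s\<^sup>2 * (e * ?M) + s\<^sup>2 * (e * ?M)"
        using elim(1,2) by (simp add: add.commute[of "norm k"] add.assoc add.commute[of "s *\<^sub>R k"] abs_le_iff algebra_simps)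
      then have "s\<^sup>2 * \<bar>D2 x h k - D2 x k h\<bar> \<le> s\<^sup>2 * (e * (2 * ?M))"
        by (simp add: abs_mult right_diff_distrib[symmetric] mult_ac del: right_diff_distrib)
      then show ?case using elim(3) by simp
    qed
    then show ?thesis by (simp add: eventually_const)
  qed
  have "\<bar>D2 x h k - D2 x k h\<bar> \<le> 0"
  proof (rule field_le_epsilon)
    fix e :: real assume e: "0 < e"
    have "\<bar>D2 x h k - D2 x k h\<bar> \<le> e / (2 * ?M + 1) * (2 * ?M)"
      by (rule bound) (use e in \<open>auto intro!: divide_pos_pos add_nonneg_pos\<close>)
    also have "\<dots> \<le> e" using e by (simp add: divide_le_eq add_nonneg_pos)
    finally show "\<bar>D2 x h k - D2 x k h\<bar> \<le> 0 + e" by simp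
  qed
  then show ?thesis by simp
qed

lemma C2jet_local_min:
  assumes j: "C2jet U q D D2" and U: "open U" "x \<in> U" and min: "\<forall>\<^sub>F y in nhds x. q x \<le> q y"
  shows "0 \<le> D2 x h h"
proof (rule ccontr)
  assume neg: "\<not> 0 \<le> D2 x h h"
  define y where "y t = x + t *\<^sub>R h" for t :: real
  have cy: "continuous_on UNIV y" unfolding y_def by (intro continuous_intros)
  have y0: "y 0 = x" by (simp add: y_def)
  have lim: "(y \<longlongrightarrow> x) (nhds 0)"
    using cy y0 by (metis UNIV_I continuous_on_eq_continuous_at isCont_def open_UNIV tendsto_nhds_iff)
  have ev: "\<forall>\<^sub>F t in nhds 0. y t \<in> U \<and> q x \<le> q (y t)"
    using lim topological_tendstoD[OF lim U] min by (auto intro: eventually_conj eventually_compose_filterlim)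
  then obtain r where r: "r > 0" "\<And>t. dist t 0 < r \<Longrightarrow> y t \<in> U" "\<And>t. dist t 0 < r \<Longrightarrow> q x \<le> q (y t)"
    unfolding eventually_nhds_metric by blast
  have dy: "(y has_derivative (\<lambda>s. s *\<^sub>R h)) (at t)" for t unfolding y_def by (auto intro!: derivative_eq_intros)
  have d1: "((\<lambda>t. q (y t)) has_real_derivative D (y t) h) (at t)" if "\<bar>t\<bar> < r" for t
  proof -
    have "y t \<in> U" using r(2)[of t] that by (simp add: dist_norm)
    from has_derivative_compose[OF dy C2jetD(1)[OF j this]] show ?thesis
      unfolding has_field_derivative_def
      by (rule has_derivative_eq_rhs) (auto simp: fun_eq_iff blinfun.scaleR_right)
  qed
  have d2: "((\<lambda>t. D (y t) h) has_real_derivative D2 x h h) (at 0)"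
  proof -
    have "((\<lambda>t. D (y t)) has_derivative (\<lambda>s. D2 (y 0) (s *\<^sub>R h))) (at 0)"
      using has_derivative_compose[OF dy C2jetD(2)[OF j r(2)[of 0]]] r by simp
    then have "((\<lambda>t. D (y t) h) has_derivative (\<lambda>s. D2 (y 0) (s *\<^sub>R h) h)) (at 0)"
      by (rule bounded_linear.has_derivative[OF blinfun.bounded_linear_left])
    then show ?thesis unfolding has_field_derivative_def y0
      by (rule has_derivative_eq_rhs) (auto simp: fun_eq_iff blinfun.scaleR_right blinfun.scaleR_left)
  qed
  have "D (y 0) h = 0"
    by (rule DERIV_local_min[OF d1 r(1)]) (use r in \<open>auto simp: dist_norm y0\<close>)
  moreover obtain d where d: "d > 0" "\<And>t. 0 < t \<Longrightarrow> t < d \<Longrightarrow> D (y (0 + t)) h < D (y 0) h"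
    using DERIV_neg_dec_right[OF d2] neg by auto
  ultimately have dneg: "D (y t) h < 0" if "0 < t" "t < d" for t using that by simp
  define t where "t = min r d / 2"
  have t: "0 < t" "t < r" "t < d" unfolding t_def using r d by auto
  have "\<exists>z>0. z < t \<and> q (y t) - q (y 0) = (t - 0) * D (y z) h"
    by (rule MVT2) (use t d1 in auto)
  then obtain z where z: "0 < z" "z < t" "q (y t) - q (y 0) = t * D (y z) h" by auto
  then have "q (y t) < q x" using dneg[of z] t mult_pos_neg[of t "D (y z) h"] by (simp add: y0)
  then show False using r(3)[of t] t by (simp add: dist_norm)
qed

text \<open>All derivatives fall on the kernel, so continuity of w is enough.\<close>

lemma C2jet_conv:
  fixes k :: "'a::euclidean_space \<Rightarrow> real" and w :: "'a \<Rightarrow> real"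
  assumes j: "C2jet UNIV k Dk D2k" and w: "continuous_on (cbox a b) w"
  shows "C2jet UNIV (\<lambda>x. integral (cbox a b) (\<lambda>y. w y * k (x - y)))
    (\<lambda>x. integral (cbox a b) (\<lambda>y. w y *\<^sub>R Dk (x - y)))
    (\<lambda>x. integral (cbox a b) (\<lambda>y. w y *\<^sub>R D2k (x - y)))"
proof -
  have k1: "\<And>x. (k has_derivative blinfun_apply (Dk x)) (at x)"
    and k2: "\<And>x. (Dk has_derivative blinfun_apply (D2k x)) (at x)"
    and k3: "continuous_on UNIV D2k" using j unfolding C2jet_def by auto
  have c1: "continuous_on UNIV k" by (rule has_derivative_continuous_on) (use k1 in auto)
  have c2: "continuous_on UNIV Dk" by (rule has_derivative_continuous_on) (use k2 in auto)
  have sub: "((\<lambda>x. x - y) has_derivative (\<lambda>h. h)) (at x)" for x y :: 'a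
    by (auto intro!: derivative_eq_intros)
  have cw: "continuous_on (UNIV \<times> cbox a b) (\<lambda>p. w (snd p))"
    by (rule continuous_on_compose2[OF w continuous_on_snd[OF continuous_on_id]]) auto
  have cpair: "continuous_on (UNIV \<times> cbox a b) (\<lambda>p. f (fst p - snd p))" if "continuous_on UNIV f" for f :: "'a \<Rightarrow> 'c::real_normed_vector"
    by (rule continuous_on_compose2[OF that]) (auto intro!: continuous_intros)
  have cx: "continuous_on (cbox a b) (\<lambda>y. f (x - y))" if "continuous_on UNIV f" for f :: "'a \<Rightarrow> 'c::real_normed_vector" and x
    by (rule continuous_on_compose2[OF that]) (auto intro!: continuous_intros)
  show ?thesis
    unfolding C2jet_def
  proof (intro conjI ballI)
    fix x :: 'a
    have "((\<lambda>x. integral (cbox a b) (\<lambda>y. w y * k (x - y))) has_derivative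
        blinfun_apply (integral (cbox a b) (\<lambda>y. w y *\<^sub>R Dk (x - y)))) (at x within UNIV)"
    proof (rule leibniz_rule)
      fix x y
      show "((\<lambda>x. w y * k (x - y)) has_derivative blinfun_apply (w y *\<^sub>R Dk (x - y))) (at x within UNIV)"
        using has_derivative_mult_right[OF has_derivative_compose[OF sub k1], of "w y"]
        by (simp add: scaleR_blinfun.rep_eq[abs_def])
      show "(\<lambda>y. w y * k (x - y)) integrable_on cbox a b"
        by (intro integrable_continuous continuous_intros w cx c1)
      show "continuous_on (UNIV \<times> cbox a b) (\<lambda>(x, y). w y *\<^sub>R Dk (x - y))"
        unfolding case_prod_unfold by (intro continuous_intros cw cpair c2)
    qed auto
    then show "((\<lambda>x. integral (cbox a b) (\<lambda>y. w y * k (x - y))) has_derivative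
        blinfun_apply (integral (cbox a b) (\<lambda>y. w y *\<^sub>R Dk (x - y)))) (at x)" by simp
    have "((\<lambda>x. integral (cbox a b) (\<lambda>y. w y *\<^sub>R Dk (x - y))) has_derivative
        blinfun_apply (integral (cbox a b) (\<lambda>y. w y *\<^sub>R D2k (x - y)))) (at x within UNIV)"
    proof (rule leibniz_rule)
      fix x y
      show "((\<lambda>x. w y *\<^sub>R Dk (x - y)) has_derivative blinfun_apply (w y *\<^sub>R D2k (x - y))) (at x within UNIV)"
        using has_derivative_scaleR_right[OF has_derivative_compose[OF sub k2], of "w y"]
        by (simp add: scaleR_blinfun.rep_eq[abs_def])
      show "(\<lambda>y. w y *\<^sub>R Dk (x - y)) integrable_on cbox a b"
        by (intro integrable_continuous continuous_intros w cx c2)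
      show "continuous_on (UNIV \<times> cbox a b) (\<lambda>(x, y). w y *\<^sub>R D2k (x - y))"
        unfolding case_prod_unfold by (intro continuous_intros cw cpair k3)
    qed auto
    then show "((\<lambda>x. integral (cbox a b) (\<lambda>y. w y *\<^sub>R Dk (x - y))) has_derivative
        blinfun_apply (integral (cbox a b) (\<lambda>y. w y *\<^sub>R D2k (x - y)))) (at x)" by simp
  next
    show "continuous_on UNIV (\<lambda>x. integral (cbox a b) (\<lambda>y. w y *\<^sub>R D2k (x - y)))"
      by (rule integral_continuous_on_param) (unfold case_prod_unfold, intro continuous_intros cw cpair k3)
  qed
qed

section \<open>Constant coefficient elliptic operators q -> tr (T D^2 q)\<close>

definition trace_op :: "('a \<Rightarrow> 'a) \<Rightarrow> ('a::euclidean_space \<Rightarrow>\<^sub>L 'a \<Rightarrow>\<^sub>L real) \<Rightarrow> real"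
  where "trace_op T H = (\<Sum>b\<in>Basis. H b (T b))"

lemma trace_op_add: "trace_op T (G + H) = trace_op T G + trace_op T H"
  unfolding trace_op_def by (simp add: plus_blinfun.rep_eq sum.distrib)

lemma trace_op_scaleR: "trace_op T (c *\<^sub>R H) = c * trace_op T H"
  unfolding trace_op_def by (simp add: scaleR_blinfun.rep_eq sum_distrib_left)

lemma trace_op_0: "trace_op T 0 = 0"
  unfolding trace_op_def by (simp add: zero_blinfun.rep_eq)

lemma bounded_linear_trace_op: "bounded_linear (trace_op T)"
  unfolding trace_op_def[abs_def]
  by (intro bounded_linear_sum bounded_linear_compose[OF blinfun.bounded_linear_left blinfun.bounded_linear_left])

text \<open>T holds the coefficients of the operator; S is its inverse and enters the exponent of
  the heat kernel.\<close>

locale pos_def_op =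
  fixes T S :: "'a::euclidean_space \<Rightarrow> 'a"
  assumes linear_T: "linear T" and linear_S: "linear S"
    and sym_T: "T x \<bullet> y = x \<bullet> T y" and sym_S: "S x \<bullet> y = x \<bullet> S y"
    and S_T: "S (T x) = x" and T_nonneg: "0 \<le> T x \<bullet> x"
    and S_pos: "x \<noteq> 0 \<Longrightarrow> 0 < S x \<bullet> x"
begin

lemma trace_op_outer:
  fixes l :: "'a \<Rightarrow>\<^sub>L real"
  assumes "\<And>y. l y = p \<bullet> y"
  shows "trace_op T (outer l) = p \<bullet> T p"
proof -
  have "trace_op T (outer l) = (\<Sum>b\<in>Basis. (p \<bullet> b) * (T p \<bullet> b))"
    unfolding trace_op_def by (simp add: assms sym_T)
  also have "\<dots> = p \<bullet> T p" by (rule euclidean_inner[symmetric])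
  finally show ?thesis .
qed

text \<open>Completing squares one basis vector at a time: H is reduced by rank one forms l(x) l(y),
  whose trace against T is p . T p >= 0. This avoids diagonalising H or T.\<close>

lemma trace_op_psd_nonneg:
  fixes H :: "'a \<Rightarrow>\<^sub>L 'a \<Rightarrow>\<^sub>L real"
  assumes "\<And>x y. H x y = H y x" and "\<And>x. 0 \<le> H x x"
  shows "0 \<le> trace_op T H"
proof -
  have "0 \<le> trace_op T H" if "finite F" "F \<subseteq> Basis" "\<And>x y. H x y = H y x" "\<And>x. 0 \<le> H x x"
    "\<And>b y. b \<in> Basis - F \<Longrightarrow> H b y = 0" for F and H :: "'a \<Rightarrow>\<^sub>L 'a \<Rightarrow>\<^sub>L real"
    using that
  proof (induction F arbitrary: H rule: finite_induct)
    case empty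
    then show ?case unfolding trace_op_def by simp
  next
    case (insert c F)
    show ?case
    proof (cases "H c c = 0")
      case True
      have "H c y = 0" for y
      proof (rule ccontr)
        assume ne: "H c y \<noteq> 0"
        \<comment> \<open>Since H c c = 0, the quadratic form at y + t c is affine in t; this t
          makes it equal to -1.\<close>
        define t where "t = - (H y y + 1) / (2 * H c y)"
        have "0 \<le> H (y + t *\<^sub>R c) (y + t *\<^sub>R c)" by (rule insert.prems(3))
        also have "\<dots> = H y y + 2 * t * H c y"
          using True insert.prems(2)[of y c]
          by (simp add: blinfun.add_left blinfun.add_right blinfun.scaleR_left blinfun.scaleR_right)
        also have "\<dots> = -1" using ne unfolding t_def by (simp add: field_simps)
        finally show False by simp
      qed
      then have "H b y = 0" if "b \<in> Basis - F" for b y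
        using insert.prems(4)[of b y] that by (cases "b = c") auto
      then show ?thesis using insert.IH[of H] insert.prems by auto
    next
      case False
      then have pos: "0 < H c c" using insert.prems(3)[of c] by linarith
      \<comment> \<open>The Schur complement with respect to c: it vanishes on c and on the basis
        vectors where H did.\<close>
      define G where "G = H - (1 / H c c) *\<^sub>R outer (H c)"
      have G: "G x y = H x y - H c x * H c y / H c c" for x y
        unfolding G_def by (simp add: minus_blinfun.rep_eq scaleR_blinfun.rep_eq)
      have "0 \<le> G x x" for x
      proof -
        define t where "t = H c x / H c c"
        have "0 \<le> H (x - t *\<^sub>R c) (x - t *\<^sub>R c)" by (rule insert.prems(3))
        also have "\<dots> = H x x - 2 * t * H c x + t * t * H c c"
          using insert.prems(2)[of x c]
          by (simp add: blinfun.diff_left blinfun.diff_right blinfun.scaleR_left blinfun.scaleR_right algebra_simps)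
        also have "\<dots> = G x x" unfolding G t_def using pos by (simp add: field_simps)
        finally show ?thesis .
      qed
      moreover have "G x y = G y x" for x y unfolding G by (simp add: insert.prems(2)[of x y])
      moreover have "G b y = 0" if "b \<in> Basis - F" for b y
      proof (cases "b = c")
        case True
        then show ?thesis unfolding G using pos by simp
      next
        case False
        then show ?thesis unfolding G using insert.prems(4)[of b] that insert.prems(2)[of c b] by simp
      qed
      ultimately have "0 \<le> trace_op T G" using insert.IH[of G] insert.prems(1) by blast
      define p where "p = (\<Sum>b\<in>Basis. H c b *\<^sub>R b)"
      have p: "H c y = p \<bullet> y" for y
      proof -
        have "H c y = H c (\<Sum>b\<in>Basis. (y \<bullet> b) *\<^sub>R b)" by (simp add: euclidean_representation)
        also have "\<dots> = p \<bullet> y" unfolding p_def inner_sum_left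
          by (simp only: blinfun.sum_right blinfun.scaleR_right inner_scaleR_left real_scaleR_def inner_commute[of y] mult.commute)
        finally show ?thesis .
      qed
      have "0 \<le> p \<bullet> T p" using T_nonneg[of p] by (simp add: inner_commute)
      then have "0 \<le> trace_op T ((1 / H c c) *\<^sub>R outer (H c))"
        unfolding trace_op_scaleR trace_op_outer[of "H c" p, OF p] using pos by simp
      moreover have "trace_op T H = trace_op T G + trace_op T ((1 / H c c) *\<^sub>R outer (H c))"
        unfolding G_def trace_op_add[symmetric] by simp
      ultimately show ?thesis using \<open>0 \<le> trace_op T G\<close> by linarith
    qed
  qed
  from this[of Basis H] show ?thesis using assms by simp
qed

definition visc_ge :: "real \<Rightarrow> 'a set \<Rightarrow> ('a \<Rightarrow> real) \<Rightarrow> bool"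
  where "visc_ge b V w \<longleftrightarrow> (\<forall>x\<in>V. \<forall>U q D D2. open U \<longrightarrow> x \<in> U \<longrightarrow> C2jet U q D D2 \<longrightarrow> q x = w x \<longrightarrow>
    (\<forall>\<^sub>F y in nhds x. w y \<le> q y) \<longrightarrow> b \<le> trace_op T (D2 x))"

lemma visc_ge_subset: "visc_ge b V w \<Longrightarrow> V' \<subseteq> V \<Longrightarrow> visc_ge b V' w"
  unfolding visc_ge_def by blast

lemma visc_ge_smooth:
  assumes w: "C2jet UNIV w D D2" and b: "\<And>x. x \<in> V \<Longrightarrow> b \<le> trace_op T (D2 x)"
  shows "visc_ge b V w"
  unfolding visc_ge_def
proof (intro ballI allI impI)
  fix x U q Dq D2q
  assume x: "x \<in> V" "open U" "x \<in> U" "C2jet U q Dq D2q" "q x = w x" "\<forall>\<^sub>F y in nhds x. w y \<le> q y"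
  have j: "C2jet U (\<lambda>x. q x + -1 * w x) (\<lambda>x. Dq x + (-1) *\<^sub>R D x) (\<lambda>x. D2q x + (-1) *\<^sub>R D2 x)"
    by (intro C2jet_add C2jet_cmult x(4) C2jet_subset[OF w]) auto
  have min: "\<forall>\<^sub>F y in nhds x. q x + -1 * w x \<le> q y + -1 * w y"
    using x(6) by eventually_elim (use x(5) in auto)
  have "0 \<le> trace_op T (D2q x + (-1) *\<^sub>R D2 x)"
    by (rule trace_op_psd_nonneg) (use C2jet_symmetric[OF j x(2,3)] C2jet_local_min[OF j x(2,3) min] in auto)
  then show "b \<le> trace_op T (D2q x)" using b[OF x(1)] by (simp only: trace_op_add trace_op_scaleR)
qed

section \<open>Gaussian kernels and the heat flow\<close>

definition gauss_const :: real
  where "gauss_const = (LINT z|lborel. exp (- (S z \<bullet> z) / 4))"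

definition gauss :: "'a \<Rightarrow> real"
  where "gauss z = exp (- (S z \<bullet> z) / 4) / gauss_const"

text \<open>The heat kernel of the operator at time r^2. Normalising by the integral
  \<open>gauss_const\<close> avoids computing a determinant of S.\<close>

definition gauss_r :: "real \<Rightarrow> 'a \<Rightarrow> real"
  where "gauss_r r z = exp (- (S z \<bullet> z) / (4 * r\<^sup>2)) / (gauss_const * r ^ DIM('a))"

lemma continuous_S [continuous_intros]: "continuous_on X f \<Longrightarrow> continuous_on X (\<lambda>x. S (f x))"
  using linear_S by (simp add: bounded_linear.continuous_on linear_conv_bounded_linear)

lemma S_lower_bound: "\<exists>c>0. \<forall>x. c * (norm x)\<^sup>2 \<le> S x \<bullet> x"
proof -
  have "continuous_on (sphere 0 1) (\<lambda>x. S x \<bullet> x)" by (intro continuous_intros)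
  moreover have "sphere (0::'a) 1 \<noteq> {}" by simp
  ultimately obtain x0 where x0: "x0 \<in> sphere 0 1" "\<And>y. y \<in> sphere 0 1 \<Longrightarrow> S x0 \<bullet> x0 \<le> S y \<bullet> y"
    using continuous_attains_inf[OF compact_sphere, of 0 1 "\<lambda>x. S x \<bullet> x"] by blast
  have "(S x0 \<bullet> x0) * (norm x)\<^sup>2 \<le> S x \<bullet> x" for x
  proof (cases "x = 0")
    case True
    then show ?thesis by simp
  next
    case False
    define u where "u = (1 / norm x) *\<^sub>R x"
    have "u \<in> sphere 0 1" using False by (simp add: u_def)
    then have le: "S x0 \<bullet> x0 \<le> S u \<bullet> u" by (rule x0(2))
    have "S x = norm x *\<^sub>R S u" using False unfolding u_def by (simp add: linear_scale[OF linear_S])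
    then have "S x \<bullet> x = (norm x *\<^sub>R S u) \<bullet> (norm x *\<^sub>R u)" using False by (simp add: u_def)
    then have "S x \<bullet> x = (norm x)\<^sup>2 * (S u \<bullet> u)" by (simp only: inner_scaleR_left inner_scaleR_right power2_eq_square mult.assoc)
    then show ?thesis using mult_right_mono[OF le zero_le_power2[of "norm x"]] by (simp only: mult.commute)
  qed
  moreover have "0 < S x0 \<bullet> x0" using x0(1) by (intro S_pos) auto
  ultimately show ?thesis by blast
qed

end

text \<open>A majorant of the one dimensional Gaussian that has an explicit primitive, arctan (sqrt
  a x) / sqrt a.\<close>

lemma nn_integral_inverse_square_finite: "(\<integral>\<^sup>+x. ennreal (1 / (1 + a * x\<^sup>2)) \<partial>lborel) < \<infinity>" if a: "0 < a" for a :: real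
proof -
  let ?f = "\<lambda>x::real. 1 / (1 + a * x\<^sup>2)"
  have pos: "0 < 1 + a * x\<^sup>2" for x :: real using a by (intro add_pos_nonneg) auto
  have h: "(\<integral>\<^sup>+x. ennreal (?f x) * indicator {0..} x \<partial>lborel) = ennreal (pi / 2 / sqrt a - arctan (sqrt a * 0) / sqrt a)"
  proof (rule nn_integral_FTC_atLeast)
    show "?f \<in> borel_measurable borel" by measurable
    fix x :: real
    show "((\<lambda>x. arctan (sqrt a * x) / sqrt a) has_real_derivative ?f x) (at x)"
    proof -
      have "((\<lambda>x. arctan (sqrt a * x) / sqrt a) has_real_derivative
          (inverse (1 + (sqrt a * x)\<^sup>2) * (sqrt a * 1)) / sqrt a) (at x)"
        by (intro DERIV_cdivide DERIV_chain2[OF DERIV_arctan] DERIV_cmult DERIV_ident)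
      then show ?thesis using a by (simp add: power_mult_distrib inverse_eq_divide)
    qed
    show "0 \<le> ?f x" using pos[of x] by simp
    have "filterlim (\<lambda>x. sqrt a * x) at_top at_top"
      using a by (intro filterlim_tendsto_pos_mult_at_top[OF tendsto_const] filterlim_ident) auto
    then have "((\<lambda>x. arctan (sqrt a * x)) \<longlongrightarrow> pi / 2) at_top"
      by (rule filterlim_compose[OF tendsto_arctan_at_top])
    then show "((\<lambda>x. arctan (sqrt a * x) / sqrt a) \<longlongrightarrow> pi / 2 / sqrt a) at_top"
      using a by (intro tendsto_divide tendsto_const) auto
  qed
  have h2: "(\<integral>\<^sup>+x. ennreal (?f x) * indicator {..0} x \<partial>lborel) = (\<integral>\<^sup>+x. ennreal (?f x) * indicator {0..} x \<partial>lborel)"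
    by (subst nn_integral_real_affine[where c="-1" and t=0]) (auto simp: indicator_def intro!: nn_integral_cong)
  have "(\<integral>\<^sup>+x. ennreal (?f x) \<partial>lborel) \<le> (\<integral>\<^sup>+x. ennreal (?f x) * indicator {0..} x + ennreal (?f x) * indicator {..0} x \<partial>lborel)"
    by (intro nn_integral_mono) (auto simp: indicator_def)
  also have "\<dots> = (\<integral>\<^sup>+x. ennreal (?f x) * indicator {0..} x \<partial>lborel) + (\<integral>\<^sup>+x. ennreal (?f x) * indicator {..0} x \<partial>lborel)"
    by (rule nn_integral_add) auto
  also have "\<dots> < \<infinity>" unfolding h2 h by (simp add: ennreal_add_eq_top less_top)
  finally show ?thesis .
qed

text \<open>The Gaussian is a product over the coordinates, and exp (-t) <= 1 / (1 + t) bounds each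
  factor.\<close>

lemma integrable_exp_neg_square:
  assumes a: "0 < a"
  shows "integrable lborel (\<lambda>z::'a::euclidean_space. exp (- (a * (norm z)\<^sup>2)))"
proof (rule integrableI_bounded)
  show "(\<lambda>z::'a. exp (- (a * (norm z)\<^sup>2))) \<in> borel_measurable lborel" by measurable
  have le: "exp (- (a * s\<^sup>2)) \<le> 1 / (1 + a * s\<^sup>2)" for s :: real
  proof -
    have "1 + a * s\<^sup>2 \<le> exp (a * s\<^sup>2)" by (rule exp_ge_add_one_self)
    moreover have "0 < 1 + a * s\<^sup>2" using a by (intro add_pos_nonneg) auto
    ultimately show ?thesis by (simp add: exp_minus inverse_eq_divide frac_le)
  qed
  have "(\<integral>\<^sup>+z. ennreal (norm (exp (- (a * (norm (z::'a))\<^sup>2)))) \<partial>lborel)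
    = (\<integral>\<^sup>+z. (\<Prod>b\<in>Basis. ennreal (exp (- (a * ((z::'a) \<bullet> b)\<^sup>2)))) \<partial>lborel)"
  proof (rule nn_integral_cong)
    fix z :: 'a
    have "(norm z)\<^sup>2 = (\<Sum>b\<in>Basis. (z \<bullet> b)\<^sup>2)"
      unfolding power2_norm_eq_inner by (subst euclidean_inner) (simp add: power2_eq_square)
    then have "- (a * (norm z)\<^sup>2) = (\<Sum>b\<in>Basis. - (a * (z \<bullet> b)\<^sup>2))"
      by (simp only: sum_distrib_left sum_negf)
    then have "exp (- (a * (norm z)\<^sup>2)) = (\<Prod>b\<in>Basis. exp (- (a * (z \<bullet> b)\<^sup>2)))"
      by (simp only: exp_sum[OF finite_Basis])
    then show "ennreal (norm (exp (- (a * (norm z)\<^sup>2)))) = (\<Prod>b\<in>Basis. ennreal (exp (- (a * (z \<bullet> b)\<^sup>2))))"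
      by (simp add: prod_ennreal abs_of_nonneg[OF prod_nonneg])
  qed
  also have "\<dots> = (\<Prod>b\<in>(Basis::'a set). (\<integral>\<^sup>+x. ennreal (exp (- (a * x\<^sup>2))) \<partial>lborel))"
    by (rule nn_integral_lborel_prod) auto
  also have "\<dots> \<le> (\<Prod>b\<in>(Basis::'a set). (\<integral>\<^sup>+x. ennreal (1 / (1 + a * x\<^sup>2)) \<partial>lborel))"
    by (intro prod_mono_ennreal nn_integral_mono ennreal_leI le)
  also have "\<dots> < \<infinity>"
    using nn_integral_inverse_square_finite[OF a]
    by (simp add: power_less_top_ennreal)
  finally show "(\<integral>\<^sup>+z. ennreal (norm (exp (- (a * (norm (z::'a))\<^sup>2)))) \<partial>lborel) < \<infinity>" .
qed

text \<open>Convolution of w with the kernel k at scale r, written in the rescaled variable. In this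
  form r = 0 is meaningful and returns w if k has mass 1, so the heat flow is continuous up to its
  initial time.\<close>

definition avg :: "('a::euclidean_space \<Rightarrow> real) \<Rightarrow> ('a \<Rightarrow> real) \<Rightarrow> real \<Rightarrow> 'a \<Rightarrow> real"
  where "avg k w r x = (LINT y|lborel. k y * w (x - r *\<^sub>R y))"

lemma avg_continuous:
  assumes k: "integrable lborel k" and w: "continuous_on UNIV w" and M: "\<And>x. \<bar>w x\<bar> \<le> M"
  shows "continuous_on UNIV (\<lambda>p. avg k w (fst p) (snd p))"
proof (rule continuous_on_sequentiallyI)
  fix u :: "nat \<Rightarrow> real \<times> 'a" and p
  assume u: "u \<longlonglongrightarrow> p"
  have wm [measurable]: "w \<in> borel_measurable borel" using w by (rule borel_measurable_continuous_onI)
  have km [measurable]: "k \<in> borel_measurable lborel" using k by auto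
  have m: "(\<lambda>y. k y * w (snd q - fst q *\<^sub>R y)) \<in> borel_measurable lborel" for q :: "real \<times> 'a"
    by measurable
  show "(\<lambda>n. avg k w (fst (u n)) (snd (u n))) \<longlonglongrightarrow> avg k w (fst p) (snd p)"
    unfolding avg_def
  proof (rule integral_dominated_convergence[where w="\<lambda>y. M * \<bar>k y\<bar>"])
    show "integrable lborel (\<lambda>y. M * \<bar>k y\<bar>)" using k by auto
    show "AE y in lborel. (\<lambda>n. k y * w (snd (u n) - fst (u n) *\<^sub>R y)) \<longlonglongrightarrow> k y * w (snd p - fst p *\<^sub>R y)"
    proof (rule AE_I2)
      fix y
      have "(\<lambda>n. snd (u n) - fst (u n) *\<^sub>R y) \<longlonglongrightarrow> snd p - fst p *\<^sub>R y"
        using u by (intro tendsto_intros)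
      then have "(\<lambda>n. w (snd (u n) - fst (u n) *\<^sub>R y)) \<longlonglongrightarrow> w (snd p - fst p *\<^sub>R y)"
        by (intro continuous_on_tendsto_compose[OF w]) auto
      then show "(\<lambda>n. k y * w (snd (u n) - fst (u n) *\<^sub>R y)) \<longlonglongrightarrow> k y * w (snd p - fst p *\<^sub>R y)"
        by (intro tendsto_intros)
    qed
    show "AE y in lborel. norm (k y * w (snd (u n) - fst (u n) *\<^sub>R y)) \<le> M * \<bar>k y\<bar>" for n
      using mult_left_mono[OF M abs_ge_zero] by (intro AE_I2) (simp add: abs_mult mult.commute[of M])
  qed (use m in auto)
qed

lemma avg_abs_le:
  assumes k: "integrable lborel k" "\<And>y. 0 \<le> k y" "(LINT y|lborel. k y) = 1"
    and w: "continuous_on UNIV w" and M: "\<And>x. \<bar>w x\<bar> \<le> M"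
  shows "\<bar>avg k w r x\<bar> \<le> M"
proof -
  have "\<bar>avg k w r x\<bar> \<le> (LINT y|lborel. M * k y)"
    unfolding avg_def
    by (rule order_trans[OF integral_abs_bound integral_mono'])
      (use k mult_left_mono[OF M k(2)] order_trans[OF abs_ge_zero M] in
        \<open>auto simp: abs_mult mult.commute[of M]\<close>)
  then show ?thesis using k by simp
qed

lemma lborel_integral_affine:
  fixes f :: "'a::euclidean_space \<Rightarrow> real"
  assumes r: "r \<noteq> 0" and f: "f \<in> borel_measurable borel"
  shows "(LINT y|lborel. f y) = \<bar>r\<bar> ^ DIM('a) * (LINT y|lborel. f (x + r *\<^sub>R y))"
proof -
  have m: "(\<lambda>y. x + r *\<^sub>R y) \<in> borel_measurable borel" by measurable
  have "(LINT y|lborel. f y) = (LINT y|density (distr lborel borel (\<lambda>y. x + r *\<^sub>R y)) (\<lambda>_. ennreal (\<bar>r\<bar> ^ DIM('a))). f y)"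
    using lborel_affine[OF r, of x] by (simp add: ennreal_power)
  also have "\<dots> = (LINT y|distr lborel borel (\<lambda>y. x + r *\<^sub>R y). \<bar>r\<bar> ^ DIM('a) *\<^sub>R f y)"
    by (rule integral_density) (use f in auto)
  also have "\<dots> = (LINT y|lborel. \<bar>r\<bar> ^ DIM('a) *\<^sub>R f (x + r *\<^sub>R y))"
    by (rule integral_distr) (use f m in auto)
  finally show ?thesis by simp
qed

text \<open>The change of variables moves the scale and the point onto the kernel, where derivatives
  in r and x can be taken.\<close>

lemma avg_eq_integral:
  fixes k w :: "'a::euclidean_space \<Rightarrow> real"
  assumes r: "0 < r" and k: "continuous_on UNIV k" and w: "continuous_on UNIV w"
    and supp: "\<And>y. y \<notin> cbox a b \<Longrightarrow> w y = 0"
  shows "avg k w r x = integral (cbox a b) (\<lambda>y. w y * (k ((1 / r) *\<^sub>R (x - y)) / r ^ DIM('a)))"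
proof -
  define f where "f y = w y * (k ((1 / r) *\<^sub>R (x - y)) / r ^ DIM('a))" for y
  have cf: "continuous_on UNIV f" unfolding f_def using r
    by (intro continuous_intros w continuous_on_compose2[OF k]) auto
  have "(LINT y|lborel. f y) = \<bar>- r\<bar> ^ DIM('a) * (LINT y|lborel. f (x + (- r) *\<^sub>R y))"
    using r cf by (intro lborel_integral_affine borel_measurable_continuous_onI) auto
  also have "\<dots> = (LINT y|lborel. r ^ DIM('a) * f (x + (- r) *\<^sub>R y))" using r by simp
  also have "\<dots> = avg k w r x"
    unfolding avg_def f_def using r by (intro Bochner_Integration.integral_cong) (auto simp: mult.commute)
  finally have 1: "avg k w r x = (LINT y|lborel. f y)" by simp
  have si: "set_integrable lborel (cbox a b) f"
    unfolding set_integrable_def by (rule borel_integrable_compact) (use cf in \<open>auto intro: continuous_on_subset\<close>)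
  have "(LINT y|lborel. f y) = (LINT y:cbox a b|lborel. f y)"
    unfolding set_lebesgue_integral_def
    by (intro Bochner_Integration.integral_cong refl) (auto simp: indicator_def f_def supp)
  also have "\<dots> = integral (cbox a b) f" by (rule set_borel_integral_eq_integral(2)[OF si])
  finally show ?thesis using 1 unfolding f_def by simp
qed

context pos_def_op
begin

lemma integrable_exp_S: "integrable lborel (\<lambda>z. exp (- (S z \<bullet> z) / 4))"
proof -
  obtain c where c: "c > 0" "\<And>x. c * (norm x)\<^sup>2 \<le> S x \<bullet> x" using S_lower_bound by blast
  have "integrable lborel (\<lambda>z::'a. exp (- (c / 4 * (norm z)\<^sup>2)))" using c(1) by (intro integrable_exp_neg_square) auto
  then show ?thesis
  proof (rule Bochner_Integration.integrable_bound)
    show "(\<lambda>z. exp (- (S z \<bullet> z) / 4)) \<in> borel_measurable lborel"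
      unfolding measurable_lborel2 by (intro borel_measurable_continuous_onI continuous_intros) auto
    show "AE z in lborel. norm (exp (- (S z \<bullet> z) / 4)) \<le> norm (exp (- (c / 4 * (norm z)\<^sup>2)))"
      using c(2) by (intro AE_I2) (simp add: field_simps)
  qed
qed

lemma gauss_const_pos: "0 < gauss_const"
proof -
  have "0 \<le> gauss_const" unfolding gauss_const_def by (intro integral_nonneg_AE AE_I2) simp
  moreover have "gauss_const \<noteq> 0"
  proof
    assume "gauss_const = 0"
    then have "AE z in (lborel :: 'a measure). exp (- (S z \<bullet> z) / 4) = 0"
      unfolding gauss_const_def using integral_nonneg_eq_0_iff_AE[OF integrable_exp_S] by simp
    then have "AE z in (lborel :: 'a measure). False" by simp
    then show False by (simp add: eventually_False ae_filter_eq_bot_iff emeasure_lborel_UNIV)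
  qed
  ultimately show ?thesis by simp
qed

lemma gauss_props: "integrable lborel gauss" "\<And>z. 0 \<le> gauss z" "(LINT z|lborel. gauss z) = 1"
  "continuous_on UNIV gauss"
proof -
  show "integrable lborel gauss" "continuous_on UNIV gauss" "\<And>z. 0 \<le> gauss z"
    unfolding gauss_def[abs_def] using integrable_exp_S gauss_const_pos
    by (auto intro!: continuous_intros)
  have "(LINT z|lborel. gauss z) = (LINT z|lborel. exp (- (S z \<bullet> z) / 4)) / gauss_const"
    unfolding gauss_def by simp
  then show "(LINT z|lborel. gauss z) = 1"
    using gauss_const_pos unfolding gauss_const_def[symmetric] by simp
qed

lemma gauss_r_eq: "r > 0 \<Longrightarrow> gauss ((1 / r) *\<^sub>R z) / r ^ DIM('a) = gauss_r r z"
  unfolding gauss_def gauss_r_def by (simp add: linear_scale[OF linear_S] power2_eq_square field_simps)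

lemma sum_S_T: "(\<Sum>b\<in>Basis. S b \<bullet> T b) = DIM('a)"
  by (simp add: sym_S S_T inner_Basis)

text \<open>The kernel is a function of S z . z. In the chain rule the gradient term contributes 4
  (S z . z), because S inverts T, and the Hessian of the quadratic form contributes
  \<open>2 * DIM('a)\<close>.\<close>

lemma gauss_r_jet:
  assumes r: "0 < r"
  obtains D D2 where "C2jet UNIV (gauss_r r) D D2"
    "\<And>z. trace_op T (D2 z) = gauss_r r z * ((S z \<bullet> z) / (4 * r ^ 4) - DIM('a) / (2 * r\<^sup>2))"
proof -
  define \<phi> where "\<phi> s = exp (- s / (4 * r\<^sup>2)) / (gauss_const * r ^ DIM('a))" for s
  define \<phi>' where "\<phi>' s = - \<phi> s / (4 * r\<^sup>2)" for s
  define \<phi>'' where "\<phi>'' s = \<phi> s / (16 * r ^ 4)" for s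
  have d1: "(\<phi> has_real_derivative \<phi>' s) (at s)" for s
    unfolding \<phi>_def \<phi>'_def using r gauss_const_pos by (auto intro!: derivative_eq_intros simp: field_simps)
  have d2: "(\<phi>' has_real_derivative \<phi>'' s) (at s)" for s
  proof -
    have "((\<lambda>s. - \<phi> s / (4 * r\<^sup>2)) has_real_derivative - \<phi>' s / (4 * r\<^sup>2)) (at s)"
      by (rule DERIV_cdivide[OF DERIV_minus[OF d1]])
    then show ?thesis unfolding \<phi>'_def \<phi>''_def by (simp add: power2_eq_square power4_eq_xxxx mult_ac)
  qed
  have c: "continuous_on UNIV \<phi>''"
    unfolding \<phi>''_def \<phi>_def using r gauss_const_pos by (intro continuous_intros) auto
  note j = C2jet_compose[OF C2jet_quadratic[OF linear_S sym_S, of UNIV 0] d1 d2 c]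
  let ?D2 = "\<lambda>x. \<phi>'' (S (x - 0) \<bullet> (x - 0)) *\<^sub>R outer (blinfun_inner_right (2 *\<^sub>R S (x - 0))) +
    \<phi>' (S (x - 0) \<bullet> (x - 0)) *\<^sub>R Blinfun (\<lambda>h. blinfun_inner_right (2 *\<^sub>R S h))"
  have eq: "gauss_r r = (\<lambda>x. \<phi> (S (x - 0) \<bullet> (x - 0)))" unfolding gauss_r_def \<phi>_def by simp
  have "trace_op T (?D2 z) = gauss_r r z * ((S z \<bullet> z) / (4 * r ^ 4) - DIM('a) / (2 * r\<^sup>2))" for z
  proof -
    have 1: "trace_op T (outer (blinfun_inner_right (2 *\<^sub>R S (z - 0)))) = (2 *\<^sub>R S z) \<bullet> T (2 *\<^sub>R S z)"
      by (rule trace_op_outer) (simp add: blinfun_inner_right.rep_eq)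
    have 2: "(2 *\<^sub>R S z) \<bullet> T (2 *\<^sub>R S z) = 4 * (S z \<bullet> z)"
    proof -
      have "S z \<bullet> T (S z) = z \<bullet> S z" by (subst sym_S) (simp add: S_T)
      then show ?thesis by (simp add: linear_scale[OF linear_T] inner_commute)
    qed
    have 3: "trace_op T (Blinfun (\<lambda>h. blinfun_inner_right (2 *\<^sub>R S h))) = 2 * DIM('a)"
      unfolding trace_op_def Blinfun_quadratic_apply[OF linear_S] sum_distrib_left[symmetric] sum_S_T by simp
    have "\<phi> (S z \<bullet> z) = gauss_r r z" unfolding gauss_r_def \<phi>_def ..
    then show ?thesis unfolding trace_op_add trace_op_scaleR 1 2 3 \<phi>''_def \<phi>'_def using r
      by (simp add: field_simps)
  qed
  then show ?thesis using that[of "\<lambda>x. \<phi>' (S (x - 0) \<bullet> (x - 0)) *\<^sub>R blinfun_inner_right (2 *\<^sub>R S (x - 0))" ?D2] j unfolding eq by blast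
qed

text \<open>The factor 2 r is the derivative of the time r^2; the rest is the value of the operator
  in \<open>gauss_r_jet\<close>.\<close>

lemma gauss_r_deriv:
  assumes r: "0 < r"
  shows "((\<lambda>r. gauss_r r z) has_real_derivative
    2 * r * (gauss_r r z * ((S z \<bullet> z) / (4 * r ^ 4) - DIM('a) / (2 * r\<^sup>2)))) (at r)"
proof -
  let ?g = "S z \<bullet> z"
  have 1: "((\<lambda>r. exp (- ?g / (4 * r\<^sup>2))) has_real_derivative exp (- ?g / (4 * r\<^sup>2)) * (?g / (2 * r ^ 3))) (at r)"
    using r by (auto intro!: derivative_eq_intros simp: field_simps power2_eq_square power3_eq_cube)
  have 2: "((\<lambda>r. gauss_const * r ^ DIM('a)) has_real_derivative (gauss_const * r ^ DIM('a)) * (DIM('a) / r)) (at r)"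
  proof -
    have "gauss_const * (DIM('a) * r ^ (DIM('a) - Suc 0)) = (gauss_const * r ^ DIM('a)) * (DIM('a) / r)"
      using r by (cases "DIM('a)") (auto simp: DIM_positive)
    then show ?thesis using DERIV_cmult[OF DERIV_pow[of "DIM('a)" r UNIV], of gauss_const] by simp
  qed
  have nz: "gauss_const * r ^ DIM('a) \<noteq> 0" using r gauss_const_pos by simp
  have "((\<lambda>r. gauss_r r z) has_real_derivative
     (exp (- ?g / (4 * r\<^sup>2)) * (?g / (2 * r ^ 3)) * (gauss_const * r ^ DIM('a)) - exp (- ?g / (4 * r\<^sup>2)) * ((gauss_const * r ^ DIM('a)) * (DIM('a) / r)))
     / ((gauss_const * r ^ DIM('a)) * (gauss_const * r ^ DIM('a)))) (at r)"
    unfolding gauss_r_def by (rule DERIV_divide[OF 1 2 nz])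
  moreover have alg: "(E * A * G - E * (G * B)) / (G * G) = E / G * (A - B)" if "G \<noteq> 0" for E A G B :: real
    using that by (simp add: field_simps)
  ultimately have "((\<lambda>r. gauss_r r z) has_real_derivative gauss_r r z * (?g / (2 * r ^ 3) - DIM('a) / r)) (at r)"
    unfolding alg[OF nz] unfolding gauss_r_def by simp
  moreover have "gauss_r r z * (?g / (2 * r ^ 3) - DIM('a) / r) = 2 * r * (gauss_r r z * (?g / (4 * r ^ 4) - DIM('a) / (2 * r\<^sup>2)))"
    using r by (simp add: field_simps power2_eq_square power3_eq_cube power4_eq_xxxx)
  ultimately show ?thesis by simp
qed

lemma heat_equation:
  assumes w: "continuous_on UNIV w" and supp: "\<And>y. y \<notin> cbox a b \<Longrightarrow> w y = 0" and r: "0 < r"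
  obtains D D2 where "C2jet UNIV (avg gauss w r) D D2"
    "\<And>x. ((\<lambda>r. avg gauss w r x) has_real_derivative 2 * r * trace_op T (D2 x)) (at r)"
proof -
  have W: "avg gauss w r = (\<lambda>x. integral (cbox a b) (\<lambda>y. w y * gauss_r r (x - y)))" if "0 < r" for r
    using avg_eq_integral[OF that gauss_props(4) w supp] gauss_r_eq[OF that] by (simp add: fun_eq_iff)
  obtain D D2 where j: "C2jet UNIV (gauss_r r) D D2"
    and L: "\<And>z. trace_op T (D2 z) = gauss_r r z * ((S z \<bullet> z) / (4 * r ^ 4) - DIM('a) / (2 * r\<^sup>2))"
    using gauss_r_jet[OF r] by blast
  have wc: "continuous_on (cbox a b) w" using w by (rule continuous_on_subset) simp
  note conv = C2jet_conv[OF j wc]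
  let ?d = "\<lambda>r z. 2 * r * (gauss_r r z * ((S z \<bullet> z) / (4 * r ^ 4) - DIM('a) / (2 * r\<^sup>2)))"
  have cD2: "continuous_on UNIV D2" using j unfolding C2jet_def by blast
  have "((\<lambda>r. avg gauss w r x) has_real_derivative 2 * r * trace_op T (integral (cbox a b) (\<lambda>y. w y *\<^sub>R D2 (x - y)))) (at r)" for x
  proof -
    have int: "(\<lambda>y. w y *\<^sub>R D2 (x - y)) integrable_on cbox a b"
      by (intro integrable_continuous continuous_intros wc continuous_on_compose2[OF cD2]) auto
    have "trace_op T (integral (cbox a b) (\<lambda>y. w y *\<^sub>R D2 (x - y))) = integral (cbox a b) (\<lambda>y. w y * trace_op T (D2 (x - y)))"
      using integral_linear[OF int bounded_linear_trace_op[of T]] by (simp add: o_def trace_op_scaleR)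
    then have eq: "2 * r * trace_op T (integral (cbox a b) (\<lambda>y. w y *\<^sub>R D2 (x - y))) = integral (cbox a b) (\<lambda>y. w y * ?d r (x - y))"
      by (simp add: L mult_ac flip: integral_mult_right)
    have cg: "continuous_on ({0<..} \<times> cbox a b) (\<lambda>p. gauss_r (fst p) (x - snd p))"
      unfolding gauss_r_def using gauss_const_pos by (intro continuous_intros) auto
    have "((\<lambda>r. integral (cbox a b) (\<lambda>y. w y * gauss_r r (x - y))) has_real_derivative
       integral (cbox a b) (\<lambda>y. w y * ?d r (x - y))) (at r within {0<..})"
    proof (rule leibniz_rule_field_derivative)
      show "((\<lambda>r. w y * gauss_r r (x - y)) has_real_derivative w y * ?d r (x - y)) (at r within {0<..})"
        if "r \<in> {0<..}" for r y
        using that by (intro DERIV_cmult has_field_derivative_at_within[OF gauss_r_deriv]) auto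
      show "(\<lambda>y. w y * gauss_r r (x - y)) integrable_on cbox a b" if "r \<in> {0<..}" for r
      proof -
        have "continuous_on UNIV (gauss_r r)" unfolding gauss_r_def using gauss_const_pos that
          by (intro continuous_intros) auto
        then show ?thesis
          by (intro integrable_continuous continuous_intros wc) (rule continuous_on_compose2, auto intro!: continuous_intros)
      qed
      have cw: "continuous_on ({0<..} \<times> cbox a b) (\<lambda>p. w (snd p))"
        by (rule continuous_on_compose2[OF w]) (auto intro!: continuous_intros)
      show "continuous_on ({0<..} \<times> cbox a b) (\<lambda>(r, y). w y * ?d r (x - y))"
        unfolding case_prod_unfold by (intro continuous_intros cg cw) auto
    qed (use r in auto)
    then have "((\<lambda>r. integral (cbox a b) (\<lambda>y. w y * gauss_r r (x - y))) has_real_derivative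
       integral (cbox a b) (\<lambda>y. w y * ?d r (x - y))) (at r)"
      using r by (simp add: at_within_open[of r "{0<..}"])
    then have "((\<lambda>r. avg gauss w r x) has_real_derivative integral (cbox a b) (\<lambda>y. w y * ?d r (x - y))) (at r)"
      by (rule has_field_derivative_transform_within_open[where S="{0<..}"]) (use r W in \<open>auto simp: fun_eq_iff\<close>)
    then show ?thesis unfolding eq .
  qed
  then show ?thesis using that conv unfolding W[OF r, symmetric] by blast
qed

end

section \<open>Comparison of subsolutions with their heat flow\<close>

context pos_def_op
begin

lemma visc_geD:
  assumes "visc_ge b V w" "x \<in> V" "open U" "x \<in> U" "C2jet U q D D2" "q x = w x" "\<forall>\<^sub>F y in nhds x. w y \<le> q y"
  shows "b \<le> trace_op T (D2 x)"
  using assms unfolding visc_ge_def by blast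

text \<open>The barrier \<open>C0 (\<bar>x - x0\<bar>\<^sup>2 + \<kappa> r\<^sup>2)\<^sup>2\<close> is a supersolution of the heat equation in time \<open>r\<^sup>2\<close>.  It localises the
  comparison to a ball, and at the centre of the ball it costs only a quadratic error in time.\<close>

lemma heat_lower:
  assumes w: "continuous_on UNIV w" and supp: "\<And>y. y \<notin> cbox a b \<Longrightarrow> w y = 0"
    and M: "\<And>x. \<bar>w x\<bar> \<le> M" and R: "0 < R"
  obtains C where "\<And>x0 r. visc_ge l (ball x0 R) w \<Longrightarrow> 0 < r \<Longrightarrow> r \<le> 1 \<Longrightarrow>
    w x0 + l * r\<^sup>2 - C * r ^ 4 \<le> avg gauss w r x0"
proof -
  have blT: "bounded_linear T" using linear_T by (simp add: linear_conv_bounded_linear)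
  obtain B where B: "B > 0" "\<And>x. norm (T x) \<le> norm x * B"
    using bounded_linear.pos_bounded[OF blT] by blast
  have TB: "p \<bullet> T p \<le> B * (p \<bullet> p)" for p
  proof -
    have "p \<bullet> T p \<le> norm p * norm (T p)" by (rule norm_cauchy_schwarz)
    also have "\<dots> \<le> norm p * (norm p * B)" using B(2) by (intro mult_left_mono) auto
    finally show ?thesis by (simp add: power2_norm_eq_inner[symmetric] power2_eq_square mult_ac)
  qed
  define tr where "tr = (\<Sum>b\<in>Basis. b \<bullet> T b)"
  have tr: "0 \<le> tr" unfolding tr_def using T_nonneg by (intro sum_nonneg) (auto simp: inner_commute)
  \<comment> \<open>With this value the operator applied to the barrier is at most 2 C0 kappa (s +
    kappa r^2), s = |x - x0|^2, which is the derivative of the barrier in the time r^2.\<close>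
  define \<kappa> where "\<kappa> = 4 * B + 2 * tr"
  have \<kappa>: "0 < \<kappa>" unfolding \<kappa>_def using B(1) tr by simp
  have M0: "0 \<le> M" using M[of 0] by linarith
  \<comment> \<open>On the sphere of radius R the barrier reaches 2 M + |l|, which bounds w + l r^2
    minus the heat flow as long as r <= 1.\<close>
  define C0 where "C0 = (2 * M + \<bar>l\<bar>) / R ^ 4"
  have C0: "0 \<le> C0" unfolding C0_def using M0 R by simp
  have C0R: "C0 * (R\<^sup>2)\<^sup>2 = 2 * M + \<bar>l\<bar>" unfolding C0_def using R by (simp flip: power_mult)
  have main: "w x0 + l * r1\<^sup>2 - C0 * \<kappa>\<^sup>2 * r1 ^ 4 \<le> avg gauss w r1 x0"
    if v: "visc_ge l (ball x0 R) w" and r1: "0 < r1" "r1 \<le> 1" for x0 r1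
  proof (rule ccontr)
    assume neg: "\<not> ?thesis"
    \<comment> \<open>Half of the gap, per unit of the time r1^2; the other half keeps
      \<open>\<Psi>\<close> positive at (r1, x0).\<close>
    define \<epsilon> where "\<epsilon> = (w x0 + l * r1\<^sup>2 - C0 * \<kappa>\<^sup>2 * r1 ^ 4 - avg gauss w r1 x0) / (2 * r1\<^sup>2)"
    have \<epsilon>: "0 < \<epsilon>" unfolding \<epsilon>_def using neg r1 by simp
    define E where "E r x = C0 * ((x - x0) \<bullet> (x - x0) + \<kappa> * r\<^sup>2)\<^sup>2" for r x
    have E0: "0 \<le> E r x" for r x unfolding E_def using C0 by simp
    define \<Psi> where "\<Psi> p = w (snd p) + l * (fst p)\<^sup>2 - E (fst p) (snd p) - avg gauss w (fst p) (snd p) - \<epsilon> * (fst p)\<^sup>2" for p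
    have "continuous_on UNIV \<Psi>"
      unfolding \<Psi>_def E_def
      by (intro continuous_intros avg_continuous[OF gauss_props(1) w M] continuous_on_compose2[OF w]) auto
    then have cont: "continuous_on ({0..r1} \<times> cball x0 R) \<Psi>" by (rule continuous_on_subset) simp
    have "compact ({0..r1} \<times> cball x0 R)" by (intro compact_Times compact_Icc compact_cball)
    moreover have ne: "(r1, x0) \<in> {0..r1} \<times> cball x0 R" using r1 R by auto
    ultimately obtain p where p: "p \<in> {0..r1} \<times> cball x0 R" "\<And>p'. p' \<in> {0..r1} \<times> cball x0 R \<Longrightarrow> \<Psi> p' \<le> \<Psi> p"
      using continuous_attains_sup[OF _ _ cont] by blast
    obtain r x where prx: "p = (r, x)" by (cases p)
    have rx: "0 \<le> r" "r \<le> r1" "dist x0 x \<le> R" using p(1) unfolding prx by auto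
    have "\<Psi> (r1, x0) = \<epsilon> * r1\<^sup>2"
      unfolding \<Psi>_def E_def \<epsilon>_def using r1 by (simp add: power_mult_distrib field_simps flip: power_mult)
    then have "0 < \<Psi> (r1, x0)" using \<epsilon> r1 by simp
    then have pos: "0 < \<Psi> (r, x)" using p(2)[OF ne] unfolding prx by linarith
    have r: "0 < r"
    proof (rule ccontr)
      assume "\<not> 0 < r"
      then have "r = 0" using rx by simp
      moreover have "avg gauss w 0 x = w x" unfolding avg_def by (simp add: gauss_props(3))
      ultimately show False using pos E0[of 0 x] unfolding \<Psi>_def by simp
    qed
    have x: "dist x0 x < R"
    proof (rule ccontr)
      assume "\<not> dist x0 x < R"
      then have "dist x0 x = R" using rx by simp
      then have "(x - x0) \<bullet> (x - x0) = R\<^sup>2" by (simp add: power2_norm_eq_inner[symmetric] dist_norm norm_minus_commute)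
      then have "C0 * (R\<^sup>2)\<^sup>2 \<le> E r x" unfolding E_def using C0 \<kappa> by (intro mult_left_mono power_mono) auto
      moreover have "l * r\<^sup>2 \<le> \<bar>l\<bar>"
      proof -
        have "r\<^sup>2 \<le> 1" using rx r1 by (simp add: power_le_one)
        then have "\<bar>l\<bar> * r\<^sup>2 \<le> \<bar>l\<bar> * 1" by (intro mult_left_mono) auto
        moreover have "l * r\<^sup>2 \<le> \<bar>l\<bar> * r\<^sup>2" by (intro mult_right_mono) auto
        ultimately show ?thesis by linarith
      qed
      moreover have "\<bar>avg gauss w r x\<bar> \<le> M" by (rule avg_abs_le[OF gauss_props(1-3) w M])
      moreover have "0 \<le> \<epsilon> * r\<^sup>2" using \<epsilon> by simp
      ultimately show False using pos M[of x] C0R unfolding \<Psi>_def by simp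
    qed
    obtain D D2 where j: "C2jet UNIV (avg gauss w r) D D2"
      and dW: "\<And>x. ((\<lambda>r. avg gauss w r x) has_real_derivative 2 * r * trace_op T (D2 x)) (at r)"
      using heat_equation[OF w supp r] by blast
    let ?s = "(x - x0) \<bullet> (x - x0)"
    have s: "0 \<le> ?s" by simp
    define \<phi> where "\<phi> s = C0 * (s + \<kappa> * r\<^sup>2)\<^sup>2" for s
    have d1: "(\<phi> has_real_derivative 2 * C0 * (s + \<kappa> * r\<^sup>2)) (at s)" for s
      unfolding \<phi>_def by (auto intro!: derivative_eq_intros)
    have d2: "((\<lambda>s. 2 * C0 * (s + \<kappa> * r\<^sup>2)) has_real_derivative 2 * C0) (at s)" for s
      by (auto intro!: derivative_eq_intros)
    have lid: "linear (\<lambda>x::'a. x)" by (simp add: linear_id[unfolded id_def])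
    note jE = C2jet_compose[OF C2jet_quadratic[OF lid, of UNIV x0] d1 d2 continuous_on_const, OF refl]
    let ?D2E = "\<lambda>x. (2 * C0) *\<^sub>R outer (blinfun_inner_right (2 *\<^sub>R (x - x0))) +
      (2 * C0 * ((x - x0) \<bullet> (x - x0) + \<kappa> * r\<^sup>2)) *\<^sub>R Blinfun (\<lambda>h. blinfun_inner_right (2 *\<^sub>R h))"
    have LE: "trace_op T (?D2E x) \<le> 2 * C0 * \<kappa> * (?s + \<kappa> * r\<^sup>2)"
    proof -
      have 1: "trace_op T (outer (blinfun_inner_right (2 *\<^sub>R (x - x0)))) = (2 *\<^sub>R (x - x0)) \<bullet> T (2 *\<^sub>R (x - x0))"
        by (rule trace_op_outer) (simp add: blinfun_inner_right.rep_eq)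
      also have "\<dots> = 4 * ((x - x0) \<bullet> T (x - x0))" by (simp only: linear_scale[OF linear_T]) simp
      also have "\<dots> \<le> 4 * (B * (?s + \<kappa> * r\<^sup>2))"
      proof -
        have "B * ?s \<le> B * (?s + \<kappa> * r\<^sup>2)" using B(1) \<kappa> by (intro mult_left_mono) auto
        then show ?thesis using TB[of "x - x0"] by linarith
      qed
      finally have o: "trace_op T (outer (blinfun_inner_right (2 *\<^sub>R (x - x0)))) \<le> 4 * (B * (?s + \<kappa> * r\<^sup>2))" .
      have q: "trace_op T (Blinfun (\<lambda>h. blinfun_inner_right (2 *\<^sub>R h))) = 2 * tr"
        unfolding trace_op_def Blinfun_quadratic_apply[OF lid] tr_def sum_distrib_left ..
      have "trace_op T (?D2E x) \<le> 2 * C0 * (4 * (B * (?s + \<kappa> * r\<^sup>2))) + 2 * C0 * (?s + \<kappa> * r\<^sup>2) * (2 * tr)"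
        unfolding trace_op_add trace_op_scaleR q using C0 o by (intro add_right_mono mult_left_mono) auto
      also have "\<dots> = 2 * C0 * \<kappa> * (?s + \<kappa> * r\<^sup>2)" unfolding \<kappa>_def by (simp add: algebra_simps)
      finally show ?thesis .
    qed
    let ?q = "\<lambda>y. (avg gauss w r y + \<phi> ((y - x0) \<bullet> (y - x0))) + (w x - avg gauss w r x - E r x)"
    have E\<phi>: "E r y = \<phi> ((y - x0) \<bullet> (y - x0))" for y unfolding E_def \<phi>_def ..
    have xin: "x \<in> ball x0 R" using x by simp
    have jq: "C2jet UNIV ?q (\<lambda>y. (D y + (2 * C0 * ((y - x0) \<bullet> (y - x0) + \<kappa> * r\<^sup>2)) *\<^sub>R blinfun_inner_right (2 *\<^sub>R (y - x0))) + 0)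
         (\<lambda>y. (D2 y + ?D2E y) + 0)"
      by (intro C2jet_add C2jet_const j jE)
    have qx: "?q x = w x" using E\<phi>[of x] by simp
    have "\<forall>\<^sub>F y in nhds x. y \<in> ball x0 R" using x by (intro eventually_nhds_in_open) auto
    then have qev: "\<forall>\<^sub>F y in nhds x. w y \<le> ?q y"
    proof eventually_elim
      case (elim y)
      have "\<Psi> (r, y) \<le> \<Psi> (r, x)" using p(2)[of "(r, y)"] elim r rx unfolding prx by simp
      then show ?case unfolding \<Psi>_def using E\<phi>[of y] by simp
    qed
    \<comment> \<open>As \<open>\<Psi>\<close> is maximal in x at the fixed time, the heat flow plus
      the barrier plus a constant touches w from above.\<close>
    have "l \<le> trace_op T ((D2 x + ?D2E x) + 0)"
      using visc_geD[OF v xin open_UNIV UNIV_I jq qx qev] .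
    then have L: "l \<le> trace_op T (D2 x) + 2 * C0 * \<kappa> * (?s + \<kappa> * r\<^sup>2)" using LE unfolding trace_op_add trace_op_0 by simp
    have dE: "((\<lambda>r. E r x) has_real_derivative 2 * r * (2 * C0 * \<kappa> * (?s + \<kappa> * r\<^sup>2))) (at r)"
      unfolding E_def by (auto intro!: derivative_eq_intros simp: field_simps)
    have dl: "((\<lambda>r. c * r\<^sup>2) has_real_derivative c * (2 * r)) (at r)" for c
      by (auto intro!: derivative_eq_intros)
    have d\<Psi>: "((\<lambda>r. \<Psi> (r, x)) has_real_derivative
       0 + l * (2 * r) - 2 * r * (2 * C0 * \<kappa> * (?s + \<kappa> * r\<^sup>2)) - 2 * r * trace_op T (D2 x) - \<epsilon> * (2 * r)) (at r)"
      unfolding \<Psi>_def fst_conv snd_conv by (intro DERIV_diff DERIV_add DERIV_const dE dl dW)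
    have "0 + l * (2 * r) - 2 * r * (2 * C0 * \<kappa> * (?s + \<kappa> * r\<^sup>2)) - 2 * r * trace_op T (D2 x) - \<epsilon> * (2 * r)
      = 2 * r * (l - 2 * C0 * \<kappa> * (?s + \<kappa> * r\<^sup>2) - trace_op T (D2 x) - \<epsilon>)" by (simp add: algebra_simps)
    also have "\<dots> < 0" using L \<epsilon> r by (intro mult_pos_neg) auto
    \<comment> \<open>\<open>\<Psi>\<close> decreases in time at its maximum. Only earlier times are
      compared, so a maximum at the final time r1 is covered.\<close>
    finally obtain d where d: "d > 0" "\<And>h. 0 < h \<Longrightarrow> h < d \<Longrightarrow> \<Psi> (r, x) < \<Psi> (r - h, x)"
      using DERIV_neg_dec_left[OF d\<Psi>] by blast
    define h where "h = min d r / 2"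
    have h: "0 < h" "h < d" "h < r" unfolding h_def using d r by auto
    have "\<Psi> (r - h, x) \<le> \<Psi> (r, x)" using p(2)[of "(r - h, x)"] h rx unfolding prx by simp
    then show False using d(2)[OF h(1,2)] by simp
  qed
  show ?thesis using main that[of "C0 * \<kappa>\<^sup>2"] by blast
qed

end

subsection \<open>Mollification of viscosity subsolutions of linear equations\<close>

text \<open>At 0 the difference quotient is itself a power of the positive part and tends to 0. Two
  applications show that the cubic \<open>bump\<close> is C^2.\<close>

lemma max0_power_DERIV:
  fixes t :: real
  shows "((\<lambda>t. max 0 t ^ (n + 2)) has_real_derivative real (n + 2) * max 0 t ^ (n + 1)) (at t)"
proof -
  consider "t > 0" | "t < 0" | "t = 0" by linarith
  then show ?thesis
  proof cases
    case 1
    have "((\<lambda>t. t ^ (n + 2)) has_real_derivative real (n + 2) * t ^ (n + 1)) (at t)"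
      using DERIV_pow[of "n + 2" t UNIV] by simp
    then have "((\<lambda>t. max 0 t ^ (n + 2)) has_real_derivative real (n + 2) * t ^ (n + 1)) (at t)"
      by (rule has_field_derivative_transform_within_open[where S="{0<..}"]) (use 1 in auto)
    then show ?thesis using 1 by simp
  next
    case 2
    have "((\<lambda>t. 0) has_real_derivative 0) (at t)" by simp
    then have "((\<lambda>t. max 0 t ^ (n + 2)) has_real_derivative 0) (at t)"
      by (rule has_field_derivative_transform_within_open[where S="{..<0}"]) (use 2 in auto)
    then show ?thesis using 2 by simp
  next
    case 3
    have "continuous_on UNIV (\<lambda>h::real. max 0 h ^ (n + 1))" by (intro continuous_intros)
    then have lim: "((\<lambda>h::real. max 0 h ^ (n + 1)) \<longlongrightarrow> max 0 0 ^ (n + 1)) (at 0)"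
      unfolding continuous_on_def by blast
    have ev: "\<forall>\<^sub>F h in at (0::real). max 0 h ^ (n + 1) = (max 0 (0 + h) ^ (n + 2) - max 0 0 ^ (n + 2)) / h"
      unfolding eventually_at by (intro exI[of _ 1]) (auto simp: max_def)
    have "((\<lambda>h::real. (max 0 (0 + h) ^ (n + 2) - max 0 0 ^ (n + 2)) / h) \<longlongrightarrow> max 0 0 ^ (n + 1)) (at 0)"
      by (rule Lim_transform_eventually[OF lim ev])
    then show ?thesis using 3 by (simp add: DERIV_def)
  qed
qed

text \<open>The power 3 makes this C^2; the compact support keeps the mollification local, which the
  Gaussian would not.\<close>

definition bump :: "'a::euclidean_space \<Rightarrow> real"
  where "bump z = max 0 (1 - z \<bullet> z) ^ 3"

definition moll :: "'a::euclidean_space \<Rightarrow> real"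
  where "moll z = bump z / (LINT z|lborel. bump (z::'a))"

lemma bump_props: "continuous_on UNIV (bump :: 'a \<Rightarrow> real)" "0 \<le> bump z" "1 \<le> norm z \<Longrightarrow> bump z = 0"
    "integrable lborel (bump :: 'a::euclidean_space \<Rightarrow> real)" for z :: "'a::euclidean_space"
proof -
  show c: "continuous_on UNIV (bump :: 'a \<Rightarrow> real)" unfolding bump_def[abs_def] by (intro continuous_intros)
  show "0 \<le> bump z" unfolding bump_def by simp
  have out: "bump z = 0" if "1 \<le> norm z" for z :: 'a
    using power_mono[OF that, of 2] unfolding bump_def by (simp add: power2_norm_eq_inner)
  then show "1 \<le> norm z \<Longrightarrow> bump z = 0" by blast
  have "integrable lborel (\<lambda>z::'a. indicator (cball 0 1) z *\<^sub>R bump z)"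
    by (rule borel_integrable_compact) (use c in \<open>auto intro: continuous_on_subset\<close>)
  moreover have "(\<lambda>z::'a. indicator (cball 0 1) z *\<^sub>R bump z) = bump"
    using out by (auto simp: fun_eq_iff indicator_def)
  ultimately show "integrable lborel (bump :: 'a \<Rightarrow> real)" by simp
qed

lemma bump_integral_pos: "0 < (LINT z|lborel. bump (z::'a::euclidean_space))"
proof -
  have "0 \<le> (LINT z|lborel. bump (z::'a))" by (intro integral_nonneg_AE AE_I2 bump_props)
  moreover have "(LINT z|lborel. bump (z::'a)) \<noteq> 0"
  proof
    assume "(LINT z|lborel. bump (z::'a)) = 0"
    then have "AE z in lborel. bump (z::'a) = 0"
      using integral_nonneg_eq_0_iff_AE[OF bump_props(4)[where 'a='a] AE_I2[OF bump_props(2)]] by simp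
    moreover have "{z. bump (z::'a) = 0} = - ball 0 1"
    proof -
      have "bump z \<noteq> 0" if "norm z < 1" for z :: 'a
        using that power_strict_mono[of "norm z" 1 2] unfolding bump_def by (simp add: power2_norm_eq_inner)
      then show ?thesis using bump_props(3) by force
    qed
    ultimately have "AE z in lborel. (z::'a) \<notin> ball 0 1" by (simp add: set_eq_iff)
    then have "ball (0::'a) 1 \<in> null_sets lborel" by (subst AE_iff_null_sets) auto
    then have "ball (0::'a) 1 \<in> null_sets lebesgue" by (rule null_sets_completionI)
    then have "negligible (ball (0::'a) 1)" by (simp add: negligible_iff_null_sets)
    then show False using open_not_negligible[of "ball (0::'a) 1"] by simp
  qed
  ultimately show ?thesis by simp
qed

lemma moll_props: "continuous_on UNIV (moll :: 'a::euclidean_space \<Rightarrow> real)" "0 \<le> moll z" "1 \<le> norm z \<Longrightarrow> moll z = 0"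
    "integrable lborel (moll :: 'a::euclidean_space \<Rightarrow> real)" "(LINT z|lborel. moll (z::'a)) = 1" for z :: "'a::euclidean_space"
proof -
  note pos = bump_integral_pos[where 'a='a]
  show "continuous_on UNIV (moll :: 'a \<Rightarrow> real)" "integrable lborel (moll :: 'a \<Rightarrow> real)"
    unfolding moll_def[abs_def] using pos by (auto intro!: continuous_intros bump_props)
  show "0 \<le> moll z" unfolding moll_def using pos bump_props(2)[of z] by simp
  show "1 \<le> norm z \<Longrightarrow> moll z = 0" unfolding moll_def by (simp add: bump_props(3))
  show "(LINT z|lborel. moll (z::'a)) = 1" unfolding moll_def using pos by simp
qed

lemma avg_moll_jet:
  fixes w :: "'a::euclidean_space \<Rightarrow> real"
  assumes w: "continuous_on UNIV w" and supp: "\<And>y. y \<notin> cbox a b \<Longrightarrow> w y = 0" and r: "0 < r"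
  obtains D D2 where "C2jet UNIV (avg moll w r) D D2"
proof -
  define c where "c = (LINT z|lborel. bump (z::'a)) * r ^ DIM('a)"
  have c: "0 < c" unfolding c_def using bump_integral_pos[where 'a='a] r by simp
  define \<phi> where "\<phi> s = max 0 (1 - s / r\<^sup>2) ^ 3 / c" for s
  have inner: "((\<lambda>s. 1 - s / r\<^sup>2) has_real_derivative - (1 / r\<^sup>2)) (at s)" for s
    using DERIV_diff[OF DERIV_const DERIV_cdivide[OF DERIV_ident]] by (metis (no_types) diff_0)
  have d1: "(\<phi> has_real_derivative 3 * max 0 (1 - s / r\<^sup>2) ^ 2 * - (1 / r\<^sup>2) / c) (at s)" for s
    unfolding \<phi>_def using DERIV_cdivide[OF DERIV_chain2[OF max0_power_DERIV[of 1] inner], of c s]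
    by (simp add: numeral_3_eq_3 numeral_2_eq_2)
  have d2: "((\<lambda>s. 3 * max 0 (1 - s / r\<^sup>2) ^ 2 * - (1 / r\<^sup>2) / c) has_real_derivative
     3 * (2 * max 0 (1 - s / r\<^sup>2) * - (1 / r\<^sup>2)) * - (1 / r\<^sup>2) / c) (at s)" for s
    using DERIV_chain2[OF max0_power_DERIV[of 0] inner, of s]
    by (intro DERIV_cdivide DERIV_cmult_right DERIV_cmult) (simp add: power2_eq_square)
  have lid: "linear (\<lambda>x::'a. x)" by (simp add: linear_id[unfolded id_def])
  have cc: "continuous_on UNIV (\<lambda>s. 3 * (2 * max 0 (1 - s / r\<^sup>2) * - (1 / r\<^sup>2)) * - (1 / r\<^sup>2) / c)"
    using r c by (intro continuous_intros) auto
  note j = C2jet_compose[OF C2jet_quadratic[OF lid, of UNIV 0] d1 d2 cc, OF refl]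
  have "moll ((1 / r) *\<^sub>R z) / r ^ DIM('a) = \<phi> ((z - 0) \<bullet> (z - 0))" for z :: 'a
    unfolding moll_def bump_def \<phi>_def c_def by (simp add: power2_eq_square)
  then have eq: "avg moll w r = (\<lambda>x. integral (cbox a b) (\<lambda>y. w y * \<phi> (((x - y) - 0) \<bullet> ((x - y) - 0))))"
    using avg_eq_integral[OF r moll_props(1) w supp] by (simp add: fun_eq_iff)
  have wc: "continuous_on (cbox a b) w" using w by (rule continuous_on_subset) simp
  show ?thesis using that C2jet_conv[OF j wc] unfolding eq by blast
qed

text \<open>Fubini, with the integrable bound M k(y) h(z).\<close>

lemma avg_commute:
  fixes k h w :: "'a::euclidean_space \<Rightarrow> real"
  assumes k: "integrable lborel k" "continuous_on UNIV k" "\<And>z. 0 \<le> k z" "(LINT z|lborel. k z) = 1"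
    and h: "integrable lborel h" "continuous_on UNIV h" "\<And>z. 0 \<le> h z" "(LINT z|lborel. h z) = 1"
    and w: "continuous_on UNIV w" and M: "\<And>x. \<bar>w x\<bar> \<le> M"
  shows "avg k (avg h w s) r x = avg h (avg k w r) s x"
proof -
  have [measurable]: "k \<in> borel_measurable borel" "h \<in> borel_measurable borel" "w \<in> borel_measurable borel"
    using k h w by (auto intro: borel_measurable_continuous_onI)
  have kh: "integrable (lborel \<Otimes>\<^sub>M lborel) (\<lambda>(y, z). k y * h z)"
  proof (rule lborel_pair.Fubini_integrable)
    show "(\<lambda>(y, z). k y * h z) \<in> borel_measurable (lborel \<Otimes>\<^sub>M lborel)" by measurable
    have "(\<lambda>y. LINT z|lborel. norm (case (y, z) of (y, z) \<Rightarrow> k y * h z)) = k"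
      using k h by (auto simp: fun_eq_iff abs_mult)
    then show "integrable lborel (\<lambda>y. LINT z|lborel. norm (case (y, z) of (y, z) \<Rightarrow> k y * h z))" using k by simp
    show "AE y in lborel. integrable lborel (\<lambda>z. case (y, z) of (y, z) \<Rightarrow> k y * h z)" using h by (intro AE_I2) simp
  qed
  have "integrable (lborel \<Otimes>\<^sub>M lborel) (\<lambda>p. M * (case p of (y, z) \<Rightarrow> k y * h z))"
    using kh by (rule integrable_mult_right)
  then have int: "integrable (lborel \<Otimes>\<^sub>M lborel) (\<lambda>(y, z). k y * (h z * w (x - r *\<^sub>R y - s *\<^sub>R z)))"
  proof (rule Bochner_Integration.integrable_bound)
    show "(\<lambda>(y, z). k y * (h z * w (x - r *\<^sub>R y - s *\<^sub>R z))) \<in> borel_measurable (lborel \<Otimes>\<^sub>M lborel)" by measurable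
    have "\<bar>k y * (h z * w (x - r *\<^sub>R y - s *\<^sub>R z))\<bar> \<le> \<bar>M * (k y * h z)\<bar>" for y z
    proof -
      have "k y * h z * \<bar>w (x - r *\<^sub>R y - s *\<^sub>R z)\<bar> \<le> k y * h z * M"
        using k h M by (intro mult_left_mono) auto
      then show ?thesis using k h order_trans[OF abs_ge_zero M[of 0]] by (simp add: abs_mult mult_ac)
    qed
    then show "AE p in lborel \<Otimes>\<^sub>M lborel. norm (case p of (y, z) \<Rightarrow> k y * (h z * w (x - r *\<^sub>R y - s *\<^sub>R z)))
       \<le> norm (M * (case p of (y, z) \<Rightarrow> k y * h z))"
      by (intro AE_I2) auto
  qed
  have "avg k (avg h w s) r x = (LINT y|lborel. LINT z|lborel. k y * (h z * w (x - r *\<^sub>R y - s *\<^sub>R z)))"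
    unfolding avg_def by simp
  also have "\<dots> = (LINT z|lborel. LINT y|lborel. k y * (h z * w (x - r *\<^sub>R y - s *\<^sub>R z)))"
    by (rule lborel_pair.Fubini_integral[OF int, symmetric])
  also have "\<dots> = (LINT z|lborel. LINT y|lborel. h z * (k y * w (x - s *\<^sub>R z - r *\<^sub>R y)))"
  proof -
    have "x - r *\<^sub>R y - s *\<^sub>R z = x - s *\<^sub>R z - r *\<^sub>R y" for y z by (simp add: algebra_simps)
    then show ?thesis by (simp only: mult.left_commute[of "k _" "h _"])
  qed
  also have "\<dots> = avg h (avg k w r) s x" unfolding avg_def by simp
  finally show ?thesis .
qed

lemma avg_moll_support:
  fixes w :: "'a::euclidean_space \<Rightarrow> real"
  assumes supp: "\<And>y. y \<notin> cbox a b \<Longrightarrow> w y = 0" and r: "0 \<le> r"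
  shows "\<exists>a' b'. \<forall>y. y \<notin> cbox a' b' \<longrightarrow> avg moll w r y = 0"
proof -
  obtain B where B: "\<And>y. y \<in> cbox a b \<Longrightarrow> norm y \<le> B"
    using bounded_cbox[of a b] unfolding bounded_iff by blast
  obtain c where c: "cball 0 (B + r) \<subseteq> cbox (-c) (c::'a)"
    using bounded_subset_cbox_symmetric[OF bounded_cball] by blast
  have "avg moll w r y = 0" if y: "y \<notin> cbox (-c) c" for y
  proof -
    have "norm y > B + r" using y c by (meson mem_cball_0 not_le subsetD)
    have "moll z * w (y - r *\<^sub>R z) = 0" for z
    proof (cases "1 \<le> norm z")
      case False
      have "norm y \<le> norm (y - r *\<^sub>R z) + norm (r *\<^sub>R z)" by (metis norm_triangle_sub add.commute)
      moreover have "norm (r *\<^sub>R z) \<le> r" using False r by (simp add: mult_left_le)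
      ultimately have "\<not> norm (y - r *\<^sub>R z) \<le> B" using \<open>norm y > B + r\<close> by linarith
      then have "y - r *\<^sub>R z \<notin> cbox a b" using B by blast
      then show ?thesis by (simp add: supp)
    qed (simp add: moll_props)
    then have "(\<lambda>z. moll z * w (y - r *\<^sub>R z)) = (\<lambda>z. 0)" by (rule ext)
    then show ?thesis unfolding avg_def by (simp only: Bochner_Integration.integral_zero)
  qed
  then show ?thesis by blast
qed

lemma avg_uminus: "avg k (\<lambda>x. - w x) r x = - avg k w r x"
  unfolding avg_def by simp

context pos_def_op
begin

text \<open>Both \<open>w\<close> and minus its mollification are compared with their heat flows, which commute with
  mollification; comparing the first order terms in time gives the claim.\<close>

lemma trace_op_mollification_ge:
  assumes w: "continuous_on UNIV w" and supp: "\<And>y. y \<notin> cbox a b \<Longrightarrow> w y = 0"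
    and M: "\<And>x. \<bar>w x\<bar> \<le> M" and \<delta>: "0 < \<delta>" and visc: "visc_ge l (ball y0 (2 * \<delta>)) w"
    and j: "C2jet UNIV (avg moll w \<delta>) D D2"
  shows "l \<le> trace_op T (D2 y0)"
proof (rule ccontr)
  assume neg: "\<not> l \<le> trace_op T (D2 y0)"
  define v where "v = avg moll w \<delta>"
  \<comment> \<open>Half of the gap: by continuity the smooth v has trace below l - eta on a whole
    ball, so - v is a subsolution there with constant - (l - eta).\<close>
  define \<eta> where "\<eta> = (l - trace_op T (D2 y0)) / 2"
  have \<eta>: "0 < \<eta>" "trace_op T (D2 y0) < l - \<eta>" unfolding \<eta>_def using neg by (auto simp: field_simps)
  have jv: "C2jet UNIV (\<lambda>x. -1 * v x) (\<lambda>x. (-1) *\<^sub>R D x) (\<lambda>x. (-1) *\<^sub>R D2 x)"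
    unfolding v_def by (rule C2jet_cmult[OF j])
  have cv: "continuous_on UNIV v"
    by (rule has_derivative_continuous_on) (use C2jetD(1)[OF j] in \<open>auto simp: v_def\<close>)
  have cL: "continuous_on UNIV (\<lambda>x. trace_op T (D2 x))"
    using j unfolding C2jet_def by (intro bounded_linear.continuous_on[OF bounded_linear_trace_op]) auto
  have "open {x. trace_op T (D2 x) < l - \<eta>}" using cL by (intro open_Collect_less continuous_on_const)
  then obtain R where R: "0 < R" "ball y0 R \<subseteq> {x. trace_op T (D2 x) < l - \<eta>}"
    using \<eta>(2) openE[of _ y0] by blast
  have "visc_ge (- (l - \<eta>)) (ball y0 R) (\<lambda>x. -1 * v x)"
  proof (rule visc_ge_smooth[OF jv])
    fix x assume "x \<in> ball y0 R"
    then have "trace_op T (D2 x) < l - \<eta>" using R(2) by blast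
    then show "- (l - \<eta>) \<le> trace_op T ((-1) *\<^sub>R D2 x)" unfolding trace_op_scaleR by simp
  qed
  then have v2: "visc_ge (- (l - \<eta>)) (ball y0 R) (\<lambda>x. - v x)" by simp
  obtain a' b' where supp': "\<And>y. y \<notin> cbox a' b' \<Longrightarrow> v y = 0"
    using avg_moll_support[of a b w \<delta>, OF supp less_imp_le[OF \<delta>]] unfolding v_def by blast
  have Mv: "\<bar>v x\<bar> \<le> M" for x unfolding v_def by (rule avg_abs_le[OF moll_props(4,2,5) w M])
  obtain C1 where C1: "\<And>x0 r. visc_ge l (ball x0 \<delta>) w \<Longrightarrow> 0 < r \<Longrightarrow> r \<le> 1 \<Longrightarrow>
    w x0 + l * r\<^sup>2 - C1 * r ^ 4 \<le> avg gauss w r x0" using heat_lower[OF w supp M \<delta>] by blast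
  obtain C2 where C2: "\<And>x0 r. visc_ge (- (l - \<eta>)) (ball x0 R) (\<lambda>x. - v x) \<Longrightarrow> 0 < r \<Longrightarrow> r \<le> 1 \<Longrightarrow>
    - v x0 + (- (l - \<eta>)) * r\<^sup>2 - C2 * r ^ 4 \<le> avg gauss (\<lambda>x. - v x) r x0"
    using heat_lower[of "\<lambda>x. - v x" a' b' M R "- (l - \<eta>)"] cv supp' Mv R(1) by (auto intro: continuous_on_minus)
  \<comment> \<open>At y0 the heat flow of v is at least v + l r^2 - C1 r^4, by averaging the bound
    for w, and at most v + (l - eta) r^2 + C2 r^4, by the bound for - v. Hence eta r^2 <= (C1 + C2)
    r^4.\<close>
  have key: "\<eta> \<le> (C1 + C2) * r\<^sup>2" if r: "0 < r" "r \<le> 1" for r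
  proof -
    let ?W = "avg gauss w r"
    have cW: "continuous_on UNIV ?W"
    proof -
      have "continuous_on UNIV (\<lambda>x::'a. (r, x))" by (intro continuous_on_Pair continuous_on_const continuous_on_id)
      from continuous_on_compose2[OF avg_continuous[OF gauss_props(1) w M] this subset_UNIV]
      show ?thesis by simp
    qed
    have MW: "\<bar>?W x\<bar> \<le> M" for x by (rule avg_abs_le[OF gauss_props(1-3) w M])
    have mint: "integrable lborel (\<lambda>z. moll z * f (y0 - \<delta> *\<^sub>R z))" if f: "continuous_on UNIV f" for f :: "'a \<Rightarrow> real"
    proof -
      have "integrable lborel (\<lambda>z. indicator (cball 0 1) z *\<^sub>R (moll z * f (y0 - \<delta> *\<^sub>R z)))"
        by (rule borel_integrable_compact)
          (auto intro!: continuous_intros continuous_on_compose2[OF f] continuous_on_subset[OF moll_props(1)])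
      moreover have "(\<lambda>z::'a. indicator (cball 0 1) z *\<^sub>R (moll z * f (y0 - \<delta> *\<^sub>R z))) = (\<lambda>z. moll z * f (y0 - \<delta> *\<^sub>R z))"
      proof (rule ext)
        fix z :: 'a
        show "indicator (cball 0 1) z *\<^sub>R (moll z * f (y0 - \<delta> *\<^sub>R z)) = moll z * f (y0 - \<delta> *\<^sub>R z)"
          using moll_props(3)[of z] by (cases "norm z \<le> 1") (simp_all add: indicator_def)
      qed
      ultimately show ?thesis by simp
    qed
    have "v y0 + (l * r\<^sup>2 - C1 * r ^ 4) = (LINT z|lborel. moll z * w (y0 - \<delta> *\<^sub>R z)) + (LINT z|lborel. moll (z::'a) * (l * r\<^sup>2 - C1 * r ^ 4))"
      unfolding v_def avg_def using moll_props(5)[where 'a='a] by simp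
    also have "\<dots> = (LINT z|lborel. moll z * w (y0 - \<delta> *\<^sub>R z) + moll z * (l * r\<^sup>2 - C1 * r ^ 4))"
      using moll_props(4)[where 'a='a] by (intro Bochner_Integration.integral_add[symmetric] mint w) auto
    also have "\<dots> \<le> (LINT z|lborel. moll z * ?W (y0 - \<delta> *\<^sub>R z))"
    proof (rule integral_mono)
      show "integrable lborel (\<lambda>z. moll z * w (y0 - \<delta> *\<^sub>R z) + moll z * (l * r\<^sup>2 - C1 * r ^ 4))"
        using moll_props(4)[where 'a='a] by (intro Bochner_Integration.integrable_add mint w) auto
      show "integrable lborel (\<lambda>z. moll z * ?W (y0 - \<delta> *\<^sub>R z))" by (rule mint[OF cW])
      fix z :: 'a
      show "moll z * w (y0 - \<delta> *\<^sub>R z) + moll z * (l * r\<^sup>2 - C1 * r ^ 4) \<le> moll z * ?W (y0 - \<delta> *\<^sub>R z)"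
      proof (cases "1 \<le> norm z")
        case False
        \<comment> \<open>The bound for w at y0 - delta z asks for a ball of radius delta around
          that point; this explains the radius 2 delta in the hypothesis.\<close>
        have "ball (y0 - \<delta> *\<^sub>R z) \<delta> \<subseteq> ball y0 (2 * \<delta>)"
        proof
          fix x assume "x \<in> ball (y0 - \<delta> *\<^sub>R z) \<delta>"
          moreover have "dist y0 (y0 - \<delta> *\<^sub>R z) \<le> \<delta>" using False \<delta> by (simp add: dist_norm)
          ultimately show "x \<in> ball y0 (2 * \<delta>)"
            using dist_triangle[of y0 x "y0 - \<delta> *\<^sub>R z"] by simp
        qed
        then have "w (y0 - \<delta> *\<^sub>R z) + l * r\<^sup>2 - C1 * r ^ 4 \<le> ?W (y0 - \<delta> *\<^sub>R z)"
          using C1 visc_ge_subset[OF visc] r by blast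
        then have "moll z * (w (y0 - \<delta> *\<^sub>R z) + l * r\<^sup>2 - C1 * r ^ 4) \<le> moll z * ?W (y0 - \<delta> *\<^sub>R z)"
          by (intro mult_left_mono moll_props)
        then show ?thesis by (simp add: algebra_simps)
      qed (simp add: moll_props)
    qed
    also have "\<dots> = avg moll ?W \<delta> y0" unfolding avg_def ..
    also have "\<dots> = avg gauss v r y0" unfolding v_def
      by (rule avg_commute[OF moll_props(4,1,2,5) gauss_props(1,4,2,3) w M])
    also have "\<dots> \<le> v y0 + (l - \<eta>) * r\<^sup>2 + C2 * r ^ 4"
      using C2[OF v2 r] unfolding avg_uminus by (simp add: algebra_simps)
    finally have "\<eta> * r\<^sup>2 \<le> (C1 + C2) * r ^ 4" by (simp add: algebra_simps)
    also have "\<dots> = (C1 + C2) * r\<^sup>2 * r\<^sup>2" by (simp add: mult.assoc flip: power_add)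
    finally show ?thesis using r by simp
  qed
  have "((\<lambda>r::real. (C1 + C2) * r\<^sup>2) \<longlongrightarrow> (C1 + C2) * 0\<^sup>2) (at_right 0)" by (intro tendsto_intros)
  then have "\<forall>\<^sub>F r in at_right 0. (C1 + C2) * r\<^sup>2 < \<eta>" using \<eta>(1) by (intro order_tendstoD(2)) auto
  moreover have "\<forall>\<^sub>F r in at_right 0. r \<in> {0<..<1::real}" by (rule eventually_at_right_real) simp
  ultimately have "\<forall>\<^sub>F r in at_right (0::real). False"
    by eventually_elim (use key in fastforce)
  then show False by simp
qed

end

subsection \<open>Complex Hessians\<close>

text \<open>The matrix of d^2 q / dz_j dz_k-bar in terms of the real Hessian; the 4 collects the
  factors 1/2 of two Wirtinger derivatives.\<close>

definition complex_hessian :: "((complex^'n::finite) \<Rightarrow>\<^sub>L (complex^'n) \<Rightarrow>\<^sub>L real) \<Rightarrow> complex^'n^'n"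
  where "complex_hessian H = (\<chi> j k. (of_real (H (axis j 1) (axis k 1) + H (axis j \<i>) (axis k \<i>))
    + \<i> * of_real (H (axis j 1) (axis k \<i>) - H (axis j \<i>) (axis k 1))) / 4)"

lemma ddc_eq_form_of:
  fixes q :: "complex^'n::finite \<Rightarrow> real"
  assumes j: "C2jet U q D D2" and U: "open U" "x \<in> U"
  shows "ddc q x = form_of (complex_hessian (D2 x))"
proof -
  have d1: "frechet_derivative (\<lambda>y. complex_of_real (q y)) (at y) = (\<lambda>h. of_real (D y h))" if "y \<in> U" for y
    by (rule frechet_derivative_at[symmetric])
      (intro has_derivative_of_real C2jetD(1)[OF j that])
  have zbar: "deriv_zbar k (\<lambda>y. complex_of_real (q y)) y
    = (of_real (D y (axis k 1)) + \<i> * of_real (D y (axis k \<i>))) / 2" if "y \<in> U" for k y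
    unfolding deriv_zbar_def d1[OF that] ..
  have "((\<lambda>y. (of_real (D y (axis k 1)) + \<i> * of_real (D y (axis k \<i>))) / 2) has_derivative
      (\<lambda>h. (of_real (D2 x h (axis k 1)) + \<i> * of_real (D2 x h (axis k \<i>))) / 2)) (at x)" for k
  proof -
    have "((\<lambda>y. D y v) has_derivative (\<lambda>h. D2 x h v)) (at x)" for v
      by (rule bounded_linear.has_derivative[OF blinfun.bounded_linear_left C2jetD(2)[OF j U(2)]])
    then show ?thesis
      by (intro bounded_linear.has_derivative[OF bounded_linear_divide] has_derivative_add
          bounded_linear.has_derivative[OF bounded_linear_mult_right] has_derivative_of_real)
  qed
  then have d2: "(deriv_zbar k (\<lambda>y. complex_of_real (q y)) has_derivative
      (\<lambda>h. (of_real (D2 x h (axis k 1)) + \<i> * of_real (D2 x h (axis k \<i>))) / 2)) (at x)" for k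
    by (rule has_derivative_transform_within_open[OF _ U]) (simp add: zbar)
  have "deriv_z l (deriv_zbar k (\<lambda>y. complex_of_real (q y))) x = complex_hessian (D2 x) $ l $ k" for l k
    unfolding deriv_z_def frechet_derivative_at[OF d2, symmetric] complex_hessian_def
    by (simp add: field_simps)
  then show ?thesis unfolding ddc_def form_of_def fun_eq_iff by simp
qed

lemma complex_hessian_hermitian:
  fixes H :: "(complex^'n::finite) \<Rightarrow>\<^sub>L (complex^'n) \<Rightarrow>\<^sub>L real"
  assumes "\<And>h k. H h k = H k h"
  shows "hermitian (complex_hessian H)"
  unfolding hermitian_def adjoint_matrix_def complex_hessian_def vec_eq_iff
  using assms by (simp add: complex_eq_iff)

lemma complex_hessian_add: "complex_hessian (G + H) = complex_hessian G + complex_hessian H"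
  unfolding complex_hessian_def vec_eq_iff by (simp add: plus_blinfun.rep_eq complex_eq_iff add_divide_distrib diff_divide_distrib)

lemma complex_hessian_0: "complex_hessian 0 = 0"
  unfolding complex_hessian_def vec_eq_iff by (simp add: zero_blinfun.rep_eq)

definition diag_op :: "('n::finite \<Rightarrow> real) \<Rightarrow> complex^'n \<Rightarrow> complex^'n"
  where "diag_op d z = (\<chi> i. d i *\<^sub>R z $ i)"

lemma diag_op: "linear (diag_op d)" "diag_op d x \<bullet> y = x \<bullet> diag_op d y" "diag_op (\<lambda>_. c) x = c *\<^sub>R x"
  unfolding diag_op_def
  by (auto intro!: linearI simp: vec_eq_iff scaleR_add_right inner_vec_def)

lemma inner_diag_op_nonneg: "(\<And>i. 0 \<le> d i) \<Longrightarrow> 0 \<le> diag_op d x \<bullet> x"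
  unfolding diag_op_def by (auto simp: inner_vec_def intro!: sum_nonneg mult_nonneg_nonneg)

text \<open>The quadratic form of \<open>diag_op d\<close> is the sum of the d_i |z_i|^2, where each
  |z_i|^2 = z_i z_i-bar contributes one diagonal entry.\<close>

lemma complex_hessian_diag_op:
  fixes d :: "'n::finite \<Rightarrow> real"
  shows "complex_hessian (Blinfun (\<lambda>h. blinfun_inner_right (2 *\<^sub>R diag_op d h))) = (\<Sum>i\<in>UNIV. cscale (of_real (d i)) (rank1 (axis i 1)))"
proof -
  have b: "blinfun_apply (blinfun_apply (Blinfun (\<lambda>h. blinfun_inner_right (2 *\<^sub>R diag_op d h))) (axis j u)) (axis k v)
    = (if j = k then 2 * d j * (u \<bullet> v) else 0)" for j k :: 'n and u v :: complex
    unfolding Blinfun_quadratic_apply[OF diag_op(1)]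
    by (simp add: inner_axis diag_op_def) (simp add: axis_def)
  have s: "(\<Sum>i\<in>UNIV. cscale (of_real (d i)) (rank1 (axis i 1))) $ j $ k = (if j = k then of_real (d j) else 0)" for j k :: 'n
  proof -
    have "(\<Sum>i\<in>UNIV. cscale (of_real (d i)) (rank1 (axis i 1))) $ j $ k
      = (\<Sum>i\<in>UNIV. if i = j then (if j = k then of_real (d j) else 0) else 0)"
      unfolding sum_component by (intro sum.cong refl) (auto simp: cscale_def rank1_def axis_def)
    then show ?thesis by simp
  qed
  show ?thesis unfolding vec_eq_iff s unfolding complex_hessian_def by (simp add: b complex_eq_iff)
qed

lemma sum_diag_const: "(\<Sum>i\<in>UNIV. cscale (of_real c) (rank1 (axis i 1))) = (c *\<^sub>R mat 1 :: complex^'n::finite^'n)"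
  unfolding cscale_of_real scaleR_sum_right[symmetric] sum_rank1_axis ..

lemma C2jet_diag: "C2jet U (\<lambda>x. diag_op d (x - c) \<bullet> (x - c)) (\<lambda>x. blinfun_inner_right (2 *\<^sub>R diag_op d (x - c)))
    (\<lambda>x. Blinfun (\<lambda>h. blinfun_inner_right (2 *\<^sub>R diag_op d h)))"
  by (rule C2jet_quadratic[OF diag_op(1,2)])

text \<open>Both sides are real multiples of \<open>\<beta>_top\<close>, which is not the zero form,
  so comparing them means comparing coefficients.\<close>

lemma top_form_le_iff:
  fixes A :: "complex^'n::finite^'n"
  assumes A: "hermitian A" and k: "k \<le> CARD('n)"
  shows "top_form_le (\<lambda>v. of_real r * \<beta>_top v) (wedge_\<beta> k (form_of A)) \<longleftrightarrow> r \<le> Re (hsym k A)"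
    and "top_form_le (wedge_\<beta> k (form_of A)) (\<lambda>v. of_real r * \<beta>_top v) \<longleftrightarrow> Re (hsym k A) \<le> r"
proof -
  obtain v where v: "(\<beta>_top :: 'n even_form) v \<noteq> 0" using beta_top_nonzero by blast
  have w: "wedge_\<beta> k (form_of A) v = of_real (Re (hsym k A)) * \<beta>_top v" for v
    unfolding wedge_beta_form_of[OF k] using hsym_hermitian[OF A] by simp
  have *: "(\<exists>c::real. c \<ge> 0 \<and> (\<forall>v. of_real s * (\<beta>_top :: 'n even_form) v - of_real r * \<beta>_top v = of_real c * \<beta>_top v)) \<longleftrightarrow> r \<le> s"
    for r s :: real
  proof
    assume "\<exists>c::real. c \<ge> 0 \<and> (\<forall>v. of_real s * (\<beta>_top :: 'n even_form) v - of_real r * \<beta>_top v = of_real c * \<beta>_top v)"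
    then obtain c :: real where c: "c \<ge> 0" "of_real s * (\<beta>_top :: 'n even_form) v - of_real r * \<beta>_top v = of_real c * \<beta>_top v" by blast
    then have "complex_of_real (s - r) * \<beta>_top v = of_real c * \<beta>_top v" by (simp add: left_diff_distrib)
    then have "s - r = c" using v by (simp only: mult_cancel_right of_real_eq_iff) simp
    then show "r \<le> s" using c by simp
  next
    assume "r \<le> s"
    then show "\<exists>c::real. c \<ge> 0 \<and> (\<forall>v. of_real s * (\<beta>_top :: 'n even_form) v - of_real r * \<beta>_top v = of_real c * \<beta>_top v)"
      by (intro exI[of _ "s - r"]) (auto simp: left_diff_distrib)
  qed
  show "top_form_le (\<lambda>v. of_real r * \<beta>_top v) (wedge_\<beta> k (form_of A)) \<longleftrightarrow> r \<le> Re (hsym k A)"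
    "top_form_le (wedge_\<beta> k (form_of A)) (\<lambda>v. of_real r * \<beta>_top v) \<longleftrightarrow> Re (hsym k A) \<le> r"
    unfolding top_form_le_def w by (rule *)+
qed

lemma m_positive_iff:
  fixes A :: "complex^'n::finite^'n"
  assumes A: "hermitian A" and m: "m \<le> CARD('n)"
  shows "m_positive m (form_of A) \<longleftrightarrow> A \<in> nonneg_cone m"
proof -
  have "m_positive m (form_of A) \<longleftrightarrow> (\<forall>j\<in>{1..m}. 0 \<le> Re (hsym j A))"
    unfolding m_positive_def using top_form_le_iff(1)[OF A, of _ 0] m by simp
  also have "\<dots> \<longleftrightarrow> A \<in> nonneg_cone m"
    unfolding nonneg_cone_def using A by (auto simp: hsym_0 Ball_def) (metis One_nat_def Suc_leI hsym_0 neq0_conv one_complex.sel(1) zero_le_one)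
  finally show ?thesis .
qed

text \<open>The definition speaks of \<open>hsym m\<close> alone. Adding a nonnegative diagonal
  quadratic to q keeps it touching from above, so the bound holds for all diagonal additions, and
  \<open>hsym_nonneg_of_diag\<close> recovers the lower \<open>hsym j\<close>.\<close>

lemma subsolution_hsym_ge:
  fixes w :: "complex^'n::finite \<Rightarrow> real"
  assumes sub: "viscosity_subsolution m F \<Omega> (\<lambda>x. ereal (w x))" and m: "m \<le> CARD('n)"
    and x: "x \<in> \<Omega>" "open U" "x \<in> U" and j: "C2jet U q D D2" and eq: "q x = w x"
    and ev: "\<forall>\<^sub>F y in nhds x. w y \<le> q y" and F: "0 \<le> F x (w x)"
  shows "complex_hessian (D2 x) \<in> hsym_ge m (F x (w x))"
proof -
  have le: "F x (w x) \<le> Re (hsym m (complex_hessian (D2 x) + (\<Sum>i\<in>UNIV. cscale (of_real (d i)) (rank1 (axis i 1)))))"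
    if d: "\<And>i. 0 \<le> d i" for d
  proof -
    let ?p = "\<lambda>y. q y + diag_op d (y - x) \<bullet> (y - x)"
    have jp: "C2jet U ?p (\<lambda>y. D y + blinfun_inner_right (2 *\<^sub>R diag_op d (y - x)))
        (\<lambda>y. D2 y + Blinfun (\<lambda>h. blinfun_inner_right (2 *\<^sub>R diag_op d h)))"
      by (intro C2jet_add j C2jet_diag)
    have "touches_above ?p (\<lambda>x. ereal (w x)) x"
      unfolding touches_above_def C2_near_def C2_on_C2jet
    proof (intro conjI)
      show "\<exists>V. open V \<and> x \<in> V \<and> (\<exists>D D2. C2jet V ?p D D2)" using x jp by blast
      show "ereal (?p x) = ereal (w x)" using eq by simp
      show "\<forall>\<^sub>F y in nhds x. ereal (w y) \<le> ereal (?p y)"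
        using ev
      proof eventually_elim
        case (elim y)
        then show ?case using inner_diag_op_nonneg[of d "y - x", OF d] by simp
      qed
    qed
    then have "top_form_le (\<lambda>v. of_real (F x (?p x)) * \<beta>_top v) (Hess m ?p x)"
      using sub x(1) unfolding viscosity_subsolution_def by blast
    moreover have "Hess m ?p x = wedge_\<beta> m (form_of (complex_hessian (D2 x) + (\<Sum>i\<in>UNIV. cscale (of_real (d i)) (rank1 (axis i 1)))))"
      unfolding Hess_def ddc_eq_form_of[OF jp x(2,3)] complex_hessian_add complex_hessian_diag_op ..
    moreover have "hermitian (complex_hessian (D2 x) + (\<Sum>i\<in>UNIV. cscale (of_real (d i)) (rank1 (axis i 1))))"
      unfolding complex_hessian_diag_op[symmetric] complex_hessian_add[symmetric] using C2jet_symmetric[OF jp x(2,3)] by (rule complex_hessian_hermitian)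
    moreover have "?p x = w x" using eq by simp
    ultimately show ?thesis using top_form_le_iff(1)[OF _ m] by metis
  qed
  have "0 \<le> Re (hsym i (complex_hessian (D2 x)))" if "i \<le> m" for i
  proof (rule hsym_nonneg_of_diag[OF m _ that])
    fix d :: "'n \<Rightarrow> real" assume d: "\<And>i. 0 \<le> d i"
    show "0 \<le> Re (hsym m (complex_hessian (D2 x) + (\<Sum>i\<in>UNIV. cscale (of_real (d i)) (rank1 (axis i 1)))))"
      using le[of d, OF d] F by linarith
  qed
  moreover have "F x (w x) \<le> Re (hsym m (complex_hessian (D2 x)))" using le[of "\<lambda>_. 0"] by (simp add: cscale_simps)
  moreover have "hermitian (complex_hessian (D2 x))" using C2jet_symmetric[OF j x(2,3)] by (rule complex_hessian_hermitian)
  ultimately show ?thesis unfolding hsym_ge_def nonneg_cone_def by blast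
qed

text \<open>On the cone \<open>Hess_pos\<close> agrees with \<open>Hess\<close>, so the definition
  bounds \<open>hsym m\<close> itself.\<close>

lemma supersolution_hsym_le:
  fixes w :: "complex^'n::finite \<Rightarrow> real"
  assumes super: "viscosity_supersolution m F \<Omega> (\<lambda>x. ereal (w x))" and m: "m \<le> CARD('n)"
    and x: "x \<in> \<Omega>" "open U" "x \<in> U" and j: "C2jet U q D D2" and eq: "q x = w x"
    and ev: "\<forall>\<^sub>F y in nhds x. q y \<le> w y" and cone: "complex_hessian (D2 x) \<in> nonneg_cone m"
  shows "Re (hsym m (complex_hessian (D2 x))) \<le> F x (w x)"
proof -
  have "touches_below q (\<lambda>x. ereal (w x)) x"
    unfolding touches_below_def C2_near_def C2_on_C2jet using x j eq ev by auto
  then have "top_form_le (Hess_pos m q x) (\<lambda>v. of_real (F x (q x)) * \<beta>_top v)"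
    using super x(1) unfolding viscosity_supersolution_def by blast
  moreover have herm: "hermitian (complex_hessian (D2 x))" using cone by (simp add: nonneg_cone_def)
  moreover have "Hess_pos m q x = wedge_\<beta> m (form_of (complex_hessian (D2 x)))"
    unfolding Hess_pos_def Hess_def ddc_eq_form_of[OF j x(2,3)] m_positive_iff[OF herm m] using cone by simp
  ultimately show ?thesis using top_form_le_iff(2)[OF herm m] eq by simp
qed

subsection \<open>Mollification of subsolutions of the Hessian equation\<close>

lemma sum_Basis_cvec:
  fixes f :: "complex^'n::finite \<Rightarrow> real"
  shows "(\<Sum>b\<in>Basis. f b) = (\<Sum>j\<in>UNIV. f (axis j 1) + f (axis j \<i>))"
proof -
  have B: "(Basis :: (complex^'n) set) = (\<lambda>(j, u). axis j u) ` (UNIV \<times> {1, \<i>})"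
    unfolding Basis_vec_def Basis_complex_def by auto
  have inj: "inj_on (\<lambda>(j, u). axis j u :: complex^'n) (UNIV \<times> {1, \<i>})"
    by (auto simp: inj_on_def axis_eq_axis)
  have "(\<Sum>b\<in>Basis. f b) = (\<Sum>(j, u)\<in>UNIV \<times> {1, \<i>}. f (axis j u))"
    unfolding B sum.reindex[OF inj] by (simp add: case_prod_unfold o_def)
  also have "\<dots> = (\<Sum>j\<in>UNIV. \<Sum>u\<in>{1, \<i>}. f (axis j u))" by (rule sum.cartesian_product[symmetric])
  finally show ?thesis by simp
qed

text \<open>A quarter of the transpose of Q: with these real coefficients \<open>trace_op\<close>
  computes the inner product of Q with the complex Hessian, the 4 being the one in
  \<open>complex_hessian\<close>.\<close>

definition mat_op :: "complex^'n^'n \<Rightarrow> complex^'n::finite \<Rightarrow> complex^'n"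
  where "mat_op Q v = (1/4) *\<^sub>R (\<chi> k. \<Sum>j\<in>UNIV. Q $ j $ k * v $ j)"

lemma linear_mat_op: "linear (mat_op Q)"
  unfolding mat_op_def
  by (rule linearI) (simp_all add: vec_eq_iff distrib_left sum.distrib scaleR_add_right scaleR_sum_right)

lemma trace_op_mat_op: "trace_op (mat_op Q) H = Q \<bullet> complex_hessian H" for Q :: "complex^'n::finite^'n"
proof -
  have ax: "mat_op Q (axis j u) = (1/4) *\<^sub>R (\<Sum>k\<in>UNIV. axis k (Q $ j $ k * u))" for j u
    unfolding mat_op_def vec_eq_iff
    by (simp add: axis_def if_distrib[of "\<lambda>x. _ * x"] cong: if_cong)
  have c: "axis k z = Re z *\<^sub>R axis k 1 + Im z *\<^sub>R (axis k \<i> :: complex^'n)" for k z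
    by (auto simp: vec_eq_iff axis_def complex_eq_iff)
  have "H h (mat_op Q (axis j u)) = (1/4) * (\<Sum>k\<in>UNIV. Re (Q $ j $ k * u) * H h (axis k 1) + Im (Q $ j $ k * u) * H h (axis k \<i>))" for h j u
    unfolding ax by (subst c) (simp add: blinfun.scaleR_right blinfun.sum_right blinfun.add_right)
  note * = this
  show ?thesis
    unfolding trace_op_def sum_Basis_cvec * inner_vec_def complex_hessian_def inner_complex_def
    by (simp add: sum_distrib_left sum.distrib[symmetric] algebra_simps add_divide_distrib diff_divide_distrib)
qed

lemma inner_adjoint_matrix: "adjoint_matrix A \<bullet> B = A \<bullet> adjoint_matrix B" for A B :: "complex^'n::finite^'n"
proof -
  have "adjoint_matrix A \<bullet> B = (\<Sum>i\<in>UNIV. \<Sum>j\<in>UNIV. A $ j $ i \<bullet> cnj (B $ i $ j))"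
    unfolding inner_vec_def adjoint_matrix_def by (simp add: inner_complex_def)
  also have "\<dots> = A \<bullet> adjoint_matrix B" unfolding inner_vec_def adjoint_matrix_def by (subst sum.swap) simp
  finally show ?thesis .
qed

lemma inner_mat_op:
  fixes Q :: "complex^'n::finite^'n"
  shows "mat_op Q v \<bullet> v = (1/4) * (Q \<bullet> rank1 (\<chi> i. cnj (v $ i)))"
    and "hermitian Q \<Longrightarrow> mat_op Q v \<bullet> w = v \<bullet> mat_op Q w"
proof -
  have e: "mat_op Q v \<bullet> w = (1/4) * (\<Sum>k\<in>UNIV. \<Sum>j\<in>UNIV. Re (Q $ j $ k * v $ j * cnj (w $ k)))" for v w
    unfolding mat_op_def inner_vec_def
    by (simp add: inner_complex_def sum_distrib_left sum_distrib_right sum.distrib[symmetric] algebra_simps)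
  show "mat_op Q v \<bullet> v = (1/4) * (Q \<bullet> rank1 (\<chi> i. cnj (v $ i)))"
    unfolding e by (subst sum.swap) (simp add: inner_vec_def rank1_def inner_complex_def algebra_simps)
  assume Q: "hermitian Q"
  then have Qjk: "cnj (Q $ j $ k) = Q $ k $ j" for j k
    by (metis (no_types, lifting) hermitian_def adjoint_matrix_def vec_lambda_beta)
  have "v \<bullet> mat_op Q w = (1/4) * (\<Sum>k\<in>UNIV. \<Sum>j\<in>UNIV. Re (cnj (Q $ j $ k * w $ j * cnj (v $ k))))"
    unfolding inner_commute[of v] e by (simp add: algebra_simps)
  also have "\<dots> = mat_op Q v \<bullet> w" unfolding e
    by (subst sum.swap) (simp only: complex_cnj_mult complex_cnj_cnj Qjk mult_ac)
  finally show "mat_op Q v \<bullet> w = v \<bullet> mat_op Q w" by simp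
qed

text \<open>The quadratic form of \<open>mat_op Q\<close> at v is a quarter of the inner product of
  Q with \<open>rank1\<close> of the conjugate of v. Its positivity makes the operator injective,
  hence invertible, and S is the inverse.\<close>

lemma pos_def_op_mat_op:
  fixes Q :: "complex^'n::finite^'n"
  assumes Q: "hermitian Q" and pos: "\<And>v. v \<noteq> 0 \<Longrightarrow> 0 < Q \<bullet> rank1 v"
  obtains S where "pos_def_op (mat_op Q) S"
proof -
  let ?T = "mat_op Q"
  have Tpos: "0 < ?T v \<bullet> v" if "v \<noteq> 0" for v
  proof -
    have "(\<chi> i. cnj (v $ i)) \<noteq> 0" using that by (auto simp: vec_eq_iff)
    then show ?thesis unfolding inner_mat_op(1) using pos by simp
  qed
  have inj: "inj ?T"
    unfolding linear_injective_0[OF linear_mat_op] using Tpos by (metis inner_zero_left less_irrefl)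
  then obtain S where S: "linear S" "S \<circ> ?T = id" using linear_injective_left_inverse[OF linear_mat_op] by blast
  have ST: "S (?T x) = x" for x using S(2) by (metis comp_apply id_apply)
  have surj: "surj ?T" by (rule linear_injective_imp_surjective[OF linear_mat_op inj refl])
  have "pos_def_op ?T S"
  proof (rule pos_def_op.intro)
    show "linear ?T" by (rule linear_mat_op)
    show "linear S" by (rule S(1))
    show "?T x \<bullet> y = x \<bullet> ?T y" for x y by (rule inner_mat_op(2)[OF Q])
    show "S x \<bullet> y = x \<bullet> S y" for x y
    proof -
      obtain x' y' where "x = ?T x'" "y = ?T y'" using surj by (metis surjD)
      then show ?thesis using inner_mat_op(2)[OF Q, of x' y'] by (simp add: ST)
    qed
    show "S (?T x) = x" for x by (rule ST)
    show "0 \<le> ?T x \<bullet> x" for x using Tpos[of x] by (cases "x = 0") auto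
    show "0 < S x \<bullet> x" if "x \<noteq> 0" for x
    proof -
      obtain x' where x': "x = ?T x'" using surj by (metis surjD)
      then have "x' \<noteq> 0" using that linear_0[OF linear_mat_op[of Q]] by auto
      then show ?thesis using Tpos[of x'] by (simp add: x' ST inner_commute)
    qed
  qed
  then show ?thesis using that by blast
qed

lemma inner_id_rank1: "mat 1 \<bullet> rank1 v = (norm v)\<^sup>2" for v :: "complex^'n::finite"
proof -
  have "mat 1 \<bullet> rank1 v = (\<Sum>i\<in>UNIV. \<Sum>j\<in>UNIV. if j = i then (cmod (v $ i))\<^sup>2 else 0)"
    unfolding inner_vec_def mat_def rank1_def
    by (intro sum.cong refl) (auto simp: inner_complex_def cmod_power2 simp flip: power2_eq_square)
  also have "\<dots> = (norm v)\<^sup>2"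
    by (simp add: norm_vec_def L2_set_def sum_nonneg)
  finally show ?thesis .
qed

lemma inner_id_trace: "mat 1 \<bullet> A = real CARD('n) * Re (hsym 1 A)" for A :: "complex^'n::finite^'n"
proof -
  have "mat 1 \<bullet> A = (\<Sum>i\<in>UNIV. \<Sum>j\<in>UNIV. if j = i then Re (A $ i $ i) else 0)"
    unfolding inner_vec_def mat_def
    by (intro sum.cong refl) (auto simp: inner_complex_def)
  also have "\<dots> = Re (\<Sum>i\<in>UNIV. A $ i $ i)" by simp
  also have "\<dots> = real CARD('n) * Re (hsym 1 A)" unfolding hsym_1[symmetric] by simp
  finally show ?thesis .
qed

text \<open>A half space containing \<open>hsym_ge m c\<close> is a linear constraint with a positive semidefinite, hence
  after perturbation positive definite, coefficient matrix; such constraints survive mollification.\<close>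

lemma mollification_hsym_ge:
  fixes w :: "complex^'n::finite \<Rightarrow> real"
  assumes m: "1 \<le> m" "m \<le> CARD('n)" and c: "0 \<le> c"
    and w: "continuous_on UNIV w" and supp: "\<And>y. y \<notin> cbox a b \<Longrightarrow> w y = 0" and M: "\<And>x. \<bar>w x\<bar> \<le> M"
    and \<delta>: "0 < \<delta>"
    and visc: "\<And>x U q D D2. x \<in> ball y0 (2 * \<delta>) \<Longrightarrow> open U \<Longrightarrow> x \<in> U \<Longrightarrow> C2jet U q D D2 \<Longrightarrow> q x = w x \<Longrightarrow>
      (\<forall>\<^sub>F y in nhds x. w y \<le> q y) \<Longrightarrow> complex_hessian (D2 x) \<in> hsym_ge m c"
    and j: "C2jet UNIV (avg moll w \<delta>) D D2"
  shows "complex_hessian (D2 y0) \<in> hsym_ge m c"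
proof (rule ccontr)
  let ?K = "hsym_ge m c :: (complex^'n^'n) set"
  let ?A = "complex_hessian (D2 y0)"
  assume "?A \<notin> ?K"
  then obtain s \<beta> where s: "s \<bullet> ?A < \<beta>" "\<And>X. X \<in> ?K \<Longrightarrow> \<beta> < s \<bullet> X"
    using separating_hyperplane_closed_point[OF convex_hsym_ge[OF m c] closed_hsym_ge] by blast
  \<comment> \<open>The Hermitian part has the same inner product as s with every Hermitian
    matrix.\<close>
  define P where "P = (1/2) *\<^sub>R (s + adjoint_matrix s)"
  have adj2: "adjoint_matrix (adjoint_matrix X) = X" for X :: "complex^'n^'n" by (simp add: adjoint_matrix_def vec_eq_iff)
  have P: "hermitian P" unfolding P_def hermitian_def by (simp add: adjoint_matrix_simps adj2 add.commute)
  have Ps: "P \<bullet> X = s \<bullet> X" if "hermitian X" for X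
    using that unfolding P_def hermitian_def by (simp add: inner_add_left inner_adjoint_matrix)
  have hA: "hermitian ?A" using C2jet_symmetric[OF j open_UNIV UNIV_I] by (rule complex_hessian_hermitian)
  obtain X0 where X0: "X0 \<in> ?K" using hsym_ge_nonempty[OF m c] by blast
  have Prank: "0 \<le> P \<bullet> rank1 v" for v
  proof (rule ccontr)
    assume neg: "\<not> 0 \<le> P \<bullet> rank1 v"
    \<comment> \<open>At this t the functional s takes exactly the value beta on X0 + t
      \<open>rank1 v\<close>, a matrix that lies in \<open>?K\<close>.\<close>
    define t where "t = (s \<bullet> X0 - \<beta>) / - (P \<bullet> rank1 v)"
    have t: "0 \<le> t" unfolding t_def using neg s(2)[OF X0] by (intro divide_nonneg_pos) auto
    have "X0 + t *\<^sub>R rank1 v \<in> ?K"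
      using X0 m t by (intro hsym_ge_add nonneg_cone_scale rank1_nonneg_cone) auto
    then have "\<beta> < s \<bullet> (X0 + t *\<^sub>R rank1 v)" by (rule s(2))
    also have "\<dots> = s \<bullet> X0 + t * (P \<bullet> rank1 v)" by (simp add: inner_add_right Ps hermitian_intros)
    also have "t * (P \<bullet> rank1 v) = - (s \<bullet> X0 - \<beta>)" unfolding t_def using neg by simp
    finally show False by simp
  qed
  \<comment> \<open>Small enough that adding epsilon times the identity to P keeps the Hessian at y0
    outside the half space.\<close>
  define \<epsilon> where "\<epsilon> = (\<beta> - s \<bullet> ?A) / (2 * (\<bar>mat 1 \<bullet> ?A\<bar> + 1))"
  have \<epsilon>: "0 < \<epsilon>" unfolding \<epsilon>_def using s(1) by (intro divide_pos_pos) auto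
  have "\<epsilon> * (mat 1 \<bullet> ?A) \<le> \<epsilon> * (\<bar>mat 1 \<bullet> ?A\<bar> + 1)" using \<epsilon> by (intro mult_left_mono) auto
  also have "\<dots> = (\<beta> - s \<bullet> ?A) / 2" unfolding \<epsilon>_def by (simp add: field_simps)
  finally have \<epsilon>A: "\<epsilon> * (mat 1 \<bullet> ?A) < \<beta> - s \<bullet> ?A" using s(1) by simp
  define Q where "Q = P + \<epsilon> *\<^sub>R mat 1"
  have Q: "hermitian Q" unfolding Q_def by (intro hermitian_intros P)
  have "0 < Q \<bullet> rank1 v" if "v \<noteq> 0" for v
    unfolding Q_def using Prank[of v] \<epsilon> that by (simp add: inner_add_left inner_id_rank1 add_nonneg_pos)
  then obtain S where "pos_def_op (mat_op Q) S" using pos_def_op_mat_op[OF Q] by blast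
  then interpret pos_def_op "mat_op Q" S .
  have "visc_ge \<beta> (ball y0 (2 * \<delta>)) w"
    unfolding visc_ge_def
  proof (intro ballI allI impI)
    fix x U q D D2
    assume "x \<in> ball y0 (2 * \<delta>)" "open U" "x \<in> U" "C2jet U q D D2" "q x = w x" "\<forall>\<^sub>F y in nhds x. w y \<le> q y"
    then have K: "complex_hessian (D2 x) \<in> ?K" by (rule visc)
    \<comment> \<open>As m >= 1, matrices in \<open>?K\<close> have nonnegative trace, so on them
      the perturbation can only increase the functional.\<close>
    then have "hermitian (complex_hessian (D2 x))" "0 \<le> Re (hsym 1 (complex_hessian (D2 x)))" using m by (auto simp: hsym_ge_def nonneg_cone_def)
    then have "P \<bullet> complex_hessian (D2 x) = s \<bullet> complex_hessian (D2 x)" "0 \<le> \<epsilon> * (mat 1 \<bullet> complex_hessian (D2 x))"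
      using Ps \<epsilon> unfolding inner_id_trace by (auto intro!: mult_nonneg_nonneg)
    then have "\<beta> < Q \<bullet> complex_hessian (D2 x)"
      unfolding Q_def using s(2)[OF K] by (simp add: inner_add_left)
    then show "\<beta> \<le> trace_op (mat_op Q) (D2 x)" unfolding trace_op_mat_op by simp
  qed
  from trace_op_mollification_ge[OF w _ M \<delta> this j, of a b] supp
  have "\<beta> \<le> trace_op (mat_op Q) (D2 y0)" by blast
  then show False unfolding trace_op_mat_op Q_def using \<epsilon>A by (simp add: inner_add_left Ps[OF hA])
qed

subsection \<open>Comparison\<close>

text \<open>Tietze extension times a cutoff. The heat flow averages over the whole space, so a
  function given on C is replaced by one of compact support that agrees with it there.\<close>

lemma compact_support_extension:
  fixes a :: "'a::euclidean_space \<Rightarrow> real"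
  assumes C: "compact C" and a: "continuous_on C a"
  obtains w M l u where "continuous_on UNIV w" "\<And>x. \<bar>w x\<bar> \<le> M" "\<And>x. x \<notin> cbox l u \<Longrightarrow> w x = 0"
    "\<And>x. x \<in> C \<Longrightarrow> w x = a x"
proof (cases "C = {}")
  case True
  then show ?thesis using that[of "\<lambda>_. 0" 0] by auto
next
  case False
  obtain M' where M': "\<And>x. x \<in> C \<Longrightarrow> norm (a x) \<le> M'"
    using compact_imp_bounded[OF compact_continuous_image[OF a C]] unfolding bounded_iff by blast
  define M where "M = max 0 M'"
  have M: "0 \<le> M" "\<And>x. x \<in> C \<Longrightarrow> norm (a x) \<le> M" unfolding M_def using M' by (auto intro: max.coboundedI2)
  obtain v where v: "continuous_on UNIV v" "\<And>x. x \<in> C \<Longrightarrow> v x = a x" "\<And>x. norm (v x) \<le> M"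
  proof (rule Tietze[OF a _ M])
    show "closedin (top_of_set UNIV) C" using compact_imp_closed[OF C] by simp
  qed auto
  obtain B where B: "\<And>x. x \<in> C \<Longrightarrow> norm x \<le> B" using compact_imp_bounded[OF C] unfolding bounded_iff by blast
  define \<eta> where "\<eta> x = max 0 (min 1 (B + 1 - norm x))" for x :: 'a
  have \<eta>: "0 \<le> \<eta> x" "\<eta> x \<le> 1" for x unfolding \<eta>_def by auto
  obtain c where c: "cball 0 (B + 1) \<subseteq> cbox (-c) (c::'a)"
    using bounded_subset_cbox_symmetric[OF bounded_cball] by blast
  show ?thesis
  proof (rule that[of "\<lambda>x. \<eta> x * v x" M "-c" c])
    show "continuous_on UNIV (\<lambda>x. \<eta> x * v x)" unfolding \<eta>_def by (intro continuous_intros v)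
    show "\<bar>\<eta> x * v x\<bar> \<le> M" for x
    proof -
      have "\<eta> x * \<bar>v x\<bar> \<le> 1 * M" using \<eta>[of x] v(3)[of x] by (intro mult_mono) auto
      then show ?thesis using \<eta>[of x] by (simp add: abs_mult)
    qed
    show "\<eta> x * v x = 0" if "x \<notin> cbox (-c) c" for x
    proof -
      have "x \<notin> cball 0 (B + 1)" using that c by blast
      then show ?thesis by (simp add: \<eta>_def)
    qed
    show "\<eta> x * v x = a x" if "x \<in> C" for x using B[OF that] v(2)[OF that] by (simp add: \<eta>_def)
  qed
qed

lemma avg_moll_uniform:
  fixes w :: "'a::euclidean_space \<Rightarrow> real"
  assumes w: "continuous_on UNIV w" and C: "compact C" and e: "0 < e"
  obtains r where "0 < r" "\<And>\<delta> x. 0 < \<delta> \<Longrightarrow> \<delta> < r \<Longrightarrow> x \<in> C \<Longrightarrow> \<bar>avg moll w \<delta> x - w x\<bar> \<le> e"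
proof -
  let ?C = "{x + y | x y. x \<in> C \<and> y \<in> cball 0 1}"
  have "compact ?C" by (intro compact_sums C compact_cball)
  then have uc: "uniformly_continuous_on ?C w"
    by (intro compact_uniformly_continuous continuous_on_subset[OF w]) auto
  obtain d where d: "d > 0" "\<And>x y. x \<in> ?C \<Longrightarrow> y \<in> ?C \<Longrightarrow> dist y x < d \<Longrightarrow> dist (w y) (w x) < e"
    by (rule uniformly_continuous_onE[OF uc e]) (rule that)
  show ?thesis
  proof (rule that[of "min d 1"])
    show "0 < min d 1" using d by simp
    fix \<delta> :: real and x :: 'a assume \<delta>: "0 < \<delta>" "\<delta> < min d 1" and x: "x \<in> C"
    have le: "moll z * \<bar>w (x - \<delta> *\<^sub>R z) - w x\<bar> \<le> moll z * e" for z
    proof (cases "1 \<le> norm z")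
      case False
      have "\<delta> * norm z \<le> \<delta> * 1" using False \<delta>(1) by (intro mult_left_mono) auto
      then have "\<delta> * norm z < min d 1" using \<delta>(2) by linarith
      then have n: "norm (\<delta> *\<^sub>R z) < min d 1" using \<delta> by simp
      have "x + 0 \<in> ?C" using x by force
      moreover have "x + (- (\<delta> *\<^sub>R z)) \<in> ?C" using x n by force
      ultimately have "dist (w (x - \<delta> *\<^sub>R z)) (w x) < e"
        using d(2)[of x "x - \<delta> *\<^sub>R z"] n by (simp add: dist_norm)
      then show ?thesis by (intro mult_left_mono moll_props) (simp add: dist_norm less_imp_le)
    qed (simp add: moll_props)
    have cw: "continuous_on UNIV (\<lambda>z. w (x - \<delta> *\<^sub>R z))"
      by (rule continuous_on_compose2[OF w]) (auto intro!: continuous_intros)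
    have int: "integrable lborel (\<lambda>z. moll z * f z)" if f: "continuous_on UNIV f" for f :: "'a \<Rightarrow> real"
    proof -
      have "integrable lborel (\<lambda>z. indicator (cball 0 1) z *\<^sub>R (moll z * f z))"
        by (rule borel_integrable_compact)
          (auto intro!: continuous_intros continuous_on_subset[OF f] continuous_on_subset[OF moll_props(1)])
      moreover have "(\<lambda>z::'a. indicator (cball 0 1) z *\<^sub>R (moll z * f z)) = (\<lambda>z. moll z * f z)"
      proof (rule ext)
        fix z :: 'a
        show "indicator (cball 0 1) z *\<^sub>R (moll z * f z) = moll z * f z"
          using moll_props(3)[of z] by (cases "norm z \<le> 1") (simp_all add: indicator_def)
      qed
      ultimately show ?thesis by simp
    qed
    have "avg moll w \<delta> x - w x = (LINT z|lborel. moll z * w (x - \<delta> *\<^sub>R z)) - (LINT z|lborel. moll (z::'a) * w x)"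
      unfolding avg_def using moll_props(5)[where 'a='a] by simp
    also have "\<dots> = (LINT z|lborel. moll z * w (x - \<delta> *\<^sub>R z) - moll z * w x)"
      by (rule Bochner_Integration.integral_diff[symmetric]) (use int[OF cw] int[of "\<lambda>_. w x"] in auto)
    also have "\<dots> = (LINT z|lborel. moll z * (w (x - \<delta> *\<^sub>R z) - w x))" by (simp add: right_diff_distrib)
    finally have "\<bar>avg moll w \<delta> x - w x\<bar> \<le> (LINT z|lborel. \<bar>moll z * (w (x - \<delta> *\<^sub>R z) - w x)\<bar>)"
      using integral_abs_bound by metis
    also have "\<dots> = (LINT z|lborel. moll z * \<bar>w (x - \<delta> *\<^sub>R z) - w x\<bar>)"
      by (simp add: abs_mult moll_props(2))
    also have "\<dots> \<le> (LINT z|lborel. moll (z::'a) * e)"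
      by (intro integral_mono int continuous_intros cw le)
    also have "\<dots> = e" using moll_props(5)[where 'a='a] by simp
    finally show "\<bar>avg moll w \<delta> x - w x\<bar> \<le> e" .
  qed
qed

text \<open>Here kappa is the slack on the boundary and mu the defect between the m-th roots of the
  right hand sides: adding mu |x|^2 raises the root by mu, at the cost mu R^2 in the conclusion. The
  coupling is asked for where b < a, which is where monotonicity of F in its second variable
  helps.\<close>

lemma comparison:
  fixes a b f F0 :: "complex^'n::finite \<Rightarrow> real" and D :: "(complex^'n) set"
  assumes m: "1 \<le> m" "m \<le> CARD('n)"
    and D: "open D" "bounded D" "\<And>x. x \<in> D \<Longrightarrow> norm x \<le> R"
    and ca: "continuous_on (closure D) a" and cb: "continuous_on (closure D) b"
    and bdry: "\<And>\<zeta>. \<zeta> \<in> frontier D \<Longrightarrow> a \<zeta> \<le> b \<zeta> + \<kappa>" and \<kappa>: "0 \<le> \<kappa>" and lam: "0 \<le> \<mu>"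
    and cf: "continuous_on D f" and f: "\<And>x. x \<in> D \<Longrightarrow> 0 \<le> f x"
    and sub: "\<And>x U q Dq D2q. x \<in> D \<Longrightarrow> open U \<Longrightarrow> x \<in> U \<Longrightarrow> C2jet U q Dq D2q \<Longrightarrow> q x = a x \<Longrightarrow>
      (\<forall>\<^sub>F y in nhds x. a y \<le> q y) \<Longrightarrow> complex_hessian (D2q x) \<in> hsym_ge m (f x)"
    and super: "\<And>x U q Dq D2q. x \<in> D \<Longrightarrow> open U \<Longrightarrow> x \<in> U \<Longrightarrow> C2jet U q Dq D2q \<Longrightarrow> q x = b x \<Longrightarrow>
      (\<forall>\<^sub>F y in nhds x. q y \<le> b y) \<Longrightarrow> complex_hessian (D2q x) \<in> nonneg_cone m \<Longrightarrow> Re (hsym m (complex_hessian (D2q x))) \<le> F0 x"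
    and couple: "\<And>x. x \<in> D \<Longrightarrow> b x < a x \<Longrightarrow> root m (F0 x) \<le> root m (f x) + \<mu>"
    and x1: "x1 \<in> D"
  shows "a x1 \<le> b x1 + \<kappa> + \<mu> * R\<^sup>2"
proof (rule ccontr)
  assume neg: "\<not> ?thesis"
  have m0: "0 < m" using m by simp
  have compD: "compact (closure D)" using D by (simp add: compact_closure)
  define N where "N x = x \<bullet> x" for x :: "complex^'n"
  have cN: "continuous_on S N" for S unfolding N_def by (intro continuous_intros)
  have "closed {x. N x \<le> R\<^sup>2}" by (intro closed_Collect_le cN continuous_on_const)
  moreover have "D \<subseteq> {x. N x \<le> R\<^sup>2}"
  proof
    fix x assume "x \<in> D"
    then have "(norm x)\<^sup>2 \<le> R\<^sup>2" using D(3) by (intro power_mono) auto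
    then show "x \<in> {x. N x \<le> R\<^sup>2}" by (simp add: N_def power2_norm_eq_inner)
  qed
  ultimately have NR: "N x \<le> R\<^sup>2" if "x \<in> closure D" for x using closure_minimal that by blast
  define \<theta>0 where "\<theta>0 = a x1 - b x1 - \<kappa> - \<mu> * R\<^sup>2"
  have \<theta>0: "0 < \<theta>0" unfolding \<theta>0_def using neg by simp
  \<comment> \<open>The strictness term epsilon (N - R^2) uses up at most half of the gap.\<close>
  define \<epsilon> where "\<epsilon> = \<theta>0 / (2 * (R\<^sup>2 + 1))"
  have \<epsilon>: "0 < \<epsilon>" unfolding \<epsilon>_def using \<theta>0 by (intro divide_pos_pos) (auto intro: add_nonneg_pos)
  have "\<epsilon> * R\<^sup>2 \<le> \<epsilon> * (R\<^sup>2 + 1)" using \<epsilon> by (intro mult_left_mono) auto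
  also have "\<dots> = \<theta>0 / 2" unfolding \<epsilon>_def by (simp add: field_simps add_nonneg_eq_0_iff)
  finally have \<epsilon>R: "\<epsilon> * R\<^sup>2 \<le> \<theta>0 / 2" .
  define \<Phi> where "\<Phi> x = a x + (\<mu> + \<epsilon>) * (N x - R\<^sup>2) - \<kappa> - b x" for x
  have c\<Phi>: "continuous_on (closure D) \<Phi>" unfolding \<Phi>_def by (intro continuous_intros ca cb cN)
  have Nneg: "(\<mu> + \<epsilon>) * (N x - R\<^sup>2) \<le> 0" if "x \<in> closure D" for x
    using NR[OF that] lam \<epsilon> by (intro mult_nonneg_nonpos) auto
  define \<theta> where "\<theta> = \<Phi> x1"
  have "0 \<le> N x1" unfolding N_def by simp
  then have "(\<mu> + \<epsilon>) * (N x1 - R\<^sup>2) \<ge> (\<mu> + \<epsilon>) * (- R\<^sup>2)" using lam \<epsilon> by (intro mult_left_mono) auto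
  then have \<theta>: "0 < \<theta>" unfolding \<theta>_def \<Phi>_def using \<epsilon>R \<theta>0 unfolding \<theta>0_def by (simp add: algebra_simps)
  \<comment> \<open>The perturbed difference is nonpositive on the frontier of D, so C is a compact
    subset of D and leaves room for mollification.\<close>
  define C where "C = {x \<in> closure D. \<theta> / 2 \<le> \<Phi> x}"
  have "closedin (top_of_set (closure D)) (closure D \<inter> \<Phi> -` {\<theta> / 2..})"
    by (intro continuous_closedin_preimage c\<Phi>) auto
  moreover have "closure D \<inter> \<Phi> -` {\<theta> / 2..} = C" unfolding C_def by auto
  ultimately have compC: "compact C" using compD closedin_compact by metis
  have CD: "C \<subseteq> D"
  proof
    fix x assume x: "x \<in> C"
    show "x \<in> D"
    proof (rule ccontr)
      assume "x \<notin> D"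
      then have "x \<in> frontier D" using x D(1) unfolding C_def frontier_def by (simp add: interior_open)
      then have "\<Phi> x \<le> 0" using bdry[of x] Nneg[of x] x unfolding \<Phi>_def C_def by simp
      then show False using x \<theta> unfolding C_def by simp
    qed
  qed
  have Cab: "b x < a x" if "x \<in> C" for x
    using that \<theta> Nneg[of x] \<kappa> unfolding C_def \<Phi>_def by simp
  obtain d0 where d0: "d0 > 0" "(\<Union>x\<in>C. cball x d0) \<subseteq> D"
    using compact_subset_open_imp_cball_epsilon_subset[OF compC D(1) CD] by blast
  define Ct where "Ct = {x + y | x y. x \<in> C \<and> y \<in> cball 0 d0}"
  have compCt: "compact Ct" unfolding Ct_def by (intro compact_sums compC compact_cball)
  have inCt: "y \<in> Ct" if "x \<in> C" "dist x y \<le> d0" for x y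
  proof -
    have "y = x + (y - x)" "y - x \<in> cball 0 d0" using that by (auto simp: dist_norm norm_minus_commute)
    then show ?thesis unfolding Ct_def using that(1) by blast
  qed
  have CtD: "Ct \<subseteq> D"
  proof
    fix z assume "z \<in> Ct"
    then obtain x y where "z = x + y" "x \<in> C" "y \<in> cball 0 d0" unfolding Ct_def by blast
    then have "z \<in> cball x d0" by (simp add: dist_norm)
    then show "z \<in> D" using d0(2) \<open>x \<in> C\<close> by blast
  qed
  define h where "h x = root m (f x)" for x
  have ch: "continuous_on Ct h" unfolding h_def
    by (intro continuous_on_real_root continuous_on_subset[OF cf CtD])
  then have "uniformly_continuous_on Ct h" using compCt by (rule compact_uniformly_continuous)
  then obtain d1 where d1: "d1 > 0" "\<And>x y. x \<in> Ct \<Longrightarrow> y \<in> Ct \<Longrightarrow> dist y x < d1 \<Longrightarrow> dist (h y) (h x) < \<epsilon> / 2"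
    unfolding uniformly_continuous_on_def using \<epsilon> half_gt_zero by metis
  obtain w M l u where w: "continuous_on UNIV w" "\<And>x. \<bar>w x\<bar> \<le> M" "\<And>x. x \<notin> cbox l u \<Longrightarrow> w x = 0"
    "\<And>x. x \<in> closure D \<Longrightarrow> w x = a x"
    using compact_support_extension[OF compD ca] by blast
  have "0 < \<theta> / 4" using \<theta> by simp
  then obtain r where r: "0 < r" "\<And>\<delta> x. 0 < \<delta> \<Longrightarrow> \<delta> < r \<Longrightarrow> x \<in> closure D \<Longrightarrow> \<bar>avg moll w \<delta> x - w x\<bar> \<le> \<theta> / 4"
    using avg_moll_uniform[OF w(1) compD] by blast
  \<comment> \<open>Balls of radius 2 delta around points of C stay in \<open>Ct\<close>, h differs
    there from its value at the centre by less than epsilon / 2, and mollification changes a by at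
    most theta / 4.\<close>
  define \<delta> where "\<delta> = min r (min d0 d1) / 2"
  have \<delta>: "0 < \<delta>" "\<delta> < r" "2 * \<delta> \<le> d0" "2 * \<delta> \<le> d1" unfolding \<delta>_def using r d0 d1 by auto
  have app: "\<bar>avg moll w \<delta> x - a x\<bar> \<le> \<theta> / 4" if "x \<in> closure D" for x
    using r(2)[OF \<delta>(1,2) that] w(4)[OF that] by simp
  obtain Dm D2m where j: "C2jet UNIV (avg moll w \<delta>) Dm D2m"
    using avg_moll_jet[OF w(1) w(3) \<delta>(1)] by blast
  have cm: "continuous_on UNIV (avg moll w \<delta>)"
    by (rule has_derivative_continuous_on) (use C2jetD(1)[OF j] in auto)
  define G where "G x = avg moll w \<delta> x + (\<mu> + \<epsilon>) * (N x - R\<^sup>2) - \<kappa> - b x" for x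
  have cG: "continuous_on (closure D) G"
    unfolding G_def by (intro continuous_intros cb cN continuous_on_subset[OF cm]) auto
  have "x1 \<in> closure D" using x1 closure_subset by blast
  then have "closure D \<noteq> {}" using x1 by auto
  from continuous_attains_sup[OF compD this cG]
  obtain x where x: "x \<in> closure D" "\<And>y. y \<in> closure D \<Longrightarrow> G y \<le> G x" by blast
  \<comment> \<open>Passing to the mollified function and back costs theta / 4 each time, so the
    maximum point of G still lies in C.\<close>
  have "a x1 - \<theta> / 4 \<le> avg moll w \<delta> x1" using app[OF \<open>x1 \<in> closure D\<close>] by (simp only: abs_le_iff) linarith
  moreover have "\<theta> = a x1 + (\<mu> + \<epsilon>) * (N x1 - R\<^sup>2) - \<kappa> - b x1" unfolding \<theta>_def \<Phi>_def ..
  ultimately have "\<theta> - \<theta> / 4 \<le> G x1" unfolding G_def by linarith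
  also have "\<dots> \<le> G x" by (rule x(2)[OF \<open>x1 \<in> closure D\<close>])
  also have "\<dots> \<le> \<Phi> x + \<theta> / 4" using app[OF x(1)] unfolding G_def \<Phi>_def abs_le_iff by linarith
  finally have xC: "x \<in> C" unfolding C_def using x(1) by simp
  then have xD: "x \<in> D" using CD by blast
  \<comment> \<open>A constant lower bound for f on the ball around x, with m-th root at least h x -
    epsilon / 2.\<close>
  define c where "c = max 0 (h x - \<epsilon> / 2) ^ m"
  have c: "0 \<le> c" unfolding c_def by simp
  have ballD: "ball x (2 * \<delta>) \<subseteq> Ct"
  proof
    fix y assume "y \<in> ball x (2 * \<delta>)"
    then have "dist x y \<le> d0" using \<delta>(3) by simp
    then show "y \<in> Ct" by (rule inCt[OF xC])
  qed
  have fc: "c \<le> f y" if "y \<in> ball x (2 * \<delta>)" for y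
  proof -
    have y: "y \<in> Ct" using that ballD by blast
    have "x \<in> Ct" using inCt[OF xC, of x] d0(1) by simp
    then have "dist (h y) (h x) < \<epsilon> / 2" using d1(2)[of x y] y that \<delta>(4) by (auto simp: dist_commute)
    then have "h x - \<epsilon> / 2 \<le> h y" unfolding dist_real_def abs_less_iff by linarith
    moreover have "0 \<le> f y" using f y CtD by blast
    then have "0 \<le> h y" unfolding h_def using m0 by simp
    ultimately have "c \<le> h y ^ m" unfolding c_def by (intro power_mono) auto
    then show ?thesis unfolding h_def using m0 \<open>0 \<le> f y\<close> by simp
  qed
  have K: "complex_hessian (D2m x) \<in> hsym_ge m c"
  proof (rule mollification_hsym_ge[OF m c w(1) _ w(2) \<delta>(1) _ j])
    show "\<And>y. y \<notin> cbox l u \<Longrightarrow> w y = 0" by (rule w(3))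
    fix y U q Dq D2q
    assume y: "y \<in> ball x (2 * \<delta>)" and q: "open U" "y \<in> U" "C2jet U q Dq D2q" "q y = w y" "\<forall>\<^sub>F z in nhds y. w z \<le> q z"
    have yD: "y \<in> D" using y ballD CtD by blast
    have wa: "w z = a z" if "z \<in> D" for z using w(4) that closure_subset by blast
    have "\<forall>\<^sub>F z in nhds y. z \<in> D" using D(1) yD by (rule eventually_nhds_in_open)
    with q(5) have ev: "\<forall>\<^sub>F z in nhds y. a z \<le> q z" by eventually_elim (use wa in auto)
    have "q y = a y" using q(4) wa[OF yD] by simp
    from sub[OF yD q(1,2,3) this ev] have "complex_hessian (D2q y) \<in> hsym_ge m (f y)" .
    then show "complex_hessian (D2q y) \<in> hsym_ge m c" using fc[OF y] unfolding hsym_ge_def by auto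
  qed
  let ?d = "\<lambda>_::'n. \<mu> + \<epsilon>"
  define k where "k = b x - avg moll w \<delta> x - (\<mu> + \<epsilon>) * N x"
  \<comment> \<open>G + b up to a constant: as G is maximal at x, this smooth function touches b
    from below there.\<close>
  let ?q = "\<lambda>y. (avg moll w \<delta> y + diag_op ?d (y - 0) \<bullet> (y - 0)) + k"
  have jq: "C2jet UNIV ?q (\<lambda>y. (Dm y + blinfun_inner_right (2 *\<^sub>R diag_op ?d (y - 0))) + 0)
     (\<lambda>y. (D2m y + Blinfun (\<lambda>h. blinfun_inner_right (2 *\<^sub>R diag_op ?d h))) + 0)"
    by (intro C2jet_add j C2jet_diag C2jet_const)
  have qN: "?q y = avg moll w \<delta> y + (\<mu> + \<epsilon>) * N y + k" for y
    by (simp add: diag_op_def inner_vec_def N_def sum_distrib_left)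
  let ?H = "(D2m x + Blinfun (\<lambda>h. blinfun_inner_right (2 *\<^sub>R diag_op ?d h))) + 0"
  have H: "complex_hessian ?H = complex_hessian (D2m x) + (\<mu> + \<epsilon>) *\<^sub>R mat 1"
    unfolding complex_hessian_add complex_hessian_0 complex_hessian_diag_op sum_diag_const by simp
  have cone: "complex_hessian (D2m x) \<in> nonneg_cone m" "c \<le> Re (hsym m (complex_hessian (D2m x)))" using K by (auto simp: hsym_ge_def)
  have idc: "(\<mu> + \<epsilon>) *\<^sub>R mat 1 \<in> (nonneg_cone m :: (complex^'n^'n) set)"
    using lam \<epsilon> m subsetD[OF pos_cone_subset id_pos_cone[OF m(2)]] by (intro nonneg_cone_scale) auto
  have "Re (hsym m (complex_hessian ?H)) \<le> F0 x"
  proof (rule super[OF xD open_UNIV UNIV_I jq])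
    show "?q x = b x" unfolding qN unfolding k_def by simp
    have "\<forall>\<^sub>F y in nhds x. y \<in> D" using D(1) xD by (rule eventually_nhds_in_open)
    then show "\<forall>\<^sub>F y in nhds x. ?q y \<le> b y"
    proof eventually_elim
      case (elim y)
      then have "G y \<le> G x" using x(2) closure_subset by blast
      then show ?case unfolding qN unfolding k_def G_def by (simp add: algebra_simps)
    qed
    show "complex_hessian ?H \<in> nonneg_cone m" unfolding H by (rule nonneg_cone_superadditive(1)[OF cone(1) idc m])
  qed
  then have "root m (Re (hsym m (complex_hessian ?H))) \<le> root m (F0 x)" using m0 by simp
  also have "\<dots> \<le> h x + \<mu>" unfolding h_def by (rule couple[OF xD Cab[OF xC]])
  finally have up: "root m (Re (hsym m (complex_hessian ?H))) \<le> h x + \<mu>" .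
  have "root m c \<le> root m (Re (hsym m (complex_hessian (D2m x))))" using cone(2) m0 by simp
  moreover have "root m c = max 0 (h x - \<epsilon> / 2)" unfolding c_def using m0 by (intro real_root_power_cancel) auto
  moreover have "root m (Re (hsym m ((\<mu> + \<epsilon>) *\<^sub>R mat 1 :: complex^'n^'n))) = \<mu> + \<epsilon>"
    using m lam \<epsilon> by (simp add: hsym_scaleR hsym_id real_root_power_cancel)
  \<comment> \<open>The quadratic gained mu + epsilon and freezing f lost epsilon / 2, which exceeds
    the upper bound h x + mu.\<close>
  ultimately have "h x - \<epsilon> / 2 + (\<mu> + \<epsilon>) \<le> root m (Re (hsym m (complex_hessian ?H)))"
    using nonneg_cone_superadditive(2)[OF cone(1) idc m] unfolding H by linarith
  then show False using up \<epsilon> by simp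
qed

lemma C2jet_shift:
  assumes "C2jet U q D D2"
  shows "C2jet ((+) h ` U) (\<lambda>y. q (y - h)) (\<lambda>y. D (y - h)) (\<lambda>y. D2 (y - h))"
proof -
  have sub: "((\<lambda>y. y - h) has_derivative (\<lambda>k. k)) (at y)" for y by (auto intro!: derivative_eq_intros)
  show ?thesis
    unfolding C2jet_def
  proof (intro conjI ballI)
    fix y assume "y \<in> (+) h ` U"
    then have y: "y - h \<in> U" by auto
    show "((\<lambda>y. q (y - h)) has_derivative blinfun_apply (D (y - h))) (at y)"
      using has_derivative_compose[OF sub C2jetD(1)[OF assms y]] .
    show "((\<lambda>y. D (y - h)) has_derivative blinfun_apply (D2 (y - h))) (at y)"
      using has_derivative_compose[OF sub C2jetD(2)[OF assms y]] .
  next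
    have "continuous_on U D2" using assms by (simp add: C2jet_def)
    then show "continuous_on ((+) h ` U) (\<lambda>y. D2 (y - h))"
      by (rule continuous_on_compose2) (auto intro!: continuous_intros)
  qed
qed

subsection \<open>Boundary values\<close>

lemma usc_lsc_continuous:
  fixes w :: "'a::topological_space \<Rightarrow> real"
  assumes "open S" "usc_on S (\<lambda>x. ereal (w x))" "lsc_on S (\<lambda>x. ereal (w x))"
  shows "continuous_on S w"
  unfolding continuous_on_def
proof
  fix x assume x: "x \<in> S"
  show "(w \<longlongrightarrow> w x) (at x within S)"
  proof (rule order_tendstoI)
    fix a assume "a < w x"
    then have "\<forall>\<^sub>F y in at x within S. ereal a < ereal (w y)"
      using assms(3)[unfolded lsc_on_def, rule_format, OF x, of "ereal a"] by simp
    then show "\<forall>\<^sub>F y in at x within S. a < w y" by simp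
  next
    fix a assume "w x < a"
    then have "\<forall>\<^sub>F y in at x within S. ereal (w y) < ereal a"
      using assms(2)[unfolded usc_on_def, rule_format, OF x, of "ereal a"] by simp
    then show "\<forall>\<^sub>F y in at x within S. w y < a" by simp
  qed
qed

lemma extend_continuous:
  fixes w g :: "'a::metric_space \<Rightarrow> real"
  assumes S: "open S" and w: "continuous_on S w" and g: "continuous_on (frontier S) g"
    and bv: "has_boundary_value S w g"
  shows "continuous_on (closure S) (extend_by_boundary_value S w g)"
  unfolding continuous_on_def
proof
  let ?W = "extend_by_boundary_value S w g"
  have disj: "x \<notin> frontier S" if "x \<in> S" for x using S that by (auto simp: frontier_def interior_open)
  have cl: "closure S = S \<union> frontier S" using S closure_subset[of S] by (auto simp: frontier_def interior_open)
  fix x assume x: "x \<in> closure S"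
  show "(?W \<longlongrightarrow> ?W x) (at x within closure S)"
  proof (cases "x \<in> S")
    case True
    have "(w \<longlongrightarrow> w x) (at x within S)" using w True by (simp add: continuous_on_def)
    then have "(w \<longlongrightarrow> w x) (at x)" using at_within_open[OF True S] by simp
    moreover have "\<forall>\<^sub>F y in at x. w y = ?W y"
      using eventually_at_in_open'[OF S True] by eventually_elim (simp add: extend_by_boundary_value_def disj)
    ultimately have "(?W \<longlongrightarrow> w x) (at x)" by (rule Lim_transform_eventually)
    moreover have "?W x = w x" using True by (simp add: extend_by_boundary_value_def disj)
    ultimately have "(?W \<longlongrightarrow> ?W x) (at x)" by simp
    then show ?thesis by (rule tendsto_within_subset) simp
  next
    case False
    then have fr: "x \<in> frontier S" using x cl by blast
    then have Wx: "?W x = g x" by (simp add: extend_by_boundary_value_def)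
    have "(w \<longlongrightarrow> g x) (at x within S)" using bv fr by (simp add: has_boundary_value_def)
    moreover have "\<forall>\<^sub>F y in at x within S. w y = ?W y"
      unfolding eventually_at_topological by (intro exI[of _ UNIV]) (auto simp: extend_by_boundary_value_def disj)
    ultimately have 1: "(?W \<longlongrightarrow> g x) (at x within S)" by (rule Lim_transform_eventually)
    have "(g \<longlongrightarrow> g x) (at x within frontier S)" using g fr by (simp add: continuous_on_def)
    moreover have "\<forall>\<^sub>F y in at x within frontier S. g y = ?W y"
      unfolding eventually_at_topological by (intro exI[of _ UNIV]) (auto simp: extend_by_boundary_value_def)
    ultimately have 2: "(?W \<longlongrightarrow> g x) (at x within frontier S)" by (rule Lim_transform_eventually)
    show ?thesis unfolding Wx cl using Lim_Un[OF 1 2] .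
  qed
qed

lemma holder_imp_continuous:
  fixes f :: "'a::metric_space \<Rightarrow> real"
  assumes f: "holder_continuous_on \<gamma> S f" and \<gamma>: "0 < \<gamma>"
  shows "continuous_on S f"
proof -
  obtain C where C: "\<And>x y. x \<in> S \<Longrightarrow> y \<in> S \<Longrightarrow> \<bar>f x - f y\<bar> \<le> C * dist x y powr \<gamma>"
    using f unfolding holder_continuous_on_def by blast
  show ?thesis
    unfolding continuous_on_def
  proof
    fix x assume x: "x \<in> S"
    have "((\<lambda>y. dist y x) \<longlongrightarrow> 0) (at x within S)" using tendsto_dist[OF tendsto_ident_at[of x S] tendsto_const[of x]] by simp
    then have "((\<lambda>y. dist y x powr \<gamma>) \<longlongrightarrow> 0 powr \<gamma>) (at x within S)"
      by (intro tendsto_powr' tendsto_const) (use \<gamma> in auto)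
    then have "((\<lambda>y. C * dist y x powr \<gamma>) \<longlongrightarrow> C * 0) (at x within S)" by (intro tendsto_intros) simp
    then have lim: "((\<lambda>y. C * dist y x powr \<gamma>) \<longlongrightarrow> 0) (at x within S)" by simp
    have "((\<lambda>y. f y - f x) \<longlongrightarrow> 0) (at x within S)"
    proof (rule Lim_null_comparison[OF _ lim])
      show "\<forall>\<^sub>F y in at x within S. norm (f y - f x) \<le> C * dist y x powr \<gamma>"
        unfolding eventually_at_topological using C x by (intro exI[of _ UNIV]) auto
    qed
    then show "(f \<longlongrightarrow> f x) (at x within S)" by (simp add: LIM_zero_iff)
  qed
qed

text \<open>The case kappa = mu = 0 of \<open>comparison\<close>: where b < a, monotonicity gives F
  x (b x) <= F x (a x).\<close>

lemma sub_super_comparison: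
  fixes \<Omega> :: "(complex ^ 'n::finite) set" and a b :: "complex^'n \<Rightarrow> real"
  assumes \<Omega>: "open \<Omega>" "bounded \<Omega>" and m: "1 \<le> m" "m \<le> CARD('n)"
    and F: "continuous_on (\<Omega> \<times> UNIV) (\<lambda>(x, t). F x t)" "\<And>x t. x \<in> \<Omega> \<Longrightarrow> 0 \<le> F x t"
      "\<And>x. x \<in> \<Omega> \<Longrightarrow> mono (F x)"
    and ca: "continuous_on (closure \<Omega>) a" and cb: "continuous_on (closure \<Omega>) b"
    and sub: "\<And>x U q Dq D2q. x \<in> \<Omega> \<Longrightarrow> open U \<Longrightarrow> x \<in> U \<Longrightarrow> C2jet U q Dq D2q \<Longrightarrow> q x = a x \<Longrightarrow>
      (\<forall>\<^sub>F y in nhds x. a y \<le> q y) \<Longrightarrow> complex_hessian (D2q x) \<in> hsym_ge m (F x (a x))"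
    and super: "\<And>x U q Dq D2q. x \<in> \<Omega> \<Longrightarrow> open U \<Longrightarrow> x \<in> U \<Longrightarrow> C2jet U q Dq D2q \<Longrightarrow> q x = b x \<Longrightarrow>
      (\<forall>\<^sub>F y in nhds x. q y \<le> b y) \<Longrightarrow> complex_hessian (D2q x) \<in> nonneg_cone m \<Longrightarrow> Re (hsym m (complex_hessian (D2q x))) \<le> F x (b x)"
    and bdry: "\<And>\<zeta>. \<zeta> \<in> frontier \<Omega> \<Longrightarrow> a \<zeta> \<le> b \<zeta>" and x: "x \<in> closure \<Omega>"
  shows "a x \<le> b x"
proof (cases "x \<in> \<Omega>")
  case False
  then show ?thesis using bdry[of x] x \<Omega>(1) by (simp add: frontier_def interior_open)
next
  case True
  obtain R where R: "\<And>x. x \<in> \<Omega> \<Longrightarrow> norm x \<le> R" using \<Omega>(2) unfolding bounded_iff by blast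
  have ca': "continuous_on \<Omega> a" using ca closure_subset by (rule continuous_on_subset)
  have cf: "continuous_on \<Omega> (\<lambda>x. F x (a x))"
    using continuous_on_compose2[OF F(1) continuous_on_Pair[OF continuous_on_id ca']] by auto
  have couple: "root m (F x (b x)) \<le> root m (F x (a x)) + 0" if "x \<in> \<Omega>" "b x < a x" for x
    using m monoD[OF F(3)[OF that(1)], of "b x" "a x"] that by simp
  have bdry': "a \<zeta> \<le> b \<zeta> + 0" if "\<zeta> \<in> frontier \<Omega>" for \<zeta> using bdry[OF that] by simp
  have "a x \<le> b x + 0 + 0 * R\<^sup>2"
  proof (rule comparison[where m=m and D=\<Omega> and a=a and b=b and R=R and \<kappa>=0 and \<mu>=0
        and f="\<lambda>x. F x (a x)" and ?F0.0="\<lambda>x. F x (b x)"])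
    show "0 \<le> F z (a z)" if "z \<in> \<Omega>" for z by (rule F(2)[OF that])
    show "complex_hessian (D2q z) \<in> hsym_ge m (F z (a z))"
      if "z \<in> \<Omega>" "open U" "z \<in> U" "C2jet U q Dq D2q" "q z = a z" "\<forall>\<^sub>F y in nhds z. a y \<le> q y" for z U q Dq D2q
      by (rule sub[OF that])
    show "Re (hsym m (complex_hessian (D2q z))) \<le> F z (b z)"
      if "z \<in> \<Omega>" "open U" "z \<in> U" "C2jet U q Dq D2q" "q z = b z" "\<forall>\<^sub>F y in nhds z. q y \<le> b y"
        "complex_hessian (D2q z) \<in> nonneg_cone m" for z U q Dq D2q
      by (rule super[OF that])
  qed (use m \<Omega> R ca cb bdry' cf couple True in simp_all)
  then show ?thesis by simp
qed

section \<open>Holder estimate up to the boundary\<close>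

theorem theoremB:
  fixes \<Omega> :: "(complex ^ 'n::finite) set"
    and m :: nat
    and \<gamma> :: real
    and g u v w :: "complex ^ 'n \<Rightarrow> real"
    and F :: "complex ^ 'n \<Rightarrow> real \<Rightarrow> real"
  assumes "open \<Omega>" and "connected \<Omega>" and "\<Omega> \<noteq> {}" and "bounded \<Omega>"
    and "1 \<le> m" and "m \<le> CARD('n)"
    and "0 < \<gamma>" and "\<gamma> \<le> 1"
    and "continuous_on (frontier \<Omega>) g"
    and "continuous_on (\<Omega> \<times> UNIV) (\<lambda>(x, t). F x t)"
    and "\<And>x t. x \<in> \<Omega> \<Longrightarrow> 0 \<le> F x t"
    and "\<And>x. x \<in> \<Omega> \<Longrightarrow> mono (F x)"
    and "\<And>M. 0 < M \<Longrightarrow>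
           bdd_above {\<bar>root m (F x t) - root m (F y t)\<bar> / dist x y powr \<gamma> | t x y.
                        \<bar>t\<bar> \<le> M \<and> x \<in> \<Omega> \<and> y \<in> \<Omega> \<and> x \<noteq> y}"
    and "holder_continuous_on \<gamma> (closure \<Omega>) u"
    and "holder_continuous_on \<gamma> (closure \<Omega>) v"
    and "viscosity_subsolution m F \<Omega> (\<lambda>x. ereal (u x))"
    and "viscosity_supersolution m F \<Omega> (\<lambda>x. ereal (v x))"
    and "\<And>\<zeta>. \<zeta> \<in> frontier \<Omega> \<Longrightarrow> u \<zeta> = g \<zeta> \<and> v \<zeta> = g \<zeta>"
    and "viscosity_solution m F \<Omega> w"
    and "has_boundary_value \<Omega> w g"
  shows "holder_continuous_on \<gamma> (closure \<Omega>) (extend_by_boundary_value \<Omega> w g)"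
proof -
  note \<Omega> = assms(1,4) and m = assms(5,6) and \<gamma> = assms(7) and F = assms(10-12) and FH = assms(13)
  have m0: "0 < m" using m by simp
  define W where "W = extend_by_boundary_value \<Omega> w g"
  have disj: "x \<notin> frontier \<Omega>" if "x \<in> \<Omega>" for x using \<Omega>(1) that by (auto simp: frontier_def interior_open)
  have cl: "closure \<Omega> = \<Omega> \<union> frontier \<Omega>" using \<Omega>(1) closure_subset[of \<Omega>] by (auto simp: frontier_def interior_open)
  have Ww: "W x = w x" if "x \<in> \<Omega>" for x using disj[OF that] by (simp add: W_def extend_by_boundary_value_def)
  have Wg: "W x = g x" if "x \<in> frontier \<Omega>" for x using that by (simp add: W_def extend_by_boundary_value_def)
  have wsub: "viscosity_subsolution m F \<Omega> (\<lambda>x. ereal (w x))" and wsuper: "viscosity_supersolution m F \<Omega> (\<lambda>x. ereal (w x))"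
    using assms(19) by (auto simp: viscosity_solution_def)
  have cw: "continuous_on \<Omega> w"
    using usc_lsc_continuous[OF \<Omega>(1)] wsub wsuper
    unfolding viscosity_subsolution_def viscosity_supersolution_def by blast
  have cW: "continuous_on (closure \<Omega>) W"
    unfolding W_def by (rule extend_continuous[OF \<Omega>(1) cw assms(9,20)])
  have evW: "\<forall>\<^sub>F y in nhds x. W y = w y" if "x \<in> \<Omega>" for x
    using eventually_nhds_in_open[OF \<Omega>(1) that] by eventually_elim (rule Ww)
  have Wsub: "complex_hessian (D2q x) \<in> hsym_ge m (F x (W x))"
    if x: "x \<in> \<Omega>" "open U" "x \<in> U" "C2jet U q Dq D2q" and q: "q x = W x" "\<forall>\<^sub>F y in nhds x. W y \<le> q y" for x U q Dq D2q
  proof -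
    have "\<forall>\<^sub>F y in nhds x. w y \<le> q y" using q(2) evW[OF x(1)] by eventually_elim simp
    moreover have "q x = w x" using q(1) Ww[OF x(1)] by simp
    ultimately show ?thesis
      using subsolution_hsym_ge[OF wsub m(2) x _ _ F(2)[OF x(1)]] Ww[OF x(1)] by simp
  qed
  have Wsuper: "Re (hsym m (complex_hessian (D2q x))) \<le> F x (W x)"
    if x: "x \<in> \<Omega>" "open U" "x \<in> U" "C2jet U q Dq D2q" and q: "q x = W x" "\<forall>\<^sub>F y in nhds x. q y \<le> W y"
      and cone: "complex_hessian (D2q x) \<in> nonneg_cone m" for x U q Dq D2q
  proof -
    have "\<forall>\<^sub>F y in nhds x. q y \<le> w y" using q(2) evW[OF x(1)] by eventually_elim simp
    moreover have "q x = w x" using q(1) Ww[OF x(1)] by simp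
    ultimately show ?thesis
      using supersolution_hsym_le[OF wsuper m(2) x _ _ cone] Ww[OF x(1)] by simp
  qed
  have usub: "complex_hessian (D2q x) \<in> hsym_ge m (F x (u x))"
    if "x \<in> \<Omega>" "open U" "x \<in> U" "C2jet U q Dq D2q" "q x = u x" "\<forall>\<^sub>F y in nhds x. u y \<le> q y" for x U q Dq D2q
    by (rule subsolution_hsym_ge[OF assms(16) m(2) that F(2)[OF that(1)]])
  have vsuper: "Re (hsym m (complex_hessian (D2q x))) \<le> F x (v x)"
    if "x \<in> \<Omega>" "open U" "x \<in> U" "C2jet U q Dq D2q" "q x = v x" "\<forall>\<^sub>F y in nhds x. q y \<le> v y"
      "complex_hessian (D2q x) \<in> nonneg_cone m" for x U q Dq D2q
    by (rule supersolution_hsym_le[OF assms(17) m(2) that])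
  have cu: "continuous_on (closure \<Omega>) u" by (rule holder_imp_continuous[OF assms(14) \<gamma>])
  have cv: "continuous_on (closure \<Omega>) v" by (rule holder_imp_continuous[OF assms(15) \<gamma>])
  have bu: "u \<zeta> = W \<zeta>" and bv: "v \<zeta> = W \<zeta>" if "\<zeta> \<in> frontier \<Omega>" for \<zeta>
    using assms(18)[OF that] Wg[OF that] by auto
  have uW: "u x \<le> W x" if "x \<in> closure \<Omega>" for x
  proof (rule sub_super_comparison[where \<Omega>=\<Omega> and m=m and F=F and a=u and b=W])
    show "complex_hessian (D2q z) \<in> hsym_ge m (F z (u z))"
      if "z \<in> \<Omega>" "open U" "z \<in> U" "C2jet U q Dq D2q" "q z = u z" "\<forall>\<^sub>F y in nhds z. u y \<le> q y" for z U q Dq D2q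
      by (rule usub[OF that])
    show "Re (hsym m (complex_hessian (D2q z))) \<le> F z (W z)"
      if "z \<in> \<Omega>" "open U" "z \<in> U" "C2jet U q Dq D2q" "q z = W z" "\<forall>\<^sub>F y in nhds z. q y \<le> W y"
        "complex_hessian (D2q z) \<in> nonneg_cone m" for z U q Dq D2q
      by (rule Wsuper[OF that])
  qed (use \<Omega> m F cu cW bu that in simp_all)
  have Wv: "W x \<le> v x" if "x \<in> closure \<Omega>" for x
  proof (rule sub_super_comparison[where \<Omega>=\<Omega> and m=m and F=F and a=W and b=v])
    show "complex_hessian (D2q z) \<in> hsym_ge m (F z (W z))"
      if "z \<in> \<Omega>" "open U" "z \<in> U" "C2jet U q Dq D2q" "q z = W z" "\<forall>\<^sub>F y in nhds z. W y \<le> q y" for z U q Dq D2q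
      by (rule Wsub[OF that])
    show "Re (hsym m (complex_hessian (D2q z))) \<le> F z (v z)"
      if "z \<in> \<Omega>" "open U" "z \<in> U" "C2jet U q Dq D2q" "q z = v z" "\<forall>\<^sub>F y in nhds z. q y \<le> v y"
        "complex_hessian (D2q z) \<in> nonneg_cone m" for z U q Dq D2q
      by (rule vsuper[OF that])
  qed (use \<Omega> m F cW cv bv that in simp_all)
  obtain Cu where Cu: "\<And>x y. x \<in> closure \<Omega> \<Longrightarrow> y \<in> closure \<Omega> \<Longrightarrow> \<bar>u x - u y\<bar> \<le> Cu * dist x y powr \<gamma>"
    using assms(14) unfolding holder_continuous_on_def by blast
  obtain Cv where Cv: "\<And>x y. x \<in> closure \<Omega> \<Longrightarrow> y \<in> closure \<Omega> \<Longrightarrow> \<bar>v x - v y\<bar> \<le> Cv * dist x y powr \<gamma>"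
    using assms(15) unfolding holder_continuous_on_def by blast
  define C0 where "C0 = max 0 (max Cu Cv)"
  have C0: "0 \<le> C0" "Cu \<le> C0" "Cv \<le> C0" unfolding C0_def by auto
  \<comment> \<open>W lies between u and v, and all three agree at zeta.\<close>
  have at_bdry: "\<bar>W x - W \<zeta>\<bar> \<le> C0 * dist x \<zeta> powr \<gamma>" if x: "x \<in> closure \<Omega>" and \<zeta>: "\<zeta> \<in> frontier \<Omega>" for x \<zeta>
  proof -
    have \<zeta>': "\<zeta> \<in> closure \<Omega>" using \<zeta> cl by blast
    have "Cu * dist x \<zeta> powr \<gamma> \<le> C0 * dist x \<zeta> powr \<gamma>" "Cv * dist x \<zeta> powr \<gamma> \<le> C0 * dist x \<zeta> powr \<gamma>"
      using C0 by (auto intro!: mult_right_mono)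
    then show ?thesis using uW[OF x] Wv[OF x] Cu[OF x \<zeta>'] Cv[OF x \<zeta>'] bu[OF \<zeta>] bv[OF \<zeta>]
      unfolding abs_le_iff by linarith
  qed
  have compcl: "compact (closure \<Omega>)" using \<Omega> by (simp add: compact_closure)
  obtain M where M: "\<And>x. x \<in> closure \<Omega> \<Longrightarrow> norm (W x) \<le> M"
    using compact_imp_bounded[OF compact_continuous_image[OF cW compcl]] unfolding bounded_iff by blast
  obtain R where R: "\<And>x. x \<in> \<Omega> \<Longrightarrow> norm x \<le> R" using \<Omega>(2) unfolding bounded_iff by blast
  have "0 < \<bar>M\<bar> + 1" by simp
  from FH[OF this] obtain L where L: "\<And>t x y. \<bar>t\<bar> \<le> \<bar>M\<bar> + 1 \<Longrightarrow> x \<in> \<Omega> \<Longrightarrow> y \<in> \<Omega> \<Longrightarrow> x \<noteq> y \<Longrightarrow>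
      \<bar>root m (F x t) - root m (F y t)\<bar> / dist x y powr \<gamma> \<le> L"
    unfolding bdd_above_def by blast
  \<comment> \<open>One side of the estimate, from the translation by h = y - x; exchanging x and y
    gives the other.\<close>
  have half: "W y \<le> W x + (C0 + \<bar>L\<bar> * R\<^sup>2) * dist x y powr \<gamma>" if x: "x \<in> \<Omega>" and y: "y \<in> \<Omega>" and ne: "x \<noteq> y" for x y
  proof -
    define h where "h = y - x"
    define \<rho> where "\<rho> = dist x y powr \<gamma>"
    have \<rho>: "0 < \<rho>" unfolding \<rho>_def using ne by simp
    have dh: "dist (z + h) z = dist x y" for z unfolding h_def by (simp add: dist_norm norm_minus_commute)
    \<comment> \<open>The points z for which both z and z + h are in the domain. This set may be
      disconnected, which \<open>comparison\<close> allows.\<close>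
    define D where "D = \<Omega> \<inter> (\<lambda>z. z + h) -` \<Omega>"
    have cs: "continuous_on S (\<lambda>z. z + h)" for S by (intro continuous_intros)
    have D: "open D" "bounded D" "\<And>z. z \<in> D \<Longrightarrow> norm z \<le> R"
      unfolding D_def using \<Omega> R by (auto intro!: open_Int open_vimage cs intro: bounded_subset)
    have clD: "z \<in> closure \<Omega>" "z + h \<in> closure \<Omega>" if "z \<in> closure D" for z
    proof -
      show "z \<in> closure \<Omega>" using that closure_mono[of D \<Omega>] unfolding D_def by blast
      have "closed ((\<lambda>z. z + h) -` closure \<Omega>)" by (intro closed_vimage closed_closure cs)
      moreover have "D \<subseteq> (\<lambda>z. z + h) -` closure \<Omega>" unfolding D_def using closure_subset by blast
      ultimately show "z + h \<in> closure \<Omega>" using that closure_minimal by blast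
    qed
    have cWh: "continuous_on (closure D) (\<lambda>z. W (z + h))"
      by (rule continuous_on_compose2[OF cW cs]) (use clD in auto)
    have cWD: "continuous_on (closure D) W" using cW by (rule continuous_on_subset) (use clD in auto)
    have bdry: "W (\<zeta> + h) \<le> W \<zeta> + C0 * \<rho>" if "\<zeta> \<in> frontier D" for \<zeta>
    proof -
      have \<zeta>: "\<zeta> \<in> closure D" "\<zeta> \<notin> D" using that D(1) by (auto simp: frontier_def interior_open)
      then have "\<zeta> \<notin> \<Omega> \<or> \<zeta> + h \<notin> \<Omega>" unfolding D_def by blast
      \<comment> \<open>A boundary point of D either is a boundary point of the domain or is
        translated to one, and \<open>at_bdry\<close> applies with distance |h|.\<close>
      then have "\<zeta> \<in> frontier \<Omega> \<or> \<zeta> + h \<in> frontier \<Omega>" using clD[OF \<zeta>(1)] cl by blast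
      then have "\<bar>W (\<zeta> + h) - W \<zeta>\<bar> \<le> C0 * \<rho>"
      proof
        assume "\<zeta> \<in> frontier \<Omega>"
        from at_bdry[OF clD(2)[OF \<zeta>(1)] this] show ?thesis unfolding dh \<rho>_def .
      next
        assume "\<zeta> + h \<in> frontier \<Omega>"
        from at_bdry[OF clD(1)[OF \<zeta>(1)] this] show ?thesis
          unfolding dist_commute[of \<zeta>] dh \<rho>_def abs_minus_commute[of "W \<zeta>"] .
      qed
      then show ?thesis by linarith
    qed
    have inD: "z \<in> \<Omega>" "z + h \<in> \<Omega>" if "z \<in> D" for z using that unfolding D_def by auto
    have cf: "continuous_on D (\<lambda>z. F (z + h) (W (z + h)))"
    proof (rule continuous_on_compose2[OF F(1), of D "\<lambda>z. (z + h, W (z + h))", simplified])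
      show "continuous_on D (\<lambda>z. (z + h, W (z + h)))"
        by (intro continuous_on_Pair cs continuous_on_subset[OF cWh] closure_subset)
      show "(\<lambda>z. (z + h, W (z + h))) ` D \<subseteq> \<Omega> \<times> UNIV" using inD by auto
    qed
    have Fnn: "0 \<le> F (z + h) (W (z + h))" if "z \<in> D" for z by (rule F(2)[OF inD(2)[OF that]])
    have sub: "complex_hessian (D2q z) \<in> hsym_ge m (F (z + h) (W (z + h)))"
      if z: "z \<in> D" "open U" "z \<in> U" "C2jet U q Dq D2q" "q z = W (z + h)" "\<forall>\<^sub>F y in nhds z. W (y + h) \<le> q y"
      for z U q Dq D2q
    proof -
      \<comment> \<open>Testing the translate at z with q is testing W at z + h with the translated
        q.\<close>
      have "((\<lambda>y. y - h) \<longlongrightarrow> (z + h) - h) (nhds (z + h))" by (intro tendsto_intros filterlim_ident)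
      then have "filterlim (\<lambda>y. y - h) (nhds z) (nhds (z + h))" by simp
      from eventually_compose_filterlim[OF z(6) this]
      have ev: "\<forall>\<^sub>F y in nhds (z + h). W y \<le> q (y - h)" by simp
      have "z + h \<in> (+) h ` U" using z(3) by (auto simp: add.commute)
      moreover have "open ((+) h ` U)" using z(2) by (rule open_translation)
      ultimately have "complex_hessian (D2q ((z + h) - h)) \<in> hsym_ge m (F (z + h) (W (z + h)))"
        by (intro Wsub[OF inD(2)[OF z(1)] _ _ C2jet_shift[OF z(4), of h]]) (use z(5) ev in auto)
      then show ?thesis by simp
    qed
    have couple: "root m (F z (W z)) \<le> root m (F (z + h) (W (z + h))) + \<bar>L\<bar> * \<rho>"
      if z: "z \<in> D" "W z < W (z + h)" for z
    proof -
      let ?t = "W (z + h)"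
      have zh: "z \<noteq> z + h" using ne by (simp add: h_def)
      have "norm ?t \<le> M" using M inD(2)[OF z(1)] closure_subset by blast
      then have "\<bar>?t\<bar> \<le> \<bar>M\<bar> + 1" by simp
      from L[OF this inD[OF z(1)] zh]
      have "\<bar>root m (F z ?t) - root m (F (z + h) ?t)\<bar> / \<rho> \<le> \<bar>L\<bar>"
        unfolding dist_commute[of z] dh \<rho>_def by linarith
      then have "\<bar>root m (F z ?t) - root m (F (z + h) ?t)\<bar> \<le> \<bar>L\<bar> * \<rho>" using \<rho> by (simp add: pos_divide_le_eq)
      \<comment> \<open>Monotonicity raises W z to the level \<open>?t\<close>, so that both values
        of F are compared at the same second argument.\<close>
      moreover have "root m (F z (W z)) \<le> root m (F z ?t)"
        using m0 monoD[OF F(3)[OF inD(1)[OF z(1)]], of "W z" ?t] z(2) by simp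
      ultimately show ?thesis by linarith
    qed
    have "x \<in> D" unfolding D_def h_def using x y by simp
    have C0\<rho>: "0 \<le> C0 * \<rho>" "0 \<le> \<bar>L\<bar> * \<rho>" using C0 \<rho> by auto
    have "W (x + h) \<le> W x + C0 * \<rho> + \<bar>L\<bar> * \<rho> * R\<^sup>2"
    proof (rule comparison[where m=m and D=D and a="\<lambda>z. W (z + h)" and b=W and R=R and \<kappa>="C0 * \<rho>" and \<mu>="\<bar>L\<bar> * \<rho>"
          and f="\<lambda>z. F (z + h) (W (z + h))" and ?F0.0="\<lambda>z. F z (W z)"])
    show "complex_hessian (D2q z) \<in> hsym_ge m (F (z + h) (W (z + h)))"
      if "z \<in> D" "open U" "z \<in> U" "C2jet U q Dq D2q" "q z = W (z + h)" "\<forall>\<^sub>F y in nhds z. W (y + h) \<le> q y" for z U q Dq D2q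
      by (rule sub[OF that])
    show "Re (hsym m (complex_hessian (D2q z))) \<le> F z (W z)"
      if "z \<in> D" "open U" "z \<in> U" "C2jet U q Dq D2q" "q z = W z" "\<forall>\<^sub>F y in nhds z. q y \<le> W y"
        "complex_hessian (D2q z) \<in> nonneg_cone m" for z U q Dq D2q
      by (rule Wsuper[OF inD(1)[OF that(1)] that(2-)])
    qed (use m D cWh cWD bdry C0\<rho> cf Fnn couple \<open>x \<in> D\<close> in simp_all)
    then show ?thesis unfolding h_def \<rho>_def by (simp add: algebra_simps)
  qed
  show ?thesis
    unfolding holder_continuous_on_def W_def[symmetric]
  proof (intro exI ballI)
    fix x y assume x: "x \<in> closure \<Omega>" and y: "y \<in> closure \<Omega>"
    let ?C = "C0 + \<bar>L\<bar> * R\<^sup>2"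
    have le: "C0 * dist x y powr \<gamma> \<le> ?C * dist x y powr \<gamma>" by (intro mult_right_mono) auto
    consider "x = y" | "x \<in> frontier \<Omega>" | "y \<in> frontier \<Omega>" | "x \<noteq> y" "x \<in> \<Omega>" "y \<in> \<Omega>" using x y cl by blast
    then show "\<bar>W x - W y\<bar> \<le> ?C * dist x y powr \<gamma>"
    proof cases
      case 1
      then show ?thesis by simp
    next
      case 2
      then show ?thesis using at_bdry[OF y 2] le by (simp add: dist_commute abs_minus_commute)
    next
      case 3
      then show ?thesis using at_bdry[OF x 3] le by simp
    next
      case 4
      then show ?thesis using half[OF 4(2,3,1)] half[OF 4(3,2)] by (simp add: dist_commute abs_le_iff)
    qed
  qed
qed

end
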